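(* Let $\mathbb{F}$ be a field and let $\Delta$ be a pure $(d-1)$-dimensional simplicial complex with $h$-vector $h(\Delta)=(h_0(\Delta),\dots,h_d(\Delta))$. The vector $\gamma(R_{\Delta})=(\gamma_0(R_\Delta),\dots,\gamma_{\lfloor (d+1)/2\rfloor}(R_\Delta))$ is given by $\gamma_0(R_{\Delta}) = 1$, $$\gamma_1(R_{\Delta}) = 2h_1(\Delta) + \sum_{k=2}^{d}h_k(\Delta),$$ and $$\gamma_i(R_{\Delta})=(-1)^{i-1}\sum_{k=2i-1}^d \left(\binom{k-i}{i-1} + \binom{k-i-1}{i-2}\right)h_k(\Delta)$$ for $2 \leq i \leq \lfloor\frac{d+1}{2}\rfloor$. In particular, if $h(\Delta)$ has nonnegative entries, then $(-1)^{i-1}\gamma_i(R_{\Delta})\geq 0$ for every $1\leq i\leq \lfloor\frac{d+1}{2}\rfloor$.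
   Context: Simplicial complexes. A simplicial complex $\Delta$ on $[n]=\{1,\dots,n\}$ is a nonempty collection of subsets of $[n]$ closed under inclusion. Inclusion-maximal elements are facets; $\dim F=|F|-1$, $\dim\Delta$ is the maximal dimension of an element, and $\Delta$ is pure if all facets have the same dimension. The Stanley--Reisner ideal of $\Delta$ is $I_\Delta=(\prod_{i\in F}x_i : F\subseteq [n],\, F\notin\Delta)\subseteq\mathbb{F}[x_1,\dots,x_n]$. If $\dim\Delta=d-1$ and $f_{j}$ is the number of $j$-dimensional faces ($f_{-1}=1$), the $h$-vector of $\Delta$ is given by $h_i(\Delta)=\sum_{j=0}^{i}(-1)^{i-j}\binom{d-j}{d-i}f_{j-1}$, $0\le i\le d$. The algebra $R_\Delta$. Let $\Delta$ be a pure $(d-1)$-dimensional simplicial complex on $[n]$, let $S=\mathbb{F}[x_1,\dots,x_n,y_1,\dots,y_n]$ be standard graded, and let $\mathbb{F}[\Gamma]=S/I_\Gamma$ with $I_\Gamma=I_\Delta S+(x_iy_i : i\in[n])$; $\mathbb{F}[\Gamma]$ is Cohen--Macaulay of Krull dimension $n$. Let $\omega=\mathrm{Ext}^n_S(\mathbb{F}[\Gamma],S(-2n))$ be its graded canonical module. For a ring $A$ and an $A$-module $M$, the idealization $A\ltimes M$ is $A\oplus M$ with multiplication $(a_1,m_1)(a_2,m_2)=(a_1a_2,a_1m_2+a_2m_1)$, graded by $(A\ltimes M)_j=A_j\oplus M_j$. Then $R_\Delta:=\mathbb{F}[\Gamma]\ltimes\omega(n-d-1)$, where $M(a)_j=M_{a+j}$;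 it is a standard graded Gorenstein $\mathbb{F}$-algebra, and its $h$-polynomial has degree $d+1$. $\gamma$-vector. The $h$-vector $(h_0,\dots,h_s)$ of a standard graded algebra $A$ of Krull dimension $D$ is defined by $\mathrm{Hilb}(A,t)=(\sum_{i=0}^s h_it^i)/(1-t)^D$, with $h_s\ne 0$. If $A$ is Gorenstein, then $h_i=h_{s-i}$ and $\gamma(A)=(\gamma_0,\dots,\gamma_{\lfloor s/2\rfloor})$ is the unique integer vector with $\sum_{i=0}^{\lfloor s/2\rfloor}\gamma_it^i(t+1)^{s-2i}=\sum_{i=0}^s h_it^i$. *)

theory Defs
  imports
    "HOL-Algebra.QuotRing"
    "HOL-Algebra.Module"
    "HOL-Algebra.Embedded_Algebras"
    "HOL-Computational_Algebra.Polynomial_FPS"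
    "HOL-Library.Poly_Mapping"
    "HOL-Library.Extended_Nat"
begin

section \<open>Simplicial complexes\<close>

definition simplicial_complex_on :: "nat \<Rightarrow> nat set set \<Rightarrow> bool" where
  "simplicial_complex_on n \<Delta> \<longleftrightarrow>
     \<Delta> \<noteq> {} \<and> \<Delta> \<subseteq> Pow {1..n} \<and> (\<forall>F\<in>\<Delta>. \<forall>G. G \<subseteq> F \<longrightarrow> G \<in> \<Delta>)"

definition facets :: "nat set set \<Rightarrow> nat set set" where
  "facets \<Delta> = {F \<in> \<Delta>. \<forall>G\<in>\<Delta>. F \<subseteq> G \<longrightarrow> G = F}"

definition face_dim :: "nat set \<Rightarrow> int" where
  "face_dim F = int (card F) - 1"

definition complex_dim :: "nat set set \<Rightarrow> int" where
  "complex_dim \<Delta> = Max (face_dim ` \<Delta>)"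

definition pure_complex :: "nat set set \<Rightarrow> bool" where
  "pure_complex \<Delta> \<longleftrightarrow> (\<forall>F\<in>facets \<Delta>. \<forall>G\<in>facets \<Delta>. face_dim F = face_dim G)"

definition f_vector :: "nat set set \<Rightarrow> int \<Rightarrow> nat" where
  "f_vector \<Delta> j = card {F \<in> \<Delta>. face_dim F = j}"

definition h_vector :: "nat set set \<Rightarrow> nat \<Rightarrow> int" where
  "h_vector \<Delta> i =
     (let d = nat (complex_dim \<Delta> + 1) in
        \<Sum>j=0..i. (-1) ^ (i - j) * int ((d - j) choose (d - i)) * int (f_vector \<Delta> (int j - 1)))"


section \<open>Polynomial rings and graded pieces\<close>

text \<open>
  A monomial is an exponent function of finite support, and a polynomial is a finitely supported
  family of coefficients indexed by monomials. The variables are indexed by natural numbers; the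
  polynomial ring in the variables from a set \<open>V\<close> has as carrier the polynomials in which
  only variables from \<open>V\<close> occur.
\<close>

type_synonym 'f mpoly = "(nat \<Rightarrow>\<^sub>0 nat) \<Rightarrow>\<^sub>0 'f"

definition mono_deg :: "(nat \<Rightarrow>\<^sub>0 nat) \<Rightarrow> nat" where
  "mono_deg m = (\<Sum>v\<in>Poly_Mapping.keys m. Poly_Mapping.lookup m v)"

definition Const :: "'f::field \<Rightarrow> 'f mpoly" where
  "Const c = Poly_Mapping.single 0 c"

definition Var :: "nat \<Rightarrow> 'f::field mpoly" where
  "Var v = Poly_Mapping.single (Poly_Mapping.single v 1) 1"

definition poly_ring :: "nat set \<Rightarrow> 'f::field mpoly ring" where
  "poly_ring V =
     \<lparr>carrier = {p. \<forall>m\<in>Poly_Mapping.keys p. Poly_Mapping.keys m \<subseteq> V},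
      monoid.mult = (*), one = 1, zero = 0, add = (+)\<rparr>"

definition homog :: "nat set \<Rightarrow> int \<Rightarrow> 'f::field mpoly set" where
  "homog V j = {p \<in> carrier (poly_ring V). \<forall>m\<in>Poly_Mapping.keys p. int (mono_deg m) = j}"


section \<open>Modules\<close>

text \<open>
  The record of modules extends the record of rings, but the fields \<open>mult\<close> and
  \<open>one\<close> play no role for modules; they are left undefined below.
\<close>

definition regular_module :: "('a, 'm) ring_scheme \<Rightarrow> ('a, 'a) module" where
  "regular_module R =
     \<lparr>carrier = carrier R, monoid.mult = undefined, one = undefined, zero = \<zero>\<^bsub>R\<^esub>, add = add R,
      module.smult = monoid.mult R\<rparr>"

text \<open>
  The free module with \<open>b\<close> basis elements; vectors are functions on the index set
  \<open>{..<b}\<close>, extended by \<open>0\<close>.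
\<close>

definition free_module :: "nat set \<Rightarrow> nat \<Rightarrow> ('f::field mpoly, nat \<Rightarrow> 'f mpoly) module" where
  "free_module V b =
     \<lparr>carrier = {v. (\<forall>i<b. v i \<in> carrier (poly_ring V)) \<and> (\<forall>i\<ge>b. v i = 0)},
      monoid.mult = undefined, one = undefined, zero = (\<lambda>_. 0), add = (\<lambda>v w i. v i + w i),
      module.smult = (\<lambda>p v i. p * v i)\<rparr>"

definition quot_module :: "('a, 'b) module \<Rightarrow> 'b set \<Rightarrow> ('a, 'b set) module" where
  "quot_module M N =
     \<lparr>carrier = a_rcosets\<^bsub>M\<^esub> N, monoid.mult = undefined, one = undefined, zero = N, add = set_add M,
      module.smult = (\<lambda>p W. \<Union>w\<in>W. N +>\<^bsub>M\<^esub> (p \<odot>\<^bsub>M\<^esub> w))\<rparr>"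

text \<open>
  A module over \<open>R\<close> that is annihilated by an ideal \<open>I\<close>, regarded as a module over
  \<open>R Quot I\<close>: all elements of a residue class act in the same way.
\<close>

definition residue_scalars :: "('a, 'b) module \<Rightarrow> ('a set, 'b) module" where
  "residue_scalars M =
     \<lparr>carrier = carrier M, monoid.mult = undefined, one = undefined, zero = \<zero>\<^bsub>M\<^esub>, add = add M,
      module.smult = (\<lambda>a x. the_elem ((\<lambda>p. p \<odot>\<^bsub>M\<^esub> x) ` a))\<rparr>"

definition idealization :: "('a, 'm) ring_scheme \<Rightarrow> ('a, 'b) module \<Rightarrow> ('a \<times> 'b) ring" where
  "idealization A M =
     \<lparr>carrier = carrier A \<times> carrier M,
      monoid.mult = (\<lambda>(a1, m1) (a2, m2). (a1 \<otimes>\<^bsub>A\<^esub> a2, (a1 \<odot>\<^bsub>M\<^esub> m2) \<oplus>\<^bsub>M\<^esub> (a2 \<odot>\<^bsub>M\<^esub> m1))),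
      one = (\<one>\<^bsub>A\<^esub>, \<zero>\<^bsub>M\<^esub>),
      zero = (\<zero>\<^bsub>A\<^esub>, \<zero>\<^bsub>M\<^esub>),
      add = (\<lambda>(a1, m1) (a2, m2). (a1 \<oplus>\<^bsub>A\<^esub> a2, m1 \<oplus>\<^bsub>M\<^esub> m2))\<rparr>"


section \<open>Graded free resolutions and Ext\<close>

text \<open>
  A resolution \<open>\<dots> \<rightarrow> F\<^sub>2 \<rightarrow> F\<^sub>1 \<rightarrow> F\<^sub>0 \<rightarrow> M \<rightarrow> 0\<close> over \<open>S\<close> by graded free modules of finite
  rank: \<open>F\<^sub>k\<close> is the direct sum of the modules \<open>S(- bdeg k j)\<close> over all \<open>j < rank k\<close>, so that its
  \<open>j\<close>-th basis element has degree \<open>bdeg k j\<close>; the matrix \<open>diff k\<close>, with entries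
  \<open>diff k r c\<close> in row \<open>r\<close> and column \<open>c\<close>, describes the map \<open>F\<^sub>k\<^sub>+\<^sub>1 \<rightarrow> F\<^sub>k\<close>; and \<open>aug j\<close> is
  the image in \<open>M\<close> of the \<open>j\<close>-th basis element of \<open>F\<^sub>0\<close>. For a finite set \<open>V\<close> of variables the
  ring \<open>S\<close> is noetherian, so every finitely generated graded module has such a resolution, and Ext
  does not depend on its choice up to graded isomorphism.
\<close>

record ('p, 'b) resolution =
  rank :: "nat \<Rightarrow> nat"
  bdeg :: "nat \<Rightarrow> nat \<Rightarrow> int"
  diff :: "nat \<Rightarrow> nat \<Rightarrow> nat \<Rightarrow> 'p"
  aug :: "nat \<Rightarrow> 'b"

definition diff_map ::
    "('f::field mpoly, 'b) resolution \<Rightarrow> nat \<Rightarrow> (nat \<Rightarrow> 'f mpoly) \<Rightarrow> nat \<Rightarrow> 'f mpoly" where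
  "diff_map \<rho> k v = (\<lambda>r. if r < rank \<rho> k then (\<Sum>c<rank \<rho> (Suc k). diff \<rho> k r c * v c) else 0)"

definition aug_map ::
    "('f::field mpoly, 'b) module \<Rightarrow> ('f mpoly, 'b) resolution \<Rightarrow> (nat \<Rightarrow> 'f mpoly) \<Rightarrow> 'b" where
  "aug_map M \<rho> v = finsum M (\<lambda>j. v j \<odot>\<^bsub>M\<^esub> aug \<rho> j) {..<rank \<rho> 0}"

definition graded_free_resolution ::
    "nat set \<Rightarrow> ('f::field mpoly, 'b) module \<Rightarrow> (int \<Rightarrow> 'b set) \<Rightarrow> ('f mpoly, 'b) resolution \<Rightarrow> bool" where
  "graded_free_resolution V M grM \<rho> \<longleftrightarrow>
     (\<forall>j<rank \<rho> 0. aug \<rho> j \<in> grM (bdeg \<rho> 0 j)) \<and>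
     (\<forall>k. \<forall>r<rank \<rho> k. \<forall>c<rank \<rho> (Suc k).
        diff \<rho> k r c \<in> homog V (bdeg \<rho> (Suc k) c - bdeg \<rho> k r)) \<and>
     aug_map M \<rho> ` carrier (free_module V (rank \<rho> 0)) = carrier M \<and>
     {v \<in> carrier (free_module V (rank \<rho> 0)). aug_map M \<rho> v = \<zero>\<^bsub>M\<^esub>} =
        diff_map \<rho> 0 ` carrier (free_module V (rank \<rho> 1)) \<and>
     (\<forall>k. {v \<in> carrier (free_module V (rank \<rho> (Suc k))). diff_map \<rho> k v = (\<lambda>_. 0)} =
        diff_map \<rho> (Suc k) ` carrier (free_module V (rank \<rho> (Suc (Suc k)))))"

text \<open>
  A homomorphism \<open>F\<^sub>k \<rightarrow> S\<close> is identified with the vector of its values on the basis, so that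
  the coboundary map is given by the transposed matrix.
\<close>

definition codiff_map ::
    "('f::field mpoly, 'b) resolution \<Rightarrow> nat \<Rightarrow> (nat \<Rightarrow> 'f mpoly) \<Rightarrow> nat \<Rightarrow> 'f mpoly" where
  "codiff_map \<rho> k w = (\<lambda>c. if c < rank \<rho> (Suc k) then (\<Sum>r<rank \<rho> k. diff \<rho> k r c * w r) else 0)"

definition cocycles :: "nat set \<Rightarrow> ('f::field mpoly, 'b) resolution \<Rightarrow> nat \<Rightarrow> (nat \<Rightarrow> 'f mpoly) set" where
  "cocycles V \<rho> k = {w \<in> carrier (free_module V (rank \<rho> k)). codiff_map \<rho> k w = (\<lambda>_. 0)}"

definition coboundaries ::
    "nat set \<Rightarrow> ('f::field mpoly, 'b) resolution \<Rightarrow> nat \<Rightarrow> (nat \<Rightarrow> 'f mpoly) set" where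
  "coboundaries V \<rho> k =
     (case k of 0 \<Rightarrow> {\<lambda>_. 0} | Suc i \<Rightarrow> codiff_map \<rho> i ` carrier (free_module V (rank \<rho> i)))"

definition Ext ::
    "nat set \<Rightarrow> ('f::field mpoly, 'b) resolution \<Rightarrow> nat \<Rightarrow> ('f mpoly, (nat \<Rightarrow> 'f mpoly) set) module" where
  "Ext V \<rho> k =
     quot_module (free_module V (rank \<rho> k)\<lparr>carrier := cocycles V \<rho> k\<rparr>) (coboundaries V \<rho> k)"

text \<open>
  The grading of \<open>Ext\<^sup>k(M, S(a))\<close>: a homomorphism \<open>F\<^sub>k \<rightarrow> S(a)\<close> is homogeneous of
  degree \<open>j\<close> if it maps the \<open>r\<close>-th basis element into \<open>S(a)\<^bsub>j + bdeg k r\<^esub> = S\<^bsub>j + bdeg k r + a\<^esub>\<close>.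
\<close>

definition Ext_grade ::
    "nat set \<Rightarrow> ('f::field mpoly, 'b) resolution \<Rightarrow> nat \<Rightarrow> int \<Rightarrow> int \<Rightarrow> (nat \<Rightarrow> 'f mpoly) set set" where
  "Ext_grade V \<rho> k a j =
     {coboundaries V \<rho> k +>\<^bsub>free_module V (rank \<rho> k)\<^esub> w | w.
        w \<in> cocycles V \<rho> k \<and> (\<forall>r<rank \<rho> k. w r \<in> homog V (j + bdeg \<rho> k r + a))}"


section \<open>Graded algebras, h-vectors and gamma-vectors\<close>

text \<open>\<open>ground\<close> is the copy of the ground field inside the algebra.\<close>

record 'a graded_algebra = "'a ring" +
  ground :: "'a set"
  grade :: "int \<Rightarrow> 'a set"

definition krull_dim :: "('a, 'm) ring_scheme \<Rightarrow> enat" where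
  "krull_dim R =
     Sup {enat k | k. \<exists>P. (\<forall>i\<le>k. primeideal (P i) R) \<and> (\<forall>i<k. P i \<subset> P (Suc i))}"

text \<open>Meant for algebras without elements of negative degree, as all standard graded algebras.\<close>

definition hilbert_series :: "'a graded_algebra \<Rightarrow> int fps" where
  "hilbert_series A = Abs_fps (\<lambda>j. int (ring.dim A (ground A) (grade A (int j))))"

text \<open>
  The h-vector is the list of coefficients of this polynomial; its last index \<open>s\<close> is the degree,
  as the top coefficient is nonzero.
\<close>

definition h_polynomial :: "'a graded_algebra \<Rightarrow> int poly" where
  "h_polynomial A =
     (THE p. hilbert_series A * (1 - fps_X) ^ the_enat (krull_dim A) = fps_of_poly p)"

definition gamma_vector :: "'a graded_algebra \<Rightarrow> int list" where
  "gamma_vector A =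
     (let s = Polynomial.degree (h_polynomial A) in
        THE g. length g = s div 2 + 1 \<and>
          (\<Sum>i=0..s div 2. Polynomial.smult (g ! i) ([:0, 1:] ^ i * [:1, 1:] ^ (s - 2 * i))) =
            h_polynomial A)"


section \<open>The algebra \<open>R\<^sub>\<Delta>\<close>\<close>

text \<open>The polynomial ring \<open>S\<close> has the variables \<open>1, \<dots>, 2n\<close>, where
  \<open>x\<^sub>i\<close> is the variable \<open>i\<close> and \<open>y\<^sub>i\<close> is the variable \<open>n + i\<close>.\<close>

abbreviation x_var :: "nat \<Rightarrow> 'f::field mpoly" where
  "x_var i \<equiv> Var i"

abbreviation y_var :: "nat \<Rightarrow> nat \<Rightarrow> 'f::field mpoly" where
  "y_var n i \<equiv> Var (n + i)"

abbreviation S_ring :: "nat \<Rightarrow> 'f::field mpoly ring" where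
  "S_ring n \<equiv> poly_ring {1..2 * n}"

definition SR_ideal :: "nat \<Rightarrow> nat set set \<Rightarrow> 'f::field mpoly set" where
  "SR_ideal n \<Delta> = genideal (poly_ring {1..n}) {\<Prod>i\<in>F. x_var i | F. F \<subseteq> {1..n} \<and> F \<notin> \<Delta>}"

definition Gamma_ideal :: "nat \<Rightarrow> nat set set \<Rightarrow> 'f::field mpoly set" where
  "Gamma_ideal n \<Delta> =
     genideal (S_ring n) (SR_ideal n \<Delta>) <+>\<^bsub>S_ring n\<^esub>
     genideal (S_ring n) {x_var i * y_var n i | i. i \<in> {1..n}}"

definition Gamma_ring :: "nat \<Rightarrow> nat set set \<Rightarrow> 'f::field mpoly set ring" where
  "Gamma_ring n \<Delta> = S_ring n Quot Gamma_ideal n \<Delta>"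

definition Gamma_grade :: "nat \<Rightarrow> nat set set \<Rightarrow> int \<Rightarrow> 'f::field mpoly set set" where
  "Gamma_grade n \<Delta> j = (\<lambda>p. Gamma_ideal n \<Delta> +>\<^bsub>S_ring n\<^esub> p) ` homog {1..2 * n} j"

definition Gamma_module :: "nat \<Rightarrow> nat set set \<Rightarrow> ('f::field mpoly, 'f mpoly set) module" where
  "Gamma_module n \<Delta> = quot_module (regular_module (S_ring n)) (Gamma_ideal n \<Delta>)"

text \<open>
  The canonical module \<open>\<omega> = Ext\<^sup>n(M, S(-2n))\<close> of \<open>M = S / I\<close> with \<open>I = Gamma_ideal n \<Delta>\<close>,
  computed from a graded free resolution \<open>\<rho>\<close> of \<open>M\<close> over \<open>S\<close>.
\<close>

definition omega ::
    "nat \<Rightarrow> ('f::field mpoly, 'b) resolution \<Rightarrow> ('f mpoly set, (nat \<Rightarrow> 'f mpoly) set) module" where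
  "omega n \<rho> = residue_scalars (Ext {1..2 * n} \<rho> n)"

definition omega_grade ::
    "nat \<Rightarrow> ('f::field mpoly, 'b) resolution \<Rightarrow> int \<Rightarrow> (nat \<Rightarrow> 'f mpoly) set set" where
  "omega_grade n \<rho> j = Ext_grade {1..2 * n} \<rho> n (- 2 * int n) j"

text \<open>With \<open>d = complex_dim \<Delta> + 1\<close>, the module \<open>\<omega>\<close> is shifted by \<open>n - d - 1\<close>.\<close>

definition R_Delta ::
    "nat \<Rightarrow> nat set set \<Rightarrow> ('f::field mpoly, 'b) resolution \<Rightarrow>
       ('f mpoly set \<times> (nat \<Rightarrow> 'f mpoly) set) graded_algebra" where
  "R_Delta n \<Delta> \<rho> =
     ring.extend (idealization (Gamma_ring n \<Delta>) (omega n \<rho>))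
       \<lparr>ground = range (\<lambda>c. (Gamma_ideal n \<Delta> +>\<^bsub>S_ring n\<^esub> Const c, \<zero>\<^bsub>omega n \<rho>\<^esub>)),
        grade = (\<lambda>j. Gamma_grade n \<Delta> j \<times>
                      omega_grade n \<rho> ((int n - (complex_dim \<Delta> + 1) - 1) + j))\<rparr>"

end

(*
  Write M = S/I for I the ideal of Gamma. The h-polynomial of R_Delta is the sum of t^|F| + t^(d+1-|F|)
  over all faces F of Delta. The summand t^|F| counts the monomials outside I whose x-support is F.

  For the canonical module, J = (x_1 y_1, ..., x_n y_n) is generated by a regular sequence of length n
  inside I. Since M is annihilated by it, every element of the sequence induces a long exact sequence
  in which multiplication is zero, and so dimension shifting gives
    Ext^n(M, S(-2n)) = Hom(M, S/J) = (J : I)/J,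
  up to degree shifts that cancel. The right hand side has a basis of monomials, namely those whose x-
  and y-support are disjoint and for which the complement of the y-support is a face. In terms of
  cocycles, Z i k and B i k stand for the cocycles and coboundaries that compute
  Ext^i(M, S/J_k), where J_k is generated by the first k elements of the sequence.

  The Krull dimension is n: a chain of k + 1 primes forces at least (t choose k) independent elements of
  degree at most E t for a constant E, whereas the monomials outside I grow only like t^n.

  In terms of the h-vector the h-polynomial is the sum of h_k (t^k + t) (1+t)^(d-k), and 1 + t^m is
  expanded in the powers of t and 1 + t.
*)

theory Submission
  imports Defs "HOL-Library.Function_Algebras"
begin

section \<open>Polynomials with prescribed monomials\<close>

text \<open>The resolution \<open>\<rho>\<close> is arbitrary, so no explicit complex is at hand and
  every fact about Ext has to come out of exactness alone. For \<open>f\<close> in \<open>I\<close>,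
  exactness yields a homotopy from multiplication by \<open>f\<close> to zero; its transpose shows
  that \<open>f\<close> kills the cohomology with coefficients in \<open>S/J k\<close>. This gives
  the surjectivity of the connecting maps and, as \<open>f\<close> can be chosen to be a
  nonzerodivisor on \<open>S/J k\<close>, the vanishing of Ext^i(M, S/J_k) for i + k < n, hence
  their injectivity. A Hilbert series asks only for dimensions, so what travels along the connecting
  maps is, degree by degree, a basis modulo coboundaries (\<open>basis_mod\<close>). The two
  exponents of a face F arise as follows. The set of all x_i with i in F and y_i with i not in F is
  a facet of \<Gamma> with n vertices. A monomial outside \<open>I\<close> is assigned to its
  x-support F and must use all of F: exponent |F|. A monomial of the canonical module is assigned to
  the complement F of its y-support and must use every y_i with i not in F: exponent n - |F|, which
  the shift by n - d - 1 turns into d + 1 - |F|.\<close>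

abbreviation lookup :: "('a \<Rightarrow>\<^sub>0 'b::zero) \<Rightarrow> 'a \<Rightarrow> 'b" where
  "lookup \<equiv> Poly_Mapping.lookup"

abbreviation keys :: "('a \<Rightarrow>\<^sub>0 'b::zero) \<Rightarrow> 'a set" where
  "keys \<equiv> Poly_Mapping.keys"

abbreviation single :: "'a \<Rightarrow> 'b \<Rightarrow> 'a \<Rightarrow>\<^sub>0 'b::zero" where
  "single \<equiv> Poly_Mapping.single"

definition supported :: "('a \<Rightarrow> bool) \<Rightarrow> ('a \<Rightarrow>\<^sub>0 'b::zero) set" where
  "supported P = {p. \<forall>m\<in>keys p. P m}"

definition restr :: "('a \<Rightarrow> bool) \<Rightarrow> ('a \<Rightarrow>\<^sub>0 'b::zero) \<Rightarrow> ('a \<Rightarrow>\<^sub>0 'b)" where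
  "restr P p = Poly_Mapping.mapp (\<lambda>m c. c when P m) p"

lemma supported_iff: "p \<in> supported P \<longleftrightarrow> (\<forall>m. lookup p m \<noteq> 0 \<longrightarrow> P m)"
  by (auto simp: supported_def in_keys_iff)

lemma supportedD: "p \<in> supported P \<Longrightarrow> lookup p m \<noteq> 0 \<Longrightarrow> P m"
  by (simp add: supported_iff)

lemma supported_mono: "p \<in> supported P \<Longrightarrow> (\<And>m. P m \<Longrightarrow> Q m) \<Longrightarrow> p \<in> supported Q"
  by (auto simp: supported_def)

lemma supported_conj: "p \<in> supported P \<Longrightarrow> p \<in> supported Q \<Longrightarrow> p \<in> supported (\<lambda>m. P m \<and> Q m)"
  by (auto simp: supported_def)

lemma supported_zero [simp, intro]: "0 \<in> supported P"
  by (simp add: supported_def)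

lemma supported_add: "p \<in> supported P \<Longrightarrow> q \<in> supported P \<Longrightarrow> p + q \<in> supported P"
  using keys_add[of p q] by (auto simp: supported_def)

lemma supported_uminus: "p \<in> supported P \<Longrightarrow> - p \<in> supported P"
  for p :: "'a \<Rightarrow>\<^sub>0 'b::ab_group_add"
  by (simp add: supported_iff)

lemma supported_diff: "p \<in> supported P \<Longrightarrow> q \<in> supported P \<Longrightarrow> p - q \<in> supported P"
  for p q :: "'a \<Rightarrow>\<^sub>0 'b::ab_group_add"
  using supported_add[of p P "- q"] supported_uminus[of q P] by simp

lemma supported_sum: "(\<And>x. x \<in> X \<Longrightarrow> f x \<in> supported P) \<Longrightarrow> sum f X \<in> supported P"
  by (induction X rule: infinite_finite_induct) (auto intro: supported_add)

lemma supported_single: "P m \<Longrightarrow> single m c \<in> supported P"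
  by (simp add: supported_def)

lemma supported_mult:
  fixes p q :: "'a::monoid_add \<Rightarrow>\<^sub>0 'b::semiring_0"
  assumes "p \<in> supported P" "q \<in> supported Q" "\<And>m m'. P m \<Longrightarrow> Q m' \<Longrightarrow> T (m + m')"
  shows "p * q \<in> supported T"
  using assms keys_mult[of p q] unfolding supported_def by blast

lemma supported_False: "p \<in> supported (\<lambda>_. False) \<longleftrightarrow> p = 0"
  by (auto simp: supported_def)

lemma supported_disjoint:
  assumes "p \<in> supported P" "p \<in> supported Q" "\<And>m. P m \<Longrightarrow> Q m \<Longrightarrow> False"
  shows "p = 0"
  using assms by (metis poly_mapping_eqI lookup_zero supported_iff)

lemma lookup_restr: "lookup (restr P p) m = (if P m then lookup p m else 0)"
  by (auto simp: restr_def lookup_mapp in_keys_iff when_def)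

lemma restr_zero [simp]: "restr P 0 = 0"
  by (rule poly_mapping_eqI) (simp add: lookup_restr)

lemma restr_add: "restr P (p + q) = restr P p + restr P q"
  by (rule poly_mapping_eqI) (simp add: lookup_restr lookup_add)

lemma restr_diff: "restr P (p - q) = restr P p - restr P q"
  for p q :: "'a \<Rightarrow>\<^sub>0 'b::ab_group_add"
  by (rule poly_mapping_eqI) (simp add: lookup_restr lookup_minus)

lemma restr_sum: "restr P (sum f X) = (\<Sum>x\<in>X. restr P (f x))"
  by (induction X rule: infinite_finite_induct) (auto simp: restr_add)

lemma restr_in_supported: "restr P p \<in> supported P"
  by (simp add: supported_iff lookup_restr)

lemma restr_preserves_supported: "p \<in> supported Q \<Longrightarrow> restr P p \<in> supported Q"
  by (auto simp: supported_iff lookup_restr)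

lemma restr_ident: "p \<in> supported P \<Longrightarrow> restr P p = p"
  by (rule poly_mapping_eqI) (auto simp: supported_iff lookup_restr)

lemma restr_eq_zero: "p \<in> supported Q \<Longrightarrow> (\<And>m. P m \<Longrightarrow> Q m \<Longrightarrow> False) \<Longrightarrow> restr P p = 0"
  by (rule poly_mapping_eqI) (auto simp: supported_iff lookup_restr)

lemma diff_restr_supported: "p - restr P p \<in> supported (\<lambda>m. \<not> P m)"
  for p :: "'a \<Rightarrow>\<^sub>0 'b::ab_group_add"
  by (auto simp: supported_iff lookup_restr lookup_minus)

text \<open>Split \<open>q\<close> into \<open>restr Q q\<close> and a remainder: multiplication by
  \<open>p\<close> sends the first part into \<open>T\<close> and the second outside of it. The main
  instance is the homogeneous component of a product with a homogeneous factor.\<close>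

lemma restr_mult_eq:
  fixes p q :: "'a::monoid_add \<Rightarrow>\<^sub>0 'b::ring"
  assumes "p \<in> supported P"
    and "\<And>m m'. P m \<Longrightarrow> Q m' \<longleftrightarrow> T (m + m')"
  shows "restr T (p * q) = p * restr Q q"
proof -
  have "p * q = p * restr Q q + p * (q - restr Q q)"
    by (simp add: algebra_simps)
  moreover have "restr T (p * restr Q q) = p * restr Q q"
    by (intro restr_ident supported_mult[OF assms(1) restr_in_supported]) (simp add: assms(2))
  moreover have "p * (q - restr Q q) \<in> supported (\<lambda>m. \<not> T m)"
    by (intro supported_mult[OF assms(1) diff_restr_supported]) (simp add: assms(2))
  then have "restr T (p * (q - restr Q q)) = 0"
    by (rule restr_eq_zero) auto
  ultimately show ?thesis
    by (simp add: restr_add)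
qed

text \<open>The monomials violating \<open>Q\<close> absorb products, so discarding them is a ring
  homomorphism. This later proves that ideals generated by variables are prime.\<close>

lemma restr_mult_hom:
  fixes p q :: "'a::monoid_add \<Rightarrow>\<^sub>0 'b::ring"
  assumes "\<And>m m'. Q (m + m') \<longleftrightarrow> Q m \<and> Q m'"
  shows "restr Q (p * q) = restr Q p * restr Q q"
proof -
  have "(p - restr Q p) * q \<in> supported (\<lambda>m. \<not> Q m)"
    by (rule supported_mult[where Q = "\<lambda>_. True", OF diff_restr_supported])
      (auto simp: assms supported_def)
  then have 1: "restr Q ((p - restr Q p) * q) = 0"
    by (rule restr_eq_zero) auto
  have 2: "restr Q (restr Q p * q) = restr Q p * restr Q q"
    by (rule restr_mult_eq[OF restr_in_supported]) (simp add: assms)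
  have "p * q = (p - restr Q p) * q + restr Q p * q"
    by (simp add: algebra_simps)
  then show ?thesis
    by (simp only: restr_add 1 2 add_0)
qed

lemma lookup_single_mult:
  fixes q :: "'a::cancel_comm_monoid_add \<Rightarrow>\<^sub>0 'b::semiring_1"
  shows "lookup (single a 1 * q) (a + m) = lookup q m"
  by (simp add: lookup_mult lookup_single when_mult)

text \<open>A monomial factor merely translates exponents. Colon computations with monomials thereby
  become conditions on single exponents.\<close>

lemma supported_single_mult_iff:
  fixes q :: "'a::cancel_comm_monoid_add \<Rightarrow>\<^sub>0 'b::semiring_1"
  shows "single a 1 * q \<in> supported P \<longleftrightarrow> q \<in> supported (\<lambda>m. P (a + m))"
proof
  assume "single a 1 * q \<in> supported P"
  then show "q \<in> supported (\<lambda>m. P (a + m))"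
    unfolding supported_iff using lookup_single_mult[of a q] by metis
next
  assume "q \<in> supported (\<lambda>m. P (a + m))"
  then show "single a 1 * q \<in> supported P"
    by (intro supported_mult[where P = "\<lambda>m. m = a"]) (auto intro: supported_single)
qed

lemma single_factor:
  fixes p :: "'a::cancel_comm_monoid_add \<Rightarrow>\<^sub>0 'b::semiring_1"
  assumes "p \<in> supported (\<lambda>m. \<exists>m'. m = a + m')"
  obtains q where "p = single a 1 * q"
proof
  have inj: "inj ((+) a)"
    by (simp add: inj_def)
  \<comment> \<open>The quotient by the monomial: its coefficient at \<open>m\<close> is that of
    \<open>p\<close> at \<open>a + m\<close>.\<close>
  let ?q = "Poly_Mapping.map_key ((+) a) p"
  have q: "lookup ?q m = lookup p (a + m)" for m
    using map_key.rep_eq[OF inj, of p] by (simp add: comp_def)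
  have s: "single a 1 * ?q \<in> supported (\<lambda>m. \<exists>m'. m = a + m')"
    by (intro supported_mult[where P = "\<lambda>m. m = a" and Q = "\<lambda>_. True"])
      (auto intro: supported_single simp: supported_def)
  show "p = single a 1 * ?q"
  proof (rule poly_mapping_eqI)
    fix m
    show "lookup p m = lookup (single a 1 * ?q) m"
    proof (cases "\<exists>m'. m = a + m'")
      case True
      then show ?thesis
        using lookup_single_mult[of a ?q] q by metis
    next
      case False
      then show ?thesis
        using supportedD[OF assms, of m] supportedD[OF s, of m] by metis
    qed
  qed
qed

lemma poly_mapping_as_sum:
  "p = (\<Sum>m\<in>keys p. single m (lookup p m))"
proof (rule poly_mapping_eqI)
  fix k
  have "(\<Sum>m\<in>keys p. lookup p m when m = k)
      = (\<Sum>m\<in>keys p. if m = k then lookup p k else 0)"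
    by (intro sum.cong) auto
  then show "lookup p k = lookup
      (\<Sum>m\<in>keys p. single m (lookup p m)) k"
    by (simp add: lookup_sum lookup_single sum.delta in_keys_iff)
qed

lemma Const_mult_single: "Const c * single m b = single m (c * b)"
  by (simp add: Const_def mult_single)

lemma lookup_sum_Const_single:
  assumes "finite X" "x \<in> X"
  shows "lookup (\<Sum>m\<in>X. Const (c m) * single m 1) x = c x"
proof -
  have "(\<Sum>m\<in>X. c m when m = x) = (\<Sum>m\<in>X. if m = x then c x else 0)"
    by (intro sum.cong) auto
  with assms show ?thesis
    by (simp add: Const_mult_single lookup_sum lookup_single)
qed

lemma Const_add: "Const (a + b) = Const a + Const b"
  by (simp add: Const_def single_add)

lemma Const_mult: "Const (a * b) = Const a * Const b"
  by (simp add: Const_def mult_single)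

lemma Const_zero [simp]: "Const 0 = 0"
  by (simp add: Const_def)

lemma Const_one [simp]: "Const 1 = 1"
  by (simp add: Const_def)

lemma keys_add_nat: "keys (m + m' :: nat \<Rightarrow>\<^sub>0 nat) = keys m \<union> keys m'"
  by (auto simp: in_keys_iff lookup_add)

lemma mono_deg_superset:
  "finite A \<Longrightarrow> keys m \<subseteq> A \<Longrightarrow> mono_deg m = (\<Sum>v\<in>A. lookup m v)"
  unfolding mono_deg_def by (intro sum.mono_neutral_left) (auto simp: in_keys_iff)

lemma mono_deg_add [simp]: "mono_deg (m + m') = mono_deg m + mono_deg m'"
  by (simp add: mono_deg_superset[of "keys m \<union> keys m'"] keys_add_nat
      lookup_add sum.distrib)

lemma mono_deg_zero [simp]: "mono_deg 0 = 0"
  by (simp add: mono_deg_def)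

lemma mono_deg_single [simp]: "mono_deg (single v k) = k"
  by (cases "k = 0") (auto simp: mono_deg_def)

lemma lookup_le_mono_deg: "lookup m v \<le> mono_deg m"
proof (cases "v \<in> keys m")
  case True
  then show ?thesis
    unfolding mono_deg_def by (intro member_le_sum) auto
qed (simp add: in_keys_iff)

lemma mono_adds_iff: "(\<exists>m'. m = a + m') \<longleftrightarrow> (\<forall>v. lookup a v \<le> lookup m v)"
  for a m :: "nat \<Rightarrow>\<^sub>0 nat"
proof
  assume "\<forall>v. lookup a v \<le> lookup m v"
  then have "m = a + (m - a)"
    by (intro poly_mapping_eqI) (simp add: lookup_add lookup_minus)
  then show "\<exists>m'. m = a + m'" ..
qed (auto simp: lookup_add)

section \<open>Monomial ideals\<close>

definition up_closed :: "('a::plus \<Rightarrow> bool) \<Rightarrow> bool" where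
  "up_closed Q \<longleftrightarrow> (\<forall>m m'. Q m \<longrightarrow> Q (m + m'))"

abbreviation mono_in :: "nat set \<Rightarrow> (nat \<Rightarrow>\<^sub>0 nat) \<Rightarrow> bool" where
  "mono_in V m \<equiv> keys m \<subseteq> V"

abbreviation polys :: "nat set \<Rightarrow> 'f::field mpoly set" where
  "polys V \<equiv> supported (mono_in V)"

text \<open>Monomial ideals are described by their monomials instead of generators, so that
  membership is tested coefficient by coefficient and the remaining monomials form a basis of the
  quotient.\<close>

definition mono_ideal :: "nat set \<Rightarrow> ((nat \<Rightarrow>\<^sub>0 nat) \<Rightarrow> bool) \<Rightarrow> 'f::field mpoly set" where
  "mono_ideal V Q = supported (\<lambda>m. mono_in V m \<and> Q m)"

lemma carrier_poly_ring: "carrier (poly_ring V) = polys V"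
  by (simp add: poly_ring_def supported_def)

lemma poly_ring_simps [simp]:
  "monoid.mult (poly_ring V) = (*)" "one (poly_ring V) = 1"
  "zero (poly_ring V) = 0" "add (poly_ring V) = (+)"
  by (simp_all add: poly_ring_def)

lemma poly_ring_mult: "p \<in> polys V \<Longrightarrow> q \<in> polys V \<Longrightarrow> p * q \<in> polys V"
  by (rule supported_mult[of p "mono_in V" q "mono_in V"]) (auto simp: keys_add_nat)

lemma Const_in_poly_ring: "Const c \<in> polys V"
  by (simp add: Const_def supported_single)

lemma one_in_poly_ring: "1 \<in> polys V"
  by (simp add: supported_def)

lemma cring_poly_ring: "cring (poly_ring V :: 'f::field mpoly ring)"
proof (rule cringI)
  show "abelian_group (poly_ring V :: 'f mpoly ring)"
  proof (rule abelian_groupI)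
    fix x :: "'f mpoly" assume "x \<in> carrier (poly_ring V)"
    then show "\<exists>y\<in>carrier (poly_ring V). y \<oplus>\<^bsub>poly_ring V\<^esub> x = \<zero>\<^bsub>poly_ring V\<^esub>"
      by (intro bexI[of _ "- x"]) (auto simp: carrier_poly_ring supported_uminus)
  qed (auto simp: carrier_poly_ring supported_add algebra_simps)
  show "Group.comm_monoid (poly_ring V :: 'f mpoly ring)"
    by (rule comm_monoidI) (auto simp: carrier_poly_ring poly_ring_mult one_in_poly_ring algebra_simps)
qed (auto simp: carrier_poly_ring algebra_simps)

lemma a_inv_poly_ring:
  assumes "p \<in> polys V"
  shows "\<ominus>\<^bsub>poly_ring V\<^esub> p = - (p :: 'f::field mpoly)"
proof -
  interpret cring "poly_ring V :: 'f mpoly ring" by (rule cring_poly_ring)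
  show ?thesis
    using assms by (intro minus_equality) (auto simp: carrier_poly_ring supported_uminus)
qed

lemma ideal_poly_ringI:
  fixes I :: "'f::field mpoly set"
  assumes "I \<subseteq> polys V" "0 \<in> I" "\<And>p q. p \<in> I \<Longrightarrow> q \<in> I \<Longrightarrow> p + q \<in> I"
    "\<And>p q. p \<in> I \<Longrightarrow> q \<in> polys V \<Longrightarrow> q * p \<in> I"
  shows "ideal I (poly_ring V)"
proof (rule idealI)
  show "ring (poly_ring V :: 'f mpoly ring)"
    using cring_poly_ring cring_def by blast
  show "subgroup I (add_monoid (poly_ring V))"
  proof (rule group.subgroupI)
    show "Group.group (add_monoid (poly_ring V :: 'f mpoly ring))"
      using cring_poly_ring cring_def ring.is_abelian_group abelian_group.a_group by blast
    fix p assume p: "p \<in> I"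
    have "- p = Const (-1) * p"
      by (simp add: Const_def single_uminus)
    then have "- p \<in> I"
      using assms(4)[OF p Const_in_poly_ring, of "-1"] by simp
    then show "inv\<^bsub>add_monoid (poly_ring V)\<^esub> p \<in> I"
      using a_inv_poly_ring[of p V] p assms(1) by (auto simp: a_inv_def)
  qed (use assms in \<open>auto simp: carrier_poly_ring\<close>)
qed (use assms in \<open>auto simp: carrier_poly_ring mult.commute\<close>)

lemma ideal_poly_ringD:
  fixes I :: "'f::field mpoly set"
  assumes "ideal I (poly_ring V)"
  shows "I \<subseteq> polys V" "0 \<in> I" "\<And>p q. p \<in> I \<Longrightarrow> q \<in> I \<Longrightarrow> p + q \<in> I"
    "\<And>p q. p \<in> I \<Longrightarrow> q \<in> polys V \<Longrightarrow> q * p \<in> I" "\<And>p. p \<in> I \<Longrightarrow> - p \<in> I"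
    "\<And>p q. p \<in> I \<Longrightarrow> q \<in> I \<Longrightarrow> p - q \<in> I"
proof -
  interpret ideal I "poly_ring V" by fact
  show 1: "I \<subseteq> polys V"
    using a_subset by (simp add: carrier_poly_ring)
  show "0 \<in> I"
    using additive_subgroup.zero_closed[OF additive_subgroup_axioms] by simp
  show 2: "p + q \<in> I" if "p \<in> I" "q \<in> I" for p q
    using additive_subgroup.a_closed[OF additive_subgroup_axioms that] by simp
  show 4: "q * p \<in> I" if "p \<in> I" "q \<in> polys V" for p q
    using I_l_closed[OF that(1), of q] that(2) by (simp add: carrier_poly_ring)
  have "- p = Const (-1) * p" for p :: "'f mpoly"
    by (simp add: Const_def single_uminus)
  then show 3: "- p \<in> I" if "p \<in> I" for p
    using 4[OF that Const_in_poly_ring, of "-1"] by simp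
  show "p - q \<in> I" if "p \<in> I" "q \<in> I" for p q
    using 2[OF that(1) 3[OF that(2)]] by simp
qed

lemma mono_ideal_ideal: "up_closed Q \<Longrightarrow> ideal (mono_ideal V Q :: 'f::field mpoly set) (poly_ring V)"
proof (rule ideal_poly_ringI)
  fix p q :: "'f::field mpoly"
  assume Q: "up_closed Q" and p: "p \<in> mono_ideal V Q" and q: "q \<in> polys V"
  have "p * q \<in> mono_ideal V Q"
    using Q unfolding mono_ideal_def
    by (intro supported_mult[OF p[unfolded mono_ideal_def] q]) (auto simp: keys_add_nat up_closed_def)
  then show "q * p \<in> mono_ideal V Q"
    by (simp add: mult.commute)
qed (auto simp: mono_ideal_def supported_add intro: supported_mono)

lemma mono_ideal_mono:
  "V \<subseteq> V' \<Longrightarrow> (\<And>m. mono_in V m \<Longrightarrow> Q m \<Longrightarrow> Q' m) \<Longrightarrow> mono_ideal V Q \<subseteq> mono_ideal V' Q'"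
  by (auto simp: mono_ideal_def supported_def)

lemma single_in_mono_ideal: "mono_in V m \<Longrightarrow> Q m \<Longrightarrow> single m c \<in> mono_ideal V Q"
  by (simp add: mono_ideal_def supported_single)

lemma mono_ideal_restr: "p \<in> mono_ideal V Q \<Longrightarrow> restr P p \<in> mono_ideal V Q"
  unfolding mono_ideal_def by (rule restr_preserves_supported)

lemma homog_eq_supported: "homog V j = supported (\<lambda>m. mono_in V m \<and> int (mono_deg m) = j)"
  by (auto simp: homog_def carrier_poly_ring supported_def)

abbreviation hcomp :: "int \<Rightarrow> 'f::field mpoly \<Rightarrow> 'f mpoly" where
  "hcomp j \<equiv> restr (\<lambda>m. int (mono_deg m) = j)"

lemma hcomp_in_homog: "p \<in> polys V \<Longrightarrow> hcomp j p \<in> homog V j"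
  unfolding homog_eq_supported
  by (intro supported_conj restr_preserves_supported restr_in_supported)

lemma hcomp_homog: "p \<in> homog V j \<Longrightarrow> hcomp j p = p"
  unfolding homog_eq_supported by (rule restr_ident) (erule supported_mono, simp)

lemma homog_subset: "p \<in> homog V j \<Longrightarrow> p \<in> polys V"
  unfolding homog_eq_supported by (erule supported_mono) simp

lemma hcomp_mult: "p \<in> homog V i \<Longrightarrow> hcomp j (p * q) = p * hcomp (j - i) q"
  by (rule restr_mult_eq[where P = "\<lambda>m. int (mono_deg m) = i"])
    (unfold homog_eq_supported, erule supported_mono, auto)

lemma homog_mult: "p \<in> homog V i \<Longrightarrow> q \<in> homog V j \<Longrightarrow> p * q \<in> homog V (i + j)"
  unfolding homog_eq_supported by (rule supported_mult, assumption, assumption) (auto simp: keys_add_nat)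

lemma homog_sum: "(\<And>x. x \<in> X \<Longrightarrow> f x \<in> homog V j) \<Longrightarrow> sum f X \<in> homog V j"
  unfolding homog_eq_supported by (rule supported_sum)

lemma Const_homog: "Const c \<in> homog V 0"
  unfolding homog_eq_supported Const_def by (rule supported_single) simp

section \<open>The Stanley-Reisner ideal of \<open>\<Gamma>\<close>\<close>

definition xsupp :: "nat \<Rightarrow> (nat \<Rightarrow>\<^sub>0 nat) \<Rightarrow> nat set" where
  "xsupp n m = {i \<in> {1..n}. i \<in> keys m}"

definition ysupp :: "nat \<Rightarrow> (nat \<Rightarrow>\<^sub>0 nat) \<Rightarrow> nat set" where
  "ysupp n m = {i \<in> {1..n}. n + i \<in> keys m}"

text \<open>The support of \<open>m\<close> is a nonface of \<Gamma>, whose faces consist of the x_i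
  over a face of \<open>\<Delta>\<close> together with y_j for indices j outside that face.\<close>

definition gamma_nonface :: "nat \<Rightarrow> nat set set \<Rightarrow> (nat \<Rightarrow>\<^sub>0 nat) \<Rightarrow> bool" where
  "gamma_nonface n \<Delta> m \<longleftrightarrow> xsupp n m \<notin> \<Delta> \<or> xsupp n m \<inter> ysupp n m \<noteq> {}"

lemma xsupp_add: "xsupp n (m + m') = xsupp n m \<union> xsupp n m'"
  by (auto simp: xsupp_def keys_add_nat)

lemma ysupp_add: "ysupp n (m + m') = ysupp n m \<union> ysupp n m'"
  by (auto simp: ysupp_def keys_add_nat)

lemma up_closed_nonface:
  assumes "simplicial_complex_on n \<Delta>"
  shows "up_closed (\<lambda>m. xsupp n m \<notin> \<Delta>)"
  using assms unfolding up_closed_def xsupp_add simplicial_complex_on_def by blast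

lemma up_closed_gamma_nonface:
  assumes "simplicial_complex_on n \<Delta>"
  shows "up_closed (gamma_nonface n \<Delta>)"
  using assms unfolding up_closed_def gamma_nonface_def xsupp_add ysupp_add simplicial_complex_on_def
  by blast

definition mono_of :: "nat set \<Rightarrow> (nat \<Rightarrow>\<^sub>0 nat)" where
  "mono_of F = (\<Sum>i\<in>F. single i 1)"

lemma lookup_mono_of: "finite F \<Longrightarrow> lookup (mono_of F) v = (if v \<in> F then 1 else 0)"
  by (simp add: mono_of_def lookup_sum lookup_single when_def)

lemma keys_mono_of: "finite F \<Longrightarrow> keys (mono_of F) = F"
  by (auto simp: in_keys_iff lookup_mono_of split: if_splits)

lemma prod_Var: "(\<Prod>i\<in>F. Var i) = single (mono_of F) 1"
  by (induction F rule: infinite_finite_induct) (auto simp: mono_of_def Var_def mult_single)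

lemma Var_mult_Var: "Var i * Var j = single (single i 1 + single j 1) 1"
  by (simp add: Var_def mult_single)

lemma mono_of_adds: "finite F \<Longrightarrow> F \<subseteq> keys m \<Longrightarrow> \<exists>m'. m = mono_of F + m'"
  unfolding mono_adds_iff using in_keys_iff[of _ m] by (fastforce simp: lookup_mono_of)

text \<open>The right-hand side is an ideal containing the squarefree generators. For the opposite
  direction, \<open>Gamma_ideal_eq\<close> goes back to these generators inside the larger
  ring.\<close>

lemma SR_ideal_subset:
  assumes "simplicial_complex_on n \<Delta>"
  shows "(SR_ideal n \<Delta> :: 'f::field mpoly set) \<subseteq> mono_ideal {1..n} (\<lambda>m. xsupp n m \<notin> \<Delta>)"
  unfolding SR_ideal_def
proof (rule ring.genideal_minimal)
  show "ring (poly_ring {1..n} :: 'f mpoly ring)"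
    using cring_poly_ring cring_def by blast
  show "ideal (mono_ideal {1..n} (\<lambda>m. xsupp n m \<notin> \<Delta>)) (poly_ring {1..n} :: 'f mpoly ring)"
    by (rule mono_ideal_ideal[OF up_closed_nonface[OF assms]])
  have "xsupp n (mono_of F) = F" if "F \<subseteq> {1..n}" for F
    using that keys_mono_of[of F] finite_subset[of F] by (auto simp: xsupp_def)
  then have "(\<Prod>i\<in>F. x_var i) \<in> (mono_ideal {1..n} (\<lambda>m. xsupp n m \<notin> \<Delta>) :: 'f mpoly set)"
    if "F \<subseteq> {1..n}" "F \<notin> \<Delta>" for F
    using that keys_mono_of finite_subset[OF that(1)]
    unfolding prod_Var by (intro single_in_mono_ideal) auto
  then show "{\<Prod>i\<in>F. x_var i | F. F \<subseteq> {1..n} \<and> F \<notin> \<Delta>}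
      \<subseteq> (mono_ideal {1..n} (\<lambda>m. xsupp n m \<notin> \<Delta>) :: 'f mpoly set)"
    by blast
qed

text \<open>Every nonface monomial is a multiple of a generator: of the product over its x-support
  if that is no face, otherwise of some x_i y_i with i in both supports. Sums of such terms give the
  whole monomial ideal.\<close>

lemma Gamma_ideal_eq:
  assumes \<Delta>: "simplicial_complex_on n \<Delta>"
  shows "(Gamma_ideal n \<Delta> :: 'f::field mpoly set) = mono_ideal {1..2 * n} (gamma_nonface n \<Delta>)"
    (is "_ = ?R")
proof
  let ?S = "S_ring n :: 'f mpoly ring"
  let ?A = "genideal ?S (SR_ideal n \<Delta>)"
  let ?B = "genideal ?S {x_var i * y_var n i | i. i \<in> {1..n}}"
  interpret S: cring ?S by (rule cring_poly_ring)
  have R: "ideal ?R ?S"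
    by (rule mono_ideal_ideal[OF up_closed_gamma_nonface[OF \<Delta>]])
  have SR: "(SR_ideal n \<Delta> :: 'f mpoly set) \<subseteq> ?R"
    by (rule subset_trans[OF SR_ideal_subset[OF \<Delta>]], rule mono_ideal_mono)
      (auto simp: gamma_nonface_def)
  have "x_var i * y_var n i \<in> ?R" if "i \<in> {1..n}" for i
  proof -
    have "i \<in> xsupp n (single i 1 + single (n + i) 1)"
      "i \<in> ysupp n (single i 1 + single (n + i) 1)"
      using that by (auto simp: xsupp_def ysupp_def keys_add_nat)
    then show ?thesis
      using that unfolding Var_mult_Var gamma_nonface_def
      by (intro single_in_mono_ideal) (auto simp: keys_add_nat)
  qed
  then have xy: "{x_var i * y_var n i | i. i \<in> {1..n}} \<subseteq> ?R"
    by blast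
  have SRc: "(SR_ideal n \<Delta> :: 'f mpoly set) \<subseteq> carrier ?S"
    and xyc: "{x_var i * y_var n i | i. i \<in> {1..n}} \<subseteq> carrier ?S"
    using SR xy ideal_poly_ringD(1)[OF R] by (auto simp: carrier_poly_ring)
  have "?A \<subseteq> ?R" "?B \<subseteq> ?R"
    by (intro S.genideal_minimal R SR xy)+
  then show "Gamma_ideal n \<Delta> \<subseteq> ?R"
    using ideal_poly_ringD(3)[OF R] unfolding Gamma_ideal_def set_add_def set_mult_def by auto
  have A: "ideal ?A ?S" and B: "ideal ?B ?S"
    by (intro S.genideal_ideal SRc xyc)+
  have G: "ideal (Gamma_ideal n \<Delta>) ?S"
    unfolding Gamma_ideal_def by (intro S.add_ideals A B)
  have AG: "?A \<subseteq> Gamma_ideal n \<Delta>" and BG: "?B \<subseteq> Gamma_ideal n \<Delta>"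
    using ideal_poly_ringD(2)[OF A] ideal_poly_ringD(2)[OF B]
    unfolding Gamma_ideal_def set_add_def set_mult_def by force+
  interpret N: cring "poly_ring {1..n} :: 'f mpoly ring" by (rule cring_poly_ring)
  have single: "single m c \<in> Gamma_ideal n \<Delta>"
    if m: "mono_in {1..2 * n} m" "gamma_nonface n \<Delta> m" for m and c :: 'f
  proof -
    have *: "single m c \<in> Gamma_ideal n \<Delta>"
      if "m = a + m'" "single a 1 \<in> (Gamma_ideal n \<Delta> :: 'f mpoly set)" for a m'
    proof -
      have "single m' c \<in> polys {1..2 * n}"
        using m(1) that(1) by (intro supported_single) (auto simp: keys_add_nat)
      from ideal_poly_ringD(4)[OF G that(2) this] show ?thesis
        by (simp add: mult_single that(1) add.commute)
    qed
    show ?thesis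
    proof (cases "xsupp n m \<in> \<Delta>")
      case False
      let ?F = "xsupp n m"
      have F: "?F \<subseteq> {1..n}" "finite ?F" "?F \<subseteq> keys m"
        by (auto simp: xsupp_def)
      obtain m' where m': "m = mono_of ?F + m'"
        using mono_of_adds[OF F(2,3)] by blast
      have "(\<Prod>i\<in>F. x_var i) \<in> carrier (poly_ring {1..n} :: 'f mpoly ring)" if "F \<subseteq> {1..n}" for F
        using keys_mono_of[OF finite_subset[OF that]] that
        unfolding prod_Var carrier_poly_ring by (intro supported_single) simp
      then have "{\<Prod>i\<in>F. x_var i | F. F \<subseteq> {1..n} \<and> F \<notin> \<Delta>} \<subseteq> carrier (poly_ring {1..n} :: 'f mpoly ring)"
        by blast
      then have "{\<Prod>i\<in>F. x_var i | F. F \<subseteq> {1..n} \<and> F \<notin> \<Delta>} \<subseteq> (SR_ideal n \<Delta> :: 'f mpoly set)"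
        unfolding SR_ideal_def by (rule N.genideal_self)
      moreover have "(\<Prod>i\<in>?F. x_var i :: 'f mpoly) \<in> {\<Prod>i\<in>F. x_var i | F. F \<subseteq> {1..n} \<and> F \<notin> \<Delta>}"
        using False F(1) by blast
      ultimately have "single (mono_of ?F) 1 \<in> (SR_ideal n \<Delta> :: 'f mpoly set)"
        by (auto simp flip: prod_Var)
      then show ?thesis
        using S.genideal_self[OF SRc] AG by (intro *[OF m']) auto
    next
      case True
      then obtain i where i: "i \<in> xsupp n m" "i \<in> ysupp n m"
        using m(2) by (auto simp: gamma_nonface_def)
      let ?a = "single i (1::nat) + single (n + i) 1"
      have "\<exists>m'. m = ?a + m'"
        using i unfolding mono_adds_iff
        by (auto simp: lookup_add lookup_single when_def xsupp_def ysupp_def in_keys_iff)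
      then obtain m' where m': "m = ?a + m'" by blast
      have "x_var i * y_var n i \<in> {x_var i * y_var n i | i. i \<in> {1..n}}"
        using i(1) unfolding xsupp_def by blast
      then have "(x_var i * y_var n i :: 'f mpoly) \<in> ?B"
        using S.genideal_self[OF xyc] by blast
      then show ?thesis
        using BG unfolding Var_mult_Var by (intro *[OF m']) auto
    qed
  qed
  show "?R \<subseteq> Gamma_ideal n \<Delta>"
  proof
    fix p assume p: "p \<in> ?R"
    have "(\<Sum>m\<in>X. single m (lookup p m)) \<in> Gamma_ideal n \<Delta>"
      if "X \<subseteq> keys p" for X
      using finite_subset[OF that finite_keys] that
    proof (induction X rule: finite_induct)
      case (insert m X)
      then have "mono_in {1..2 * n} m" "gamma_nonface n \<Delta> m"
        using p by (auto simp: mono_ideal_def supported_def)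
      with insert show ?case
        by (auto intro!: ideal_poly_ringD(3)[OF G] single simp del: One_nat_def)
    qed (simp add: ideal_poly_ringD(2)[OF G])
    from this[OF subset_refl] show "p \<in> Gamma_ideal n \<Delta>"
      unfolding poly_mapping_as_sum[of p, symmetric] .
  qed
qed

section \<open>Free resolutions of cyclic modules\<close>

lemma free_module_iff:
  "v \<in> carrier (free_module V b) \<longleftrightarrow> (\<forall>i. v i \<in> polys V) \<and> (\<forall>i\<ge>b. v i = 0)"
  unfolding free_module_def by (auto simp: carrier_poly_ring) (metis not_le supported_zero)

lemma free_moduleD: "v \<in> carrier (free_module V b) \<Longrightarrow> v i \<in> polys V"
  and free_module_zero: "v \<in> carrier (free_module V b) \<Longrightarrow> b \<le> i \<Longrightarrow> v i = 0"
  by (auto simp: free_module_iff)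

lemma codiff_map_simps:
  "c < rank \<rho> (Suc k) \<Longrightarrow> codiff_map \<rho> k w c = (\<Sum>r<rank \<rho> k. diff \<rho> k r c * w r)"
  "rank \<rho> (Suc k) \<le> c \<Longrightarrow> codiff_map \<rho> k w c = 0"
  by (auto simp: codiff_map_def)

lemma codiff_map_add: "codiff_map \<rho> k (\<lambda>r. v r + w r) c = codiff_map \<rho> k v c + codiff_map \<rho> k w c"
  by (simp add: codiff_map_def algebra_simps sum.distrib)

lemma codiff_map_diff: "codiff_map \<rho> k (\<lambda>r. v r - w r) c = codiff_map \<rho> k v c - codiff_map \<rho> k w c"
  by (simp add: codiff_map_def algebra_simps sum_subtractf)

lemma codiff_map_scale: "codiff_map \<rho> k (\<lambda>r. q * w r) c = q * codiff_map \<rho> k w c"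
  by (simp add: codiff_map_def sum_distrib_left algebra_simps)

lemma codiff_map_zero [simp]: "codiff_map \<rho> k (\<lambda>r. 0) c = 0"
  by (simp add: codiff_map_def)

lemma codiff_map_sum: "codiff_map \<rho> k (\<lambda>r. \<Sum>x\<in>X. f x r) c = (\<Sum>x\<in>X. codiff_map \<rho> k (f x) c)"
  by (induction X rule: infinite_finite_induct) (simp_all add: codiff_map_add)

lemma diff_map_simps:
  "r < rank \<rho> k \<Longrightarrow> diff_map \<rho> k v r = (\<Sum>c<rank \<rho> (Suc k). diff \<rho> k r c * v c)"
  "rank \<rho> k \<le> r \<Longrightarrow> diff_map \<rho> k v r = 0"
  by (auto simp: diff_map_def)

lemma diff_map_diff: "diff_map \<rho> k (\<lambda>r. v r - w r) c = diff_map \<rho> k v c - diff_map \<rho> k w c"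
  by (simp add: diff_map_def algebra_simps sum_subtractf)

lemma diff_map_scale: "diff_map \<rho> k (\<lambda>r. q * w r) c = q * diff_map \<rho> k w c"
  by (simp add: diff_map_def sum_distrib_left algebra_simps)

lemma diff_map_add: "diff_map \<rho> k (\<lambda>r. v r + w r) c = diff_map \<rho> k v c + diff_map \<rho> k w c"
  by (simp add: diff_map_def algebra_simps sum.distrib)

lemma diff_map_zero [simp]: "diff_map \<rho> k (\<lambda>r. 0) c = 0"
  by (simp add: diff_map_def)

lemma diff_map_sum: "diff_map \<rho> k (\<lambda>r. \<Sum>x\<in>X. f x r) c = (\<Sum>x\<in>X. diff_map \<rho> k (f x) c)"
  by (induction X rule: infinite_finite_induct) (simp_all add: diff_map_add)

lemma codiff_map_adjoint:
  "(\<Sum>r<rank \<rho> k. w r * diff_map \<rho> k v r) = (\<Sum>c<rank \<rho> (Suc k). codiff_map \<rho> k w c * v c)"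
proof -
  have "(\<Sum>r<rank \<rho> k. w r * diff_map \<rho> k v r)
      = (\<Sum>r<rank \<rho> k. \<Sum>c<rank \<rho> (Suc k). diff \<rho> k r c * w r * v c)"
    by (intro sum.cong refl) (simp add: diff_map_simps sum_distrib_left algebra_simps)
  also have "\<dots> = (\<Sum>c<rank \<rho> (Suc k). \<Sum>r<rank \<rho> k. diff \<rho> k r c * w r * v c)"
    by (rule sum.swap)
  also have "\<dots> = (\<Sum>c<rank \<rho> (Suc k). codiff_map \<rho> k w c * v c)"
    by (intro sum.cong refl) (simp add: codiff_map_simps sum_distrib_right)
  finally show ?thesis .
qed

definition unit_vec :: "nat \<Rightarrow> nat \<Rightarrow> 'f::field mpoly" where
  "unit_vec r = (\<lambda>i. if i = r then 1 else 0)"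

lemma unit_vec_in: "r < b \<Longrightarrow> unit_vec r \<in> carrier (free_module V b)"
  by (auto simp: free_module_iff unit_vec_def one_in_poly_ring)

lemma sum_mult_unit_vec: "r < b \<Longrightarrow> (\<Sum>c<b. w c * unit_vec r c) = w r"
  by (simp add: unit_vec_def if_distrib cong: if_cong)

lemma poly_ring_sum:
  "(\<And>x. x \<in> X \<Longrightarrow> f x \<in> polys V) \<Longrightarrow> (\<And>x. x \<in> X \<Longrightarrow> g x \<in> polys V) \<Longrightarrow>
    (\<Sum>x\<in>X. f x * g x) \<in> polys V"
  by (intro supported_sum poly_ring_mult)

text \<open>A resolution of \<open>S/I\<close> without cosets: \<open>p r\<close> is a homogeneous
  polynomial representing the image of the r-th basis element, and the augmentation of
  \<open>v\<close> is the sum of the \<open>v r * p r\<close> modulo \<open>I\<close>.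
  \<open>p_generate\<close> says that it hits the class of 1.\<close>

locale cyclic_resolution =
  fixes V :: "nat set" and I :: "'f::field mpoly set" and \<rho> :: "('f mpoly, 'b) resolution"
    and p :: "nat \<Rightarrow> 'f mpoly"
  assumes ideal_I: "ideal I (poly_ring V)"
    and p_homog: "\<And>r. r < rank \<rho> 0 \<Longrightarrow> p r \<in> homog V (bdeg \<rho> 0 r)"
    and diff_homog: "\<And>k r c. r < rank \<rho> k \<Longrightarrow> c < rank \<rho> (Suc k) \<Longrightarrow>
      diff \<rho> k r c \<in> homog V (bdeg \<rho> (Suc k) c - bdeg \<rho> k r)"
    and p_generate: "\<exists>v\<in>carrier (free_module V (rank \<rho> 0)). (\<Sum>r<rank \<rho> 0. v r * p r) - 1 \<in> I"
    and exact_0: "{v \<in> carrier (free_module V (rank \<rho> 0)). (\<Sum>r<rank \<rho> 0. v r * p r) \<in> I} =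
      diff_map \<rho> 0 ` carrier (free_module V (rank \<rho> 1))"
    and exact_Suc: "\<And>k. {v \<in> carrier (free_module V (rank \<rho> (Suc k))). diff_map \<rho> k v = (\<lambda>_. 0)} =
      diff_map \<rho> (Suc k) ` carrier (free_module V (rank \<rho> (Suc (Suc k))))"
begin

abbreviation "rk \<equiv> rank \<rho>"
abbreviation "dmap \<equiv> diff_map \<rho>"
abbreviation "codiff \<equiv> codiff_map \<rho>"

abbreviation FM :: "nat \<Rightarrow> (nat \<Rightarrow> 'f mpoly) set" where
  "FM k \<equiv> carrier (free_module V (rk k))"

lemma diff_in: "r < rk k \<Longrightarrow> c < rk (Suc k) \<Longrightarrow> diff \<rho> k r c \<in> polys V"
  using diff_homog homog_subset by blast

lemma p_in: "r < rk 0 \<Longrightarrow> p r \<in> polys V"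
  using p_homog homog_subset by blast

lemma codiff_in: "w \<in> FM k \<Longrightarrow> codiff k w \<in> FM (Suc k)"
  by (auto simp: free_module_iff codiff_map_def intro!: poly_ring_sum diff_in)

lemma diff_map_in: "v \<in> FM (Suc k) \<Longrightarrow> dmap k v \<in> FM k"
  by (auto simp: free_module_iff diff_map_def intro!: poly_ring_sum diff_in)

lemma diff_diff: "v \<in> FM (Suc (Suc k)) \<Longrightarrow> dmap k (dmap (Suc k) v) = (\<lambda>_. 0)"
  using exact_Suc[of k] by blast

text \<open>Pairing with a basis vector moves both transposed maps to the other side, where two
  consecutive differentials compose to zero.\<close>

lemma codiff_codiff:
  assumes "w \<in> FM k"
  shows "codiff (Suc k) (codiff k w) c = 0"
proof (cases "c < rk (Suc (Suc k))")
  case True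
  have "codiff (Suc k) (codiff k w) c
      = (\<Sum>x<rk (Suc (Suc k)). codiff (Suc k) (codiff k w) x * unit_vec c x)"
    using True by (simp add: sum_mult_unit_vec)
  also have "\<dots> = (\<Sum>r<rk k. w r * dmap k (dmap (Suc k) (unit_vec c)) r)"
    by (simp only: codiff_map_adjoint)
  finally show ?thesis
    by (simp add: diff_diff[OF unit_vec_in[OF True]])
qed (simp add: codiff_map_simps)

lemma FM_scale: "q \<in> polys V \<Longrightarrow> w \<in> FM k \<Longrightarrow> (\<lambda>r. q * w r) \<in> FM k"
  by (auto simp: free_module_iff intro: poly_ring_mult)

lemma FM_diff: "v \<in> FM k \<Longrightarrow> w \<in> FM k \<Longrightarrow> (\<lambda>r. v r - w r) \<in> FM k"
  by (auto simp: free_module_iff intro: supported_diff)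

lemma FM_add: "v \<in> FM k \<Longrightarrow> w \<in> FM k \<Longrightarrow> (\<lambda>r. v r + w r) \<in> FM k"
  by (auto simp: free_module_iff intro: supported_add)

lemma FM_zero: "(\<lambda>r. 0) \<in> FM k"
  by (auto simp: free_module_iff)

lemma FM_sum:
  "(\<And>x. x \<in> X \<Longrightarrow> f x \<in> FM k) \<Longrightarrow> (\<lambda>r. \<Sum>x\<in>X. f x r) \<in> FM k"
  by (auto simp: free_module_iff intro!: supported_sum sum.neutral)

lemma I_in: "f \<in> I \<Longrightarrow> f \<in> polys V"
  using ideal_poly_ringD(1)[OF ideal_I] by blast

subsection \<open>Multiplication by elements of the ideal is null-homotopic\<close>

text \<open>\<open>s t\<close> is the image of the t-th basis vector under the homotopy F_i ->
  F_(i+1). The identity f = d s is required on cycles only (on all of F_0 if \<open>i = 0\<close>),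
  because there the other summand of f = d s + s d vanishes; this is just what the inductive
  construction consumes.\<close>

definition null_homotopy :: "'f mpoly \<Rightarrow> nat \<Rightarrow> (nat \<Rightarrow> nat \<Rightarrow> 'f mpoly) \<Rightarrow> bool" where
  "null_homotopy f i s \<longleftrightarrow> (\<forall>t<rk i. s t \<in> FM (Suc i)) \<and>
     (\<forall>v\<in>FM i. (\<forall>k. i = Suc k \<longrightarrow> dmap k v = (\<lambda>_. 0)) \<longrightarrow>
        (\<lambda>q. f * v q) = dmap i (\<lambda>c. \<Sum>t<rk i. v t * s t c))"

lemma FM_expand: "v \<in> FM i \<Longrightarrow> v q = (\<Sum>t<rk i. v t * unit_vec t q)"
  by (cases "q < rk i") (auto simp: unit_vec_def if_distrib free_module_iff cong: if_cong)

lemma null_homotopy_0: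
  assumes f: "f \<in> I"
  shows "\<exists>s. null_homotopy f 0 s"
proof -
  have "\<exists>u\<in>FM 1. (\<lambda>q. f * unit_vec t q) = dmap 0 u" if t: "t < rk 0" for t
  proof -
    have "(\<Sum>r<rk 0. f * unit_vec t r * p r) = (\<Sum>r<rk 0. p r * f * unit_vec t r)"
      by (simp add: algebra_simps)
    also have "\<dots> = p t * f"
      using t by (rule sum_mult_unit_vec)
    finally have "(\<lambda>q. f * unit_vec t q) \<in> {v \<in> FM 0. (\<Sum>r<rk 0. v r * p r) \<in> I}"
      using ideal_poly_ringD(4)[OF ideal_I f p_in[OF t]] FM_scale[OF I_in[OF f] unit_vec_in[OF t]]
      by simp
    then show ?thesis
      unfolding exact_0 by blast
  qed
  then obtain s where s: "\<And>t. t < rk 0 \<Longrightarrow> s t \<in> FM 1"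
    "\<And>t. t < rk 0 \<Longrightarrow> (\<lambda>q. f * unit_vec t q) = dmap 0 (s t)"
    by metis
  have "(\<lambda>q. f * v q) = dmap 0 (\<lambda>c. \<Sum>t<rk 0. v t * s t c)" if v: "v \<in> FM 0" for v
  proof
    fix q
    have "dmap 0 (\<lambda>c. \<Sum>t<rk 0. v t * s t c) q = (\<Sum>t<rk 0. v t * (f * unit_vec t q))"
      unfolding diff_map_sum diff_map_scale
      by (intro sum.cong refl arg_cong2[of _ _ _ _ "(*)"]) (simp add: s(2)[THEN fun_cong])
    also have "\<dots> = f * (\<Sum>t<rk 0. v t * unit_vec t q)"
      by (simp add: sum_distrib_left algebra_simps)
    finally show "f * v q = dmap 0 (\<lambda>c. \<Sum>t<rk 0. v t * s t c) q"
      by (simp flip: FM_expand[OF v])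
  qed
  then show ?thesis
    using s(1) unfolding null_homotopy_def by (intro exI[of _ s]) auto
qed

lemma diff_map_unit_vec:
  "r < rk (Suc i) \<Longrightarrow> t < rk i \<Longrightarrow> dmap i (unit_vec r) t = diff \<rho> i t r"
  by (simp add: diff_map_simps sum_mult_unit_vec)

text \<open>The image d e_r of a basis vector is a cycle, so d s d e_r = f d e_r by the assumption
  on \<open>s\<close>. Hence f e_r - s d e_r is a cycle, thus a boundary by exactness, and a
  preimage is taken for \<open>s' r\<close>. The second conclusion is the full homotopy identity,
  which is the one that can be transposed.\<close>

lemma null_homotopy_Suc:
  assumes f: "f \<in> I" and s: "null_homotopy f i s"
  shows "\<exists>s'. null_homotopy f (Suc i) s' \<and> (\<forall>r<rk (Suc i). \<forall>q.
    f * unit_vec r q = dmap (Suc i) (s' r) q + (\<Sum>t<rk i. diff \<rho> i t r * s t q))"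
proof -
  let ?h = "\<lambda>v c. \<Sum>t<rk i. dmap i v t * s t c"
  have h: "?h v \<in> FM (Suc i)" if "v \<in> FM (Suc i)" for v
    using s diff_map_in[OF that] unfolding null_homotopy_def
    by (intro FM_sum FM_scale) (auto simp: free_moduleD)
  have dh: "dmap i (?h v) q = f * dmap i v q" if v: "v \<in> FM (Suc i)" for v q
  proof -
    have "\<forall>k. i = Suc k \<longrightarrow> dmap k (dmap i v) = (\<lambda>_. 0)"
      using diff_diff v by auto
    then have "(\<lambda>q. f * dmap i v q) = dmap i (?h v)"
      using s diff_map_in[OF v] unfolding null_homotopy_def by blast
    then show ?thesis
      by metis
  qed
  have "\<exists>u\<in>FM (Suc (Suc i)). dmap (Suc i) u = (\<lambda>q. f * unit_vec r q - ?h (unit_vec r) q)"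
    if r: "r < rk (Suc i)" for r
  proof -
    note e = unit_vec_in[OF r, where V = V]
    have "(\<lambda>q. f * unit_vec r q - ?h (unit_vec r) q) \<in> FM (Suc i)"
      by (intro FM_diff FM_scale e h I_in[OF f])
    moreover have "dmap i (\<lambda>q. f * unit_vec r q - ?h (unit_vec r) q) = (\<lambda>_. 0)"
      by (rule ext) (simp add: diff_map_diff diff_map_scale dh[OF e])
    ultimately have "(\<lambda>q. f * unit_vec r q - ?h (unit_vec r) q)
        \<in> {v \<in> FM (Suc i). dmap i v = (\<lambda>_. 0)}"
      by blast
    then show ?thesis
      unfolding exact_Suc by auto
  qed
  then have "\<forall>r. \<exists>u. r < rk (Suc i) \<longrightarrow> u \<in> FM (Suc (Suc i)) \<and>
      dmap (Suc i) u = (\<lambda>q. f * unit_vec r q - ?h (unit_vec r) q)"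
    by blast
  from choice[OF this] obtain s' where s': "\<And>r. r < rk (Suc i) \<Longrightarrow> s' r \<in> FM (Suc (Suc i))"
    "\<And>r. r < rk (Suc i) \<Longrightarrow>
      dmap (Suc i) (s' r) = (\<lambda>q. f * unit_vec r q - ?h (unit_vec r) q)"
    by blast
  have "(\<lambda>q. f * v q) = dmap (Suc i) (\<lambda>c. \<Sum>r<rk (Suc i). v r * s' r c)"
    if v: "v \<in> FM (Suc i)" "dmap i v = (\<lambda>_. 0)" for v
  proof
    fix q
    have "dmap (Suc i) (\<lambda>c. \<Sum>r<rk (Suc i). v r * s' r c) q
        = (\<Sum>r<rk (Suc i). v r * (f * unit_vec r q - ?h (unit_vec r) q))"
      unfolding diff_map_sum diff_map_scale by (intro sum.cong refl) (simp add: s'(2))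
    also have "\<dots> = f * (\<Sum>r<rk (Suc i). v r * unit_vec r q)
        - (\<Sum>r<rk (Suc i). \<Sum>t<rk i. v r * diff \<rho> i t r * s t q)"
      by (simp add: sum_distrib_left sum_subtractf algebra_simps diff_map_unit_vec)
    also have "(\<Sum>r<rk (Suc i). \<Sum>t<rk i. v r * diff \<rho> i t r * s t q)
        = (\<Sum>t<rk i. \<Sum>r<rk (Suc i). v r * diff \<rho> i t r * s t q)"
      by (rule sum.swap)
    also have "\<dots> = (\<Sum>t<rk i. dmap i v t * s t q)"
      by (intro sum.cong refl) (simp add: diff_map_simps sum_distrib_left sum_distrib_right algebra_simps)
    finally show "f * v q = dmap (Suc i) (\<lambda>c. \<Sum>r<rk (Suc i). v r * s' r c) q"
      by (simp add: v(2) flip: FM_expand[OF v(1)])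
  qed
  moreover have "f * unit_vec r q = dmap (Suc i) (s' r) q + (\<Sum>t<rk i. diff \<rho> i t r * s t q)"
    if "r < rk (Suc i)" for r q
    using that by (simp add: s'(2) diff_map_unit_vec)
  ultimately show ?thesis
    using s'(1) unfolding null_homotopy_def by (intro exI[of _ s']) auto
qed

lemma null_homotopy_exists: "f \<in> I \<Longrightarrow> \<exists>s. null_homotopy f i s"
  by (induction i) (use null_homotopy_0 null_homotopy_Suc in blast)+

lemma ideal_sum:
  assumes "ideal J (poly_ring V)" "\<And>x. x \<in> X \<Longrightarrow> f x \<in> J"
  shows "sum f X \<in> J"
  using assms(2) by (induction X rule: infinite_finite_induct)
    (auto intro: ideal_poly_ringD(2,3)[OF assms(1)])

text \<open>With f e_r = d s_r the value f w(e_r) equals w(d s_r), which is the coboundary of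
  \<open>w\<close> evaluated at s_r and therefore lies in \<open>J\<close>.\<close>

lemma annihilates_cocycles_0:
  assumes J: "ideal J (poly_ring V)" and f: "f \<in> I"
    and w: "w \<in> FM 0" "\<And>c. codiff 0 w c \<in> J"
  shows "f * w r \<in> J"
proof (cases "r < rk 0")
  case True
  obtain s where s: "null_homotopy f 0 s"
    using null_homotopy_0[OF f] by blast
  note e = unit_vec_in[OF True, where V = V]
  have sr: "s r \<in> FM 1"
    using s True by (simp add: null_homotopy_def)
  have us: "(\<lambda>c. \<Sum>t<rk 0. unit_vec r t * s t c) = s r"
    using True by (auto simp: unit_vec_def if_distrib[of "\<lambda>x. x * _"] cong: if_cong)
  have "(\<lambda>q. f * unit_vec r q) = dmap 0 (\<lambda>c. \<Sum>t<rk 0. unit_vec r t * s t c)"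
    using s e unfolding null_homotopy_def by blast
  then have fe: "(\<lambda>q. f * unit_vec r q) = dmap 0 (s r)"
    by (simp only: us)
  have "f * w r = f * (\<Sum>q<rk 0. w q * unit_vec r q)"
    by (simp only: sum_mult_unit_vec[OF True])
  also have "\<dots> = (\<Sum>q<rk 0. w q * (f * unit_vec r q))"
    by (simp add: sum_distrib_left algebra_simps)
  also have "\<dots> = (\<Sum>c<rk 1. codiff 0 w c * s r c)"
    by (simp add: fe[THEN fun_cong] codiff_map_adjoint)
  also have "\<dots> \<in> J"
    using ideal_poly_ringD(4)[OF J w(2)] free_moduleD[OF sr]
    by (intro ideal_sum[OF J]) (simp add: mult.commute)
  finally show ?thesis .
next
  case False
  then show ?thesis
    using free_module_zero[OF w(1), of r] ideal_poly_ringD(2)[OF J] by simp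
qed

text \<open>Applying \<open>w\<close> to f = d s' + s d gives f w = (codiff w) s' + codiff (w s).
  The first summand lies in \<open>J\<close>, so multiplication by \<open>f\<close> is zero on Ext
  of \<open>S/I\<close> with values in \<open>S/J\<close>.\<close>

lemma annihilates_cocycles_Suc:
  assumes J: "ideal J (poly_ring V)" and f: "f \<in> I"
    and w: "w \<in> FM (Suc i)" "\<And>c. codiff (Suc i) w c \<in> J"
  shows "\<exists>u\<in>FM i. \<forall>r. f * w r - codiff i u r \<in> J"
proof -
  obtain s where s: "null_homotopy f i s"
    using null_homotopy_exists[OF f] by blast
  obtain s' where s': "null_homotopy f (Suc i) s'" "\<And>r q. r < rk (Suc i) \<Longrightarrow>
      f * unit_vec r q = dmap (Suc i) (s' r) q + (\<Sum>t<rk i. diff \<rho> i t r * s t q)"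
    using null_homotopy_Suc[OF f s] by blast
  \<comment> \<open>This is the composite of \<open>w\<close> with the homotopy, set to 0 beyond the
    rank as membership in the free module demands.\<close>
  define u where "u t = (if t < rk i then \<Sum>q<rk (Suc i). w q * s t q else 0)" for t
  have "s t q \<in> polys V" if "t < rk i" for t q
  proof -
    have "s t \<in> FM (Suc i)"
      using s that unfolding null_homotopy_def by blast
    then show ?thesis
      by (rule free_moduleD)
  qed
  then have "u \<in> FM i"
    using free_moduleD[OF w(1)] by (auto simp: free_module_iff[of u] u_def intro!: poly_ring_sum)
  moreover have "f * w r - codiff i u r \<in> J" for r
  proof (cases "r < rk (Suc i)")
    case True
    have "f * w r = f * (\<Sum>q<rk (Suc i). w q * unit_vec r q)"
      by (simp only: sum_mult_unit_vec[OF True])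
    also have "\<dots> = (\<Sum>q<rk (Suc i). w q * (f * unit_vec r q))"
      by (simp add: sum_distrib_left algebra_simps)
    also have "\<dots> = (\<Sum>q<rk (Suc i). w q * dmap (Suc i) (s' r) q)
        + (\<Sum>q<rk (Suc i). \<Sum>t<rk i. diff \<rho> i t r * (w q * s t q))"
      by (simp add: s'(2)[OF True] sum.distrib sum_distrib_left algebra_simps)
    also have "(\<Sum>q<rk (Suc i). \<Sum>t<rk i. diff \<rho> i t r * (w q * s t q)) = codiff i u r"
      by (subst sum.swap) (simp add: codiff_map_simps True u_def sum_distrib_left)
    finally have "f * w r - codiff i u r
        = (\<Sum>c<rk (Suc (Suc i)). codiff (Suc i) w c * s' r c)"
      by (simp add: codiff_map_adjoint)
    moreover have "s' r \<in> FM (Suc (Suc i))"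
      using s'(1) True unfolding null_homotopy_def by blast
    then have "(\<Sum>c<rk (Suc (Suc i)). codiff (Suc i) w c * s' r c) \<in> J"
      using ideal_poly_ringD(4)[OF J w(2)] free_moduleD[of "s' r"]
      by (intro ideal_sum[OF J]) (simp add: mult.commute)
    ultimately show ?thesis
      by simp
  next
    case False
    then show ?thesis
      using free_module_zero[OF w(1), of r] ideal_poly_ringD(2)[OF J] by (simp add: codiff_map_simps)
  qed
  ultimately show ?thesis
    by blast
qed

end

section \<open>Dimension shifting along a regular sequence\<close>

definition lin_comb :: "'i set \<Rightarrow> ('i \<Rightarrow> 'f) \<Rightarrow> ('i \<Rightarrow> nat \<Rightarrow> 'f::field mpoly) \<Rightarrow> nat \<Rightarrow> 'f mpoly" where
  "lin_comb X c b = (\<lambda>r. \<Sum>x\<in>X. Const (c x) * b x r)"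

text \<open>\<open>b\<close> represents a basis of the image of \<open>Z\<close> in the quotient by
  \<open>B\<close>, over the ground field. Stating it with representatives avoids forming quotient
  spaces at every stage of the dimension shift.\<close>

definition basis_mod ::
    "'i set \<Rightarrow> ('i \<Rightarrow> nat \<Rightarrow> 'f::field mpoly) \<Rightarrow> (nat \<Rightarrow> 'f mpoly) set \<Rightarrow> (nat \<Rightarrow> 'f mpoly) set \<Rightarrow> bool" where
  "basis_mod X b Z B \<longleftrightarrow> (\<forall>x\<in>X. b x \<in> Z) \<and> (\<forall>z\<in>Z. \<exists>c. (\<lambda>r. z r - lin_comb X c b r) \<in> B) \<and>
     (\<forall>c. lin_comb X c b \<in> B \<longrightarrow> (\<forall>x\<in>X. c x = 0))"

text \<open>\<open>J k\<close> is generated by \<open>a 0\<close>, ..., \<open>a (k - 1)\<close>, as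
  \<open>J_0\<close> and \<open>J_Suc\<close> express. Degree 2 is that of x_i y_i, and
  \<open>hcomp_J\<close> states that the ideals are homogeneous.\<close>

locale annihilating_regular_sequence = cyclic_resolution +
  fixes J :: "nat \<Rightarrow> 'a mpoly set" and a :: "nat \<Rightarrow> 'a mpoly" and N :: nat
  assumes ideal_J: "\<And>k. ideal (J k) (poly_ring V)"
    and J_0: "J 0 = {0}"
    and a_in_I: "\<And>k. k < N \<Longrightarrow> a k \<in> I"
    and a_homog: "\<And>k. k < N \<Longrightarrow> a k \<in> homog V 2"
    and J_Suc: "\<And>k x. k < N \<Longrightarrow> x \<in> J (Suc k) \<longleftrightarrow> (\<exists>q\<in>polys V. x - a k * q \<in> J k)"
    and regular: "\<And>k q. k < N \<Longrightarrow> q \<in> polys V \<Longrightarrow> a k * q \<in> J k \<Longrightarrow> q \<in> J k"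
    and hcomp_J: "\<And>k j x. x \<in> J k \<Longrightarrow> hcomp j x \<in> J k"
begin

definition Z :: "nat \<Rightarrow> nat \<Rightarrow> (nat \<Rightarrow> 'a mpoly) set" where
  "Z i k = {w \<in> FM i. \<forall>c. codiff i w c \<in> J k}"

definition B :: "nat \<Rightarrow> nat \<Rightarrow> (nat \<Rightarrow> 'a mpoly) set" where
  "B i k = {w \<in> FM i. \<exists>u\<in>coboundaries V \<rho> i. \<forall>r. w r - u r \<in> J k}"

definition Zgr :: "nat \<Rightarrow> nat \<Rightarrow> int \<Rightarrow> (nat \<Rightarrow> 'a mpoly) set" where
  "Zgr i k j = {w \<in> Z i k. \<forall>r<rk i. w r \<in> homog V (j + bdeg \<rho> i r)}"

text \<open>The graph of the connecting map \<open>Ext\<^sup>i(M, S/J\<^bsub>k+1\<^esub>) \<rightarrow> Ext\<^sup>i\<^sup>+\<^sup>1(M, S/J\<^sub>k)\<close> on cocycles.\<close>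

definition connects :: "nat \<Rightarrow> nat \<Rightarrow> (nat \<Rightarrow> 'a mpoly) \<Rightarrow> (nat \<Rightarrow> 'a mpoly) \<Rightarrow> bool" where
  "connects i k u w \<longleftrightarrow> (\<forall>c. codiff i u c - a k * w c \<in> J k)"

lemmas J_zero = ideal_poly_ringD(2)[OF ideal_J]
  and J_add = ideal_poly_ringD(3)[OF ideal_J]
  and J_mult = ideal_poly_ringD(4)[OF ideal_J]
  and J_uminus = ideal_poly_ringD(5)[OF ideal_J]
  and J_diff = ideal_poly_ringD(6)[OF ideal_J]

lemma J_codiff:
  assumes "\<And>r. w r \<in> J k"
  shows "codiff i w c \<in> J k"
proof (cases "c < rk (Suc i)")
  case True
  then show ?thesis
    by (simp add: codiff_map_simps) (intro ideal_sum[OF ideal_J] J_mult assms diff_in; simp)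
qed (simp add: codiff_map_simps J_zero)

lemma a_in: "k < N \<Longrightarrow> a k \<in> polys V"
  using a_in_I I_in by blast

lemma a_mult_in_J: "k < N \<Longrightarrow> q \<in> polys V \<Longrightarrow> a k * q \<in> J (Suc k)"
  by (subst J_Suc) (auto intro!: bexI[of _ q] simp: J_zero)

lemma J_mono: "k < N \<Longrightarrow> x \<in> J k \<Longrightarrow> x \<in> J (Suc k)"
  using J_Suc[of k x] by (intro iffD2[OF J_Suc] bexI[of _ 0]) auto

lemma coboundary_in: "u \<in> coboundaries V \<rho> i \<Longrightarrow> u \<in> FM i"
  by (cases i) (auto simp: coboundaries_def FM_zero intro: codiff_in)

lemma codiff_coboundary: "u \<in> coboundaries V \<rho> i \<Longrightarrow> codiff i u c = 0"
  by (cases i) (auto simp: coboundaries_def codiff_codiff)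

lemma coboundary_scale:
  "u \<in> coboundaries V \<rho> i \<Longrightarrow> q \<in> polys V \<Longrightarrow> (\<lambda>r. q * u r) \<in> coboundaries V \<rho> i"
proof (cases i)
  case (Suc i')
  assume "u \<in> coboundaries V \<rho> i" "q \<in> polys V"
  then obtain v where v: "v \<in> FM i'" "u = codiff i' v"
    by (auto simp: Suc coboundaries_def)
  have "(\<lambda>r. q * u r) = codiff i' (\<lambda>r. q * v r)"
    by (rule ext) (simp add: v codiff_map_scale)
  then show ?thesis
    using FM_scale[OF \<open>q \<in> _\<close> v(1)] by (auto simp: Suc coboundaries_def)
qed (simp add: coboundaries_def)

lemma coboundary_diff:
  "u \<in> coboundaries V \<rho> i \<Longrightarrow> v \<in> coboundaries V \<rho> i \<Longrightarrow> (\<lambda>r. u r - v r) \<in> coboundaries V \<rho> i"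
proof (cases i)
  case (Suc i')
  assume "u \<in> coboundaries V \<rho> i" "v \<in> coboundaries V \<rho> i"
  then obtain u' v' where uv: "u' \<in> FM i'" "u = codiff i' u'" "v' \<in> FM i'" "v = codiff i' v'"
    by (auto simp: Suc coboundaries_def)
  have "(\<lambda>r. u r - v r) = codiff i' (\<lambda>r. u' r - v' r)"
    by (rule ext) (simp add: uv codiff_map_diff)
  then show ?thesis
    using FM_diff[OF uv(1,3)] by (auto simp: Suc coboundaries_def)
qed (simp add: coboundaries_def)

text \<open>Applying \<open>codiff\<close> once more to \<open>codiff i u - a k * w\<close> leaves a
  multiple of \<open>a k\<close> in \<open>J k\<close>, from which \<open>regular\<close> removes
  the factor.\<close>

lemma connects_Z:
  assumes "k < N" "u \<in> FM i" "w \<in> FM (Suc i)" "connects i k u w"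
  shows "w \<in> Z (Suc i) k" "u \<in> Z i (Suc k)"
proof -
  have "a k * codiff (Suc i) w c \<in> J k" for c
  proof -
    have "codiff (Suc i) (\<lambda>c. codiff i u c - a k * w c) c \<in> J k"
      using assms(4) by (intro J_codiff) (simp add: connects_def)
    then have "- (a k * codiff (Suc i) w c) \<in> J k"
      by (simp add: codiff_map_diff codiff_map_scale codiff_codiff[OF assms(2)])
    from J_uminus[OF this] show ?thesis by simp
  qed
  then show "w \<in> Z (Suc i) k"
    using assms(1,3) free_moduleD[OF codiff_in[OF assms(3)]]
    unfolding Z_def by (auto intro: regular)
  show "u \<in> Z i (Suc k)"
    unfolding Z_def
  proof (intro CollectI conjI allI assms(2))
    fix c
    have "codiff i u c - a k * w c \<in> J k"
      using assms(4) unfolding connects_def by blast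
    then have "codiff i u c - a k * w c + a k * w c \<in> J (Suc k)"
      by (rule J_add[OF J_mono[OF assms(1)] a_mult_in_J[OF assms(1) free_moduleD[OF assms(3)]]])
    then show "codiff i u c \<in> J (Suc k)"
      by simp
  qed
qed

lemma connects_exists:
  assumes "k < N" "u \<in> Z i (Suc k)"
  shows "\<exists>w\<in>FM (Suc i). connects i k u w"
proof -
  have "\<forall>c. \<exists>q. q \<in> polys V \<and> codiff i u c - a k * q \<in> J k"
    using assms J_Suc[of k] unfolding Z_def by blast
  from choice[OF this] obtain q where q: "\<And>c. q c \<in> polys V"
    "\<And>c. codiff i u c - a k * q c \<in> J k" by blast
  define w where "w c = (if c < rk (Suc i) then q c else 0)" for c
  have "w \<in> FM (Suc i)"
    using q(1) by (auto simp: free_module_iff w_def)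
  moreover have "connects i k u w"
    unfolding connects_def
  proof
    fix c
    show "codiff i u c - a k * w c \<in> J k"
      using q(2)[of c] by (cases "c < rk (Suc i)") (auto simp: w_def codiff_map_simps(2) J_zero)
  qed
  ultimately show ?thesis by blast
qed

text \<open>Since \<open>a k\<close> lies in \<open>I\<close>, multiplication by it is zero on
  cohomology, so \<open>a k * w\<close> is a coboundary modulo \<open>J k\<close>.\<close>

lemma connects_surj:
  assumes "k < N" "w \<in> Z (Suc i) k"
  shows "\<exists>u\<in>FM i. connects i k u w"
proof -
  obtain u where u: "u \<in> FM i" "\<And>r. a k * w r - codiff i u r \<in> J k"
    using annihilates_cocycles_Suc[OF ideal_J a_in_I[OF assms(1)], of w i k] assms(2)
    unfolding Z_def by blast
  have "codiff i u r - a k * w r \<in> J k" for r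
    using J_uminus[OF u(2)[of r]] by simp
  then show ?thesis
    using u(1) unfolding connects_def by blast
qed

text \<open>Well-definedness of the connecting map: if \<open>u\<close> is a coboundary plus
  \<open>a k * v\<close> modulo \<open>J k\<close>, then \<open>a k\<close> times
  \<open>w - codiff i v\<close> lies in \<open>J k\<close>, and \<open>regular\<close> cancels
  \<open>a k\<close>.\<close>

lemma connects_B_imp:
  assumes "k < N" "u \<in> B i (Suc k)" "w \<in> FM (Suc i)" "connects i k u w"
  shows "w \<in> B (Suc i) k"
proof -
  obtain u' where u': "u' \<in> coboundaries V \<rho> i" "\<And>r. u r - u' r \<in> J (Suc k)"
    using assms(2) unfolding B_def by blast
  have u: "u \<in> FM i"
    using assms(2) by (simp add: B_def)
  have "\<forall>r. \<exists>q. q \<in> polys V \<and> u r - u' r - a k * q \<in> J k"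
    using u'(2) J_Suc[OF assms(1)] by blast
  from choice[OF this] obtain q where q: "\<And>c. q c \<in> polys V"
    "\<And>r. u r - u' r - a k * q r \<in> J k" by blast
  define v where "v r = (if r < rk i then q r else 0)" for r
  have v: "v \<in> FM i"
    using q(1) by (auto simp: free_module_iff v_def)
  have vJ: "u r - u' r - a k * v r \<in> J k" for r
    using q(2)[of r] free_module_zero[OF u, of r] free_module_zero[OF coboundary_in[OF u'(1)], of r]
    by (auto simp: v_def J_zero)
  have "w c - codiff i v c \<in> J k" for c
  proof (rule regular[OF assms(1)])
    show "w c - codiff i v c \<in> polys V"
      by (intro supported_diff free_moduleD[OF assms(3)] free_moduleD[OF codiff_in[OF v]])
    have "codiff i (\<lambda>r. u r - u' r - a k * v r) c \<in> J k"
      by (rule J_codiff) (rule vJ)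
    then have "codiff i u c - a k * codiff i v c \<in> J k"
      by (simp add: codiff_map_diff codiff_map_scale codiff_coboundary[OF u'(1)])
    moreover have "codiff i u c - a k * w c \<in> J k"
      using assms(4) unfolding connects_def by blast
    ultimately have "codiff i u c - a k * codiff i v c - (codiff i u c - a k * w c) \<in> J k"
      by (rule J_diff)
    then show "a k * (w c - codiff i v c) \<in> J k"
      by (simp add: algebra_simps)
  qed
  then show ?thesis
    using assms(3) v unfolding B_def coboundaries_def by auto
qed

text \<open>In degree 0 the element \<open>a k\<close> both kills the cocycles modulo
  \<open>J k\<close> and is regular on \<open>S/J k\<close>. The connecting map trades one unit of
  \<open>i\<close> for one unit of \<open>k\<close>, so the sum \<open>i + k\<close> is constant
  along the induction.\<close>

lemma vanishing: "i + k < N \<Longrightarrow> Z i k \<subseteq> B i k"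
proof (induction i arbitrary: k)
  case 0
  show ?case
  proof
    fix w assume w: "w \<in> Z 0 k"
    then have wF: "w \<in> FM 0"
      by (simp add: Z_def)
    have aw: "a k * w r \<in> J k" for r
      using w 0 unfolding Z_def by (intro annihilates_cocycles_0[OF ideal_J a_in_I]) auto
    have "w r \<in> J k" for r
      by (rule regular[OF _ free_moduleD[OF wF] aw]) (use 0 in simp)
    then show "w \<in> B 0 k"
      using wF unfolding B_def coboundaries_def by (intro CollectI conjI bexI[of _ "\<lambda>_. 0"]) simp_all
  qed
next
  case (Suc i)
  show ?case
  proof
    fix w assume w: "w \<in> Z (Suc i) k"
    have k: "k < N" using Suc.prems by simp
    have wF: "w \<in> FM (Suc i)" using w by (simp add: Z_def)
    obtain u where u: "u \<in> FM i" "connects i k u w"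
      using connects_surj[OF k w] by blast
    then have "u \<in> B i (Suc k)"
      using connects_Z(2)[OF k u(1) wF u(2)] Suc.IH[of "Suc k"] Suc.prems by auto
    then show "w \<in> B (Suc i) k"
      by (rule connects_B_imp[OF k _ wF u(2)])
  qed
qed

text \<open>Injectivity of the connecting map. If \<open>w\<close> is the coboundary of
  \<open>w'\<close> modulo \<open>J k\<close>, then \<open>u - a k * w'\<close> is a cocycle modulo
  \<open>J k\<close>, hence trivial by \<open>vanishing\<close>, and the correction
  \<open>a k * w'\<close> dies modulo \<open>J (Suc k)\<close>.\<close>

lemma connects_B_rev:
  assumes "i + k < N" "u \<in> FM i" "w \<in> B (Suc i) k" "connects i k u w"
  shows "u \<in> B i (Suc k)"
proof -
  have k: "k < N" using assms(1) by simp
  have wF: "w \<in> FM (Suc i)"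
    using assms(3) by (simp add: B_def)
  obtain w' where w': "w' \<in> FM i" "\<And>r. w r - codiff i w' r \<in> J k"
    using assms(3) unfolding B_def coboundaries_def by auto
  let ?v = "\<lambda>r. u r - a k * w' r"
  have "codiff i ?v c \<in> J k" for c
  proof -
    have "(codiff i u c - a k * w c) + a k * (w c - codiff i w' c) \<in> J k"
      using assms(4) unfolding connects_def by (intro J_add J_mult w'(2) a_in[OF k]) auto
    then show ?thesis
      by (simp add: codiff_map_diff codiff_map_scale algebra_simps)
  qed
  moreover have "?v \<in> FM i"
    by (intro FM_diff FM_scale assms(2) w'(1) a_in[OF k])
  ultimately have "?v \<in> Z i k"
    unfolding Z_def by blast
  then have "?v \<in> B i k"
    using vanishing[OF assms(1)] by blast
  then obtain u' where u': "u' \<in> coboundaries V \<rho> i" "\<And>r. ?v r - u' r \<in> J k"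
    unfolding B_def by blast
  have "u r - u' r \<in> J (Suc k)" for r
  proof -
    have "?v r - u' r + a k * w' r \<in> J (Suc k)"
      by (intro J_add J_mono a_mult_in_J u'(2) k free_moduleD[OF w'(1)])
    then show ?thesis by simp
  qed
  then show ?thesis
    using u'(1) assms(2) unfolding B_def by blast
qed

subsection \<open>The grading\<close>

definition gr_part :: "nat \<Rightarrow> int \<Rightarrow> (nat \<Rightarrow> 'a mpoly) \<Rightarrow> nat \<Rightarrow> 'a mpoly" where
  "gr_part i j w = (\<lambda>r. hcomp (j + bdeg \<rho> i r) (w r))"

lemma gr_part_in: "w \<in> FM i \<Longrightarrow> gr_part i j w \<in> FM i"
  by (auto simp: free_module_iff gr_part_def restr_preserves_supported)

lemma gr_part_homog: "w \<in> FM i \<Longrightarrow> gr_part i j w r \<in> homog V (j + bdeg \<rho> i r)"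
  unfolding gr_part_def by (intro hcomp_in_homog) (rule free_moduleD)

lemma gr_part_ident:
  assumes "w \<in> FM i" "\<forall>r<rk i. w r \<in> homog V (j + bdeg \<rho> i r)"
  shows "gr_part i j w = w"
proof
  fix r
  show "gr_part i j w r = w r"
    using assms free_module_zero[OF assms(1), of r]
    by (cases "r < rk i") (auto simp: gr_part_def hcomp_homog)
qed

lemma codiff_gr_part:
  assumes "c < rk (Suc i)"
  shows "codiff i (gr_part i j w) c = hcomp (j + bdeg \<rho> (Suc i) c) (codiff i w c)"
proof -
  have "hcomp (j + bdeg \<rho> (Suc i) c) (diff \<rho> i r c * w r) = diff \<rho> i r c * gr_part i j w r"
    if "r < rk i" for r
    unfolding hcomp_mult[OF diff_homog[OF that assms]] by (simp add: gr_part_def algebra_simps)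
  then show ?thesis
    using assms by (simp add: codiff_map_simps restr_sum)
qed

text \<open>Taking components commutes with both sides of the relation; the degree of
  \<open>w\<close> is lower by 2 because it is multiplied by the quadric \<open>a k\<close>.\<close>

lemma connects_gr_part:
  assumes "k < N" "connects i k u w"
  shows "connects i k (gr_part i j u) (gr_part (Suc i) (j - 2) w)"
  unfolding connects_def
proof
  fix c
  show "codiff i (gr_part i j u) c - a k * gr_part (Suc i) (j - 2) w c \<in> J k"
  proof (cases "c < rk (Suc i)")
    case True
    have "a k * gr_part (Suc i) (j - 2) w c = hcomp (j + bdeg \<rho> (Suc i) c) (a k * w c)"
      unfolding hcomp_mult[OF a_homog[OF assms(1)]] by (simp add: gr_part_def algebra_simps)
    then have "codiff i (gr_part i j u) c - a k * gr_part (Suc i) (j - 2) w c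
        = hcomp (j + bdeg \<rho> (Suc i) c) (codiff i u c - a k * w c)"
      by (simp add: codiff_gr_part[OF True] restr_diff)
    then show ?thesis
      using assms(2) hcomp_J unfolding connects_def by auto
  next
    case False
    \<comment> \<open>Beyond the rank the coboundary is 0 and the relation itself says this. The
      basis degree there is an arbitrary value, which does no harm since every homogeneous component
      stays in \<open>J k\<close>.\<close>
    have "a k * w c \<in> J k"
      using assms(2) J_uminus False unfolding connects_def
      by (metis codiff_map_simps(2) diff_0 minus_minus not_le)
    then have "hcomp (j - 2 + bdeg \<rho> (Suc i) c + 2) (a k * w c) \<in> J k"
      by (rule hcomp_J)
    then have "a k * gr_part (Suc i) (j - 2) w c \<in> J k"
      unfolding hcomp_mult[OF a_homog[OF assms(1)]] by (simp add: gr_part_def algebra_simps)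
    then show ?thesis
      using J_uminus False by (simp add: codiff_map_simps)
  qed
qed

lemma connects_graded_exists:
  assumes "k < N" "u \<in> Zgr i (Suc k) j"
  shows "\<exists>w\<in>Zgr (Suc i) k (j - 2). connects i k u w"
proof -
  have u: "u \<in> Z i (Suc k)" "u \<in> FM i" "gr_part i j u = u"
    using assms(2) by (auto simp: Zgr_def Z_def gr_part_ident)
  obtain w where w: "w \<in> FM (Suc i)" "connects i k u w"
    using connects_exists[OF assms(1) u(1)] by blast
  let ?w = "gr_part (Suc i) (j - 2) w"
  have c: "connects i k u ?w"
    using connects_gr_part[OF assms(1) w(2), of j] by (simp add: u(3))
  then show ?thesis
    using connects_Z(1)[OF assms(1) u(2) gr_part_in[OF w(1)] c] gr_part_homog[OF w(1)]
    unfolding Zgr_def by blast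
qed

lemma connects_graded_surj:
  assumes "k < N" "w \<in> Zgr (Suc i) k (j - 2)"
  shows "\<exists>u\<in>Zgr i (Suc k) j. connects i k u w"
proof -
  have w: "w \<in> Z (Suc i) k" "w \<in> FM (Suc i)" "gr_part (Suc i) (j - 2) w = w"
    using assms(2) by (auto simp: Zgr_def Z_def gr_part_ident)
  obtain u where u: "u \<in> FM i" "connects i k u w"
    using connects_surj[OF assms(1) w(1)] by blast
  let ?u = "gr_part i j u"
  have c: "connects i k ?u w"
    using connects_gr_part[OF assms(1) u(2), of j] by (simp add: w(3))
  then show ?thesis
    using connects_Z(2)[OF assms(1) gr_part_in[OF u(1)] w(2) c] gr_part_homog[OF u(1)]
    unfolding Zgr_def by blast
qed

lemma connects_diff:
  assumes "connects i k u w" "connects i k u' w'"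
  shows "connects i k (\<lambda>r. u r - u' r) (\<lambda>r. w r - w' r)"
  unfolding connects_def
proof
  fix c
  have "codiff i u c - a k * w c \<in> J k" "codiff i u' c - a k * w' c \<in> J k"
    using assms unfolding connects_def by blast+
  then have "(codiff i u c - a k * w c) - (codiff i u' c - a k * w' c) \<in> J k"
    by (rule J_diff)
  then show "codiff i (\<lambda>r. u r - u' r) c - a k * (w c - w' c) \<in> J k"
    by (simp add: codiff_map_diff algebra_simps)
qed

lemma connects_lin_comb:
  assumes "\<And>x. x \<in> X \<Longrightarrow> connects i k (b x) (b' x)"
  shows "connects i k (lin_comb X c b) (lin_comb X c b')"
  unfolding connects_def
proof
  fix r
  have "(\<Sum>x\<in>X. Const (c x) * (codiff i (b x) r - a k * b' x r)) \<in> J k"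
    using assms unfolding connects_def by (intro ideal_sum[OF ideal_J] J_mult Const_in_poly_ring) auto
  also have "(\<Sum>x\<in>X. Const (c x) * (codiff i (b x) r - a k * b' x r))
      = codiff i (lin_comb X c b) r - a k * lin_comb X c b' r"
    by (simp add: lin_comb_def codiff_map_sum codiff_map_scale sum_distrib_left sum_subtractf algebra_simps)
  finally show "codiff i (lin_comb X c b) r - a k * lin_comb X c b' r \<in> J k" .
qed

lemma lin_comb_FM: "(\<And>x. x \<in> X \<Longrightarrow> b x \<in> FM i) \<Longrightarrow> lin_comb X c b \<in> FM i"
  unfolding lin_comb_def by (intro FM_sum FM_scale Const_in_poly_ring)

text \<open>The new basis consists of images under the connecting map. They span by
  \<open>connects_graded_surj\<close> and \<open>connects_B_imp\<close>, and are independent by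
  \<open>connects_B_rev\<close>.\<close>

lemma basis_mod_shift:
  assumes ik: "i + k < N" and b: "basis_mod X b (Zgr i (Suc k) j) (B i (Suc k))"
  shows "\<exists>b'. basis_mod X b' (Zgr (Suc i) k (j - 2)) (B (Suc i) k)"
proof -
  have k: "k < N" using ik by simp
  have "\<forall>x. \<exists>w. x \<in> X \<longrightarrow> w \<in> Zgr (Suc i) k (j - 2) \<and> connects i k (b x) w"
    using connects_graded_exists[OF k] b unfolding basis_mod_def by blast
  from choice[OF this] obtain b' where b': "\<And>x. x \<in> X \<Longrightarrow> b' x \<in> Zgr (Suc i) k (j - 2)"
    "\<And>x. x \<in> X \<Longrightarrow> connects i k (b x) (b' x)" by blast
  have bF: "lin_comb X c b \<in> FM i" for c
    using b unfolding basis_mod_def Zgr_def Z_def by (intro lin_comb_FM) auto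
  have b'F: "lin_comb X c b' \<in> FM (Suc i)" for c
    using b'(1) unfolding Zgr_def Z_def by (intro lin_comb_FM) auto
  have "\<exists>c. (\<lambda>r. z r - lin_comb X c b' r) \<in> B (Suc i) k" if z: "z \<in> Zgr (Suc i) k (j - 2)" for z
  proof -
    obtain u where u: "u \<in> Zgr i (Suc k) j" "connects i k u z"
      using connects_graded_surj[OF k z] by blast
    obtain c where c: "(\<lambda>r. u r - lin_comb X c b r) \<in> B i (Suc k)"
      using b u(1) unfolding basis_mod_def by blast
    have "(\<lambda>r. z r - lin_comb X c b' r) \<in> FM (Suc i)"
      using z b'F unfolding Zgr_def Z_def by (intro FM_diff) auto
    then have "(\<lambda>r. z r - lin_comb X c b' r) \<in> B (Suc i) k"
      by (rule connects_B_imp[OF k c]) (intro connects_diff u(2) connects_lin_comb b'(2))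
    then show ?thesis by blast
  qed
  moreover have "\<forall>x\<in>X. c x = 0" if "lin_comb X c b' \<in> B (Suc i) k" for c
  proof -
    have "lin_comb X c b \<in> B i (Suc k)"
      by (rule connects_B_rev[OF ik bF that]) (intro connects_lin_comb b'(2))
    then show ?thesis
      using b unfolding basis_mod_def by blast
  qed
  ultimately show ?thesis
    using b'(1) unfolding basis_mod_def by (intro exI[of _ b']) blast
qed

lemma basis_mod_Ext:
  assumes "basis_mod X b (Zgr 0 N j) (B 0 N)"
  shows "\<exists>b'. basis_mod X b' (Zgr N 0 (j - 2 * int N)) (B N 0)"
proof -
  \<comment> \<open>The walk follows the diagonal from (0, N) to (N, 0). Each shift uses the pair
    \<open>i\<close> and \<open>N - Suc i\<close>, with sum \<open>N - 1\<close>, the last one for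
    which \<open>vanishing\<close> holds.\<close>
  have "i \<le> N \<Longrightarrow> \<exists>b'. basis_mod X b' (Zgr i (N - i) (j - 2 * int i)) (B i (N - i))" for i
  proof (induction i)
    case 0
    then show ?case using assms by auto
  next
    case (Suc i)
    then obtain b' where "basis_mod X b' (Zgr i (N - i) (j - 2 * int i)) (B i (N - i))"
      by auto
    moreover have "N - i = Suc (N - Suc i)" "j - 2 * int (Suc i) = j - 2 * int i - 2"
      using Suc.prems by auto
    ultimately show ?case
      using basis_mod_shift[of i "N - Suc i" X b' "j - 2 * int i"] Suc.prems by (simp only:)
  qed
  from this[of N] show ?thesis by simp
qed

lemma B_top: "B i 0 = coboundaries V \<rho> i"
  unfolding B_def J_0 using coboundary_in by (auto simp: fun_eq_iff) (metis ext)

lemma Z_top: "Z i 0 = cocycles V \<rho> i"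
  unfolding Z_def J_0 cocycles_def by (auto simp: fun_eq_iff)

end

declare One_nat_def [simp del]

section \<open>Cosets\<close>

text \<open>Cosets for the addition of the type. The coset operations of the ring and module records
  reduce to these, after which ordinary arithmetic on representatives is available.\<close>

definition coset :: "'a::ab_group_add set \<Rightarrow> 'a \<Rightarrow> 'a set" where
  "coset H x = (\<lambda>h. h + x) ` H"

definition add_subgroup :: "'a::ab_group_add set \<Rightarrow> bool" where
  "add_subgroup H \<longleftrightarrow> 0 \<in> H \<and> (\<forall>x\<in>H. \<forall>y\<in>H. x - y \<in> H)"

lemma add_subgroupD:
  assumes "add_subgroup H"
  shows "0 \<in> H" "x \<in> H \<Longrightarrow> y \<in> H \<Longrightarrow> x - y \<in> H" "x \<in> H \<Longrightarrow> - x \<in> H"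
    "x \<in> H \<Longrightarrow> y \<in> H \<Longrightarrow> x + y \<in> H"
proof -
  show 2: "x - y \<in> H" if "x \<in> H" "y \<in> H" for x y
    using assms that by (auto simp: add_subgroup_def)
  show 0: "0 \<in> H" using assms by (simp add: add_subgroup_def)
  show 3: "- x \<in> H" if "x \<in> H" for x
    using 2[OF 0 that] by simp
  show "x \<in> H \<Longrightarrow> y \<in> H \<Longrightarrow> x + y \<in> H"
    using 2[OF _ 3, of x y] by simp
qed

lemma coset_iff: "y \<in> coset H x \<longleftrightarrow> y - x \<in> H"
  by (auto simp: coset_def image_iff intro: bexI[of _ "y - x"])

lemma coset_eq_iff:
  assumes "add_subgroup H"
  shows "coset H x = coset H y \<longleftrightarrow> x - y \<in> H"
proof
  assume "coset H x = coset H y"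
  moreover have "x \<in> coset H x"
    using add_subgroupD(1)[OF assms] by (simp add: coset_iff)
  ultimately show "x - y \<in> H"
    using coset_iff by blast
next
  assume xy: "x - y \<in> H"
  have "z - x \<in> H \<longleftrightarrow> z - y \<in> H" for z
    using add_subgroupD(4)[OF assms _ xy, of "z - x"] add_subgroupD(2)[OF assms _ xy, of "z - y"]
    by auto
  then show "coset H x = coset H y"
    by (auto simp: coset_iff)
qed

lemma coset_zero: "coset H 0 = H"
  by (auto simp: coset_iff)

lemma coset_add:
  assumes "add_subgroup H"
  shows "(\<Union>x'\<in>coset H x. \<Union>y'\<in>coset H y. {x' + y'}) = coset H (x + y)"
proof (intro equalityI subsetI)
  fix z assume "z \<in> (\<Union>x'\<in>coset H x. \<Union>y'\<in>coset H y. {x' + y'})"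
  then obtain x' y' where "x' - x \<in> H" "y' - y \<in> H" "z = x' + y'"
    by (auto simp: coset_iff)
  then show "z \<in> coset H (x + y)"
    using add_subgroupD(4)[OF assms, of "x' - x" "y' - y"] by (simp add: coset_iff algebra_simps)
next
  fix z assume "z \<in> coset H (x + y)"
  then have "z - y \<in> coset H x" "y \<in> coset H y" "z = (z - y) + y"
    using add_subgroupD(1)[OF assms] by (auto simp: coset_iff algebra_simps)
  then show "z \<in> (\<Union>x'\<in>coset H x. \<Union>y'\<in>coset H y. {x' + y'})"
    by blast
qed

text \<open>Quotient modules define scalar multiplication by a union over all representatives; here
  all of them give the same coset.\<close>

lemma UN_coset:
  assumes "add_subgroup H" "\<And>h. h \<in> H \<Longrightarrow> f (h + x) - f x \<in> H"
  shows "(\<Union>y\<in>coset H x. coset H (f y)) = coset H (f x)"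
proof -
  have "coset H (f y) = coset H (f x)" if "y \<in> coset H x" for y
    using assms(2)[of "y - x"] that by (simp add: coset_iff coset_eq_iff[OF assms(1)])
  moreover have "x \<in> coset H x"
    using add_subgroupD(1)[OF assms(1)] by (simp add: coset_iff)
  ultimately show ?thesis
    by (blast 4 | auto)
qed

lemma a_r_coset_eq_coset: "add G = (+) \<Longrightarrow> H +>\<^bsub>G\<^esub> x = coset H x"
  by (auto simp: a_r_coset_def r_coset_def coset_def)

lemma set_add_eq: "add G = (+) \<Longrightarrow> set_add G A C = (\<Union>x\<in>A. \<Union>y\<in>C. {x + y})"
  by (auto simp: set_add_def set_mult_def)

section \<open>The algebra \<open>R\<^sub>\<Delta>\<close>\<close>

definition xy_mono :: "nat \<Rightarrow> nat \<Rightarrow> (nat \<Rightarrow>\<^sub>0 nat)" where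
  "xy_mono n i = single i 1 + single (n + i) 1"

text \<open>Generated by x_1 y_1, ..., x_k y_k. Since the regular sequence is counted from 0, its
  element number k is x_(k+1) y_(k+1), that is \<open>xy_mono n (Suc k)\<close>.\<close>

definition xy_ideal :: "nat \<Rightarrow> nat \<Rightarrow> 'f::field mpoly set" where
  "xy_ideal n k = mono_ideal {1..2 * n} (\<lambda>m. \<exists>i\<in>{1..k}. {i, n + i} \<subseteq> keys m)"

lemma keys_xy_mono: "keys (xy_mono n i) = {i, n + i}"
  by (auto simp: xy_mono_def keys_add_nat)

lemma xy_mono_adds: "1 \<le> n \<Longrightarrow> {i, n + i} \<subseteq> keys m \<Longrightarrow> \<exists>m'. m = xy_mono n i + m'"
  unfolding mono_adds_iff xy_mono_def
  by (auto simp: lookup_add lookup_single when_def in_keys_iff)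

lemma xy_ideal_Suc:
  assumes "k < n"
  shows "x \<in> xy_ideal n (Suc k) \<longleftrightarrow> (\<exists>q\<in>polys {1..2 * n}.
      x - single (xy_mono n (Suc k)) 1 * q \<in> (xy_ideal n k :: 'f::field mpoly set))"
    (is "_ \<longleftrightarrow> (\<exists>q\<in>?S. x - ?a * q \<in> ?J)")
proof
  let ?P = "\<lambda>k m. \<exists>i\<in>{1..k}. {i, n + i} \<subseteq> keys m"
  assume x: "x \<in> xy_ideal n (Suc k)"
  \<comment> \<open>The part of \<open>x\<close> that already lies in the smaller ideal; every other
    monomial must be divisible by the new generator.\<close>
  let ?r = "restr (?P k) x"
  have r: "?r \<in> ?J"
    unfolding xy_ideal_def mono_ideal_def
  proof (rule supported_conj[OF restr_preserves_supported restr_in_supported])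
    show "x \<in> polys {1..2 * n}"
      using x unfolding xy_ideal_def mono_ideal_def by (rule supported_mono) simp
  qed
  have "x - ?r \<in> supported (\<lambda>m. (mono_in {1..2 * n} m \<and> ?P (Suc k) m) \<and> \<not> ?P k m)"
    using x unfolding xy_ideal_def mono_ideal_def
    by (intro supported_conj[OF supported_diff diff_restr_supported] restr_preserves_supported)
  then have s: "x - ?r \<in> supported (\<lambda>m. mono_in {1..2 * n} m \<and> (\<exists>m'. m = xy_mono n (Suc k) + m'))"
  proof (rule supported_mono)
    fix m assume m: "(mono_in {1..2 * n} m \<and> ?P (Suc k) m) \<and> \<not> ?P k m"
    then obtain i where i: "i \<in> {1..Suc k}" "{i, n + i} \<subseteq> keys m" by blast
    then have "i = Suc k"
      using m by (metis atLeastAtMost_iff le_SucE)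
    then show "mono_in {1..2 * n} m \<and> (\<exists>m'. m = xy_mono n (Suc k) + m')"
      using m i(2) xy_mono_adds[of n "Suc k" m] assms by auto
  qed
  have "x - ?r \<in> supported (\<lambda>m. \<exists>m'. m = xy_mono n (Suc k) + m')"
    by (rule supported_mono[OF s]) simp
  then obtain q where q: "x - ?r = ?a * q"
    by (rule single_factor)
  have "?a * q \<in> ?S"
    unfolding q[symmetric] by (rule supported_mono[OF s]) simp
  then have "q \<in> ?S"
    unfolding supported_single_mult_iff by (rule supported_mono) (simp add: keys_add_nat)
  moreover have "x - ?a * q \<in> ?J"
    using r by (simp flip: q)
  ultimately show "\<exists>q\<in>?S. x - ?a * q \<in> ?J"
    by blast
next
  assume "\<exists>q\<in>?S. x - ?a * q \<in> ?J"
  then obtain q where q: "q \<in> ?S" "x - ?a * q \<in> ?J" by blast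
  have I: "ideal (xy_ideal n (Suc k) :: 'f mpoly set) (poly_ring {1..2 * n})"
    unfolding xy_ideal_def by (intro mono_ideal_ideal) (auto simp: up_closed_def keys_add_nat)
  have "?a \<in> xy_ideal n (Suc k)"
    unfolding xy_ideal_def using assms by (intro single_in_mono_ideal) (auto simp: keys_xy_mono)
  then have "q * ?a \<in> xy_ideal n (Suc k)"
    using q(1) by (rule ideal_poly_ringD(4)[OF I])
  moreover have "?J \<subseteq> xy_ideal n (Suc k)"
    unfolding xy_ideal_def by (rule mono_ideal_mono) auto
  ultimately have "(x - ?a * q) + q * ?a \<in> xy_ideal n (Suc k)"
    using q(2) by (intro ideal_poly_ringD(3)[OF I]) auto
  then show "x \<in> xy_ideal n (Suc k)"
    by (simp add: mult.commute)
qed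

text \<open>The new generator shares no variable with the earlier ones, so it cannot contribute to
  divisibility by them.\<close>

lemma xy_ideal_regular:
  assumes "k < n" "q \<in> polys {1..2 * n}"
    and "single (xy_mono n (Suc k)) 1 * q \<in> (xy_ideal n k :: 'f::field mpoly set)"
  shows "q \<in> xy_ideal n k"
proof -
  have "q \<in> supported (\<lambda>m. mono_in {1..2 * n} (xy_mono n (Suc k) + m) \<and>
      (\<exists>i\<in>{1..k}. {i, n + i} \<subseteq> keys (xy_mono n (Suc k) + m)))"
    using assms(3) unfolding xy_ideal_def mono_ideal_def supported_single_mult_iff .
  then show ?thesis
    unfolding xy_ideal_def mono_ideal_def
  proof (rule supported_mono, intro conjI)
    fix m assume "mono_in {1..2 * n} (xy_mono n (Suc k) + m) \<and>
      (\<exists>i\<in>{1..k}. {i, n + i} \<subseteq> keys (xy_mono n (Suc k) + m))"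
    then obtain i where m: "mono_in {1..2 * n} m" and i: "i \<in> {1..k}"
      "{i, n + i} \<subseteq> {Suc k, n + Suc k} \<union> keys m"
      by (auto simp: keys_add_nat keys_xy_mono)
    show "mono_in {1..2 * n} m" by fact
    have "{i, n + i} \<inter> {Suc k, n + Suc k} = {}"
      using i(1) assms(1) by auto
    then show "\<exists>i\<in>{1..k}. {i, n + i} \<subseteq> keys m"
      using i by blast
  qed
qed

locale gamma_resolution =
  fixes n d :: nat and \<Delta> :: "nat set set" and \<rho> :: "('f::field mpoly, 'f mpoly set) resolution"
  assumes complex: "simplicial_complex_on n \<Delta>"
    and complex_dim: "complex_dim \<Delta> = int d - 1"
    and resolution: "graded_free_resolution {1..2 * n} (Gamma_module n \<Delta>) (Gamma_grade n \<Delta>) \<rho>"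
begin

abbreviation "V \<equiv> {1..2 * n}"
abbreviation S :: "'f mpoly set" where "S \<equiv> polys V"
abbreviation I :: "'f mpoly set" where "I \<equiv> Gamma_ideal n \<Delta>"

abbreviation M :: "('f mpoly, 'f mpoly set) module" where "M \<equiv> Gamma_module n \<Delta>"

lemma ideal_Gamma: "ideal I (poly_ring V)"
  unfolding Gamma_ideal_eq[OF complex] by (rule mono_ideal_ideal[OF up_closed_gamma_nonface[OF complex]])

lemma subgroup_Gamma: "add_subgroup I"
  using ideal_poly_ringD[OF ideal_Gamma] by (auto simp: add_subgroup_def)

lemma carrier_Gamma_module: "carrier M = coset I ` S"
  by (auto simp: Gamma_module_def quot_module_def regular_module_def A_RCOSETS_def RCOSETS_def
      a_r_coset_def[symmetric] a_r_coset_eq_coset carrier_poly_ring image_iff r_coset_def coset_def)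

lemma add_Gamma_module: "coset I p \<oplus>\<^bsub>M\<^esub> coset I q = coset I (p + q)"
  by (simp add: Gamma_module_def quot_module_def set_add_eq regular_module_def coset_add[OF subgroup_Gamma])

lemma smult_Gamma_module:
  assumes "p \<in> S"
  shows "p \<odot>\<^bsub>M\<^esub> coset I q = coset I (p * q)"
proof -
  have "(\<Union>w\<in>coset I q. coset I (p * w)) = coset I (p * q)"
    using ideal_poly_ringD(4)[OF ideal_Gamma _ assms]
    by (intro UN_coset[OF subgroup_Gamma]) (simp add: algebra_simps)
  then show ?thesis
    by (simp add: Gamma_module_def quot_module_def regular_module_def a_r_coset_eq_coset)
qed

lemma zero_Gamma_module: "\<zero>\<^bsub>M\<^esub> = coset I 0"
  by (simp add: Gamma_module_def quot_module_def coset_zero)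

lemma abelian_group_Gamma_module: "abelian_group M"
proof (rule abelian_groupI)
  fix x assume "x \<in> carrier M"
  then obtain p where "p \<in> S" "x = coset I p"
    by (auto simp: carrier_Gamma_module)
  then show "\<exists>y\<in>carrier M. y \<oplus>\<^bsub>M\<^esub> x = \<zero>\<^bsub>M\<^esub>"
    by (intro bexI[of _ "coset I (- p)"])
      (auto simp: add_Gamma_module carrier_Gamma_module zero_Gamma_module supported_uminus)
qed (auto simp: add_Gamma_module carrier_Gamma_module zero_Gamma_module algebra_simps supported_add)

lemma finsum_Gamma_module:
  assumes "finite X" "\<And>x. x \<in> X \<Longrightarrow> g x \<in> S"
  shows "finsum M (\<lambda>x. coset I (g x)) X = coset I (sum g X)"
proof -
  interpret abelian_group M by (rule abelian_group_Gamma_module)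
  show ?thesis
    using assms
  proof (induction X)
    case (insert x X)
    have "finsum M (\<lambda>x. coset I (g x)) (insert x X)
        = coset I (g x) \<oplus>\<^bsub>M\<^esub> finsum M (\<lambda>x. coset I (g x)) X"
      using insert by (intro finsum_insert) (auto simp: carrier_Gamma_module)
    then show ?case
      using insert by (simp add: add_Gamma_module)
  qed (simp add: zero_Gamma_module)
qed

lemma Gamma_grade_eq: "Gamma_grade n \<Delta> j = coset I ` homog V j"
  by (simp add: Gamma_grade_def a_r_coset_eq_coset)

definition gens :: "nat \<Rightarrow> 'f mpoly" where
  "gens r = (SOME p. p \<in> homog V (bdeg \<rho> 0 r) \<and> aug \<rho> r = coset I p)"

lemma gens:
  assumes "r < rank \<rho> 0"
  shows "gens r \<in> homog V (bdeg \<rho> 0 r)" "aug \<rho> r = coset I (gens r)"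
proof -
  have "aug \<rho> r \<in> Gamma_grade n \<Delta> (bdeg \<rho> 0 r)"
    using resolution assms by (simp add: graded_free_resolution_def)
  then have "\<exists>p. p \<in> homog V (bdeg \<rho> 0 r) \<and> aug \<rho> r = coset I p"
    by (auto simp: Gamma_grade_eq)
  from someI_ex[OF this] show "gens r \<in> homog V (bdeg \<rho> 0 r)" "aug \<rho> r = coset I (gens r)"
    by (auto simp: gens_def)
qed

lemma aug_map_eq:
  assumes "v \<in> carrier (free_module V (rank \<rho> 0))"
  shows "aug_map M \<rho> v = coset I (\<Sum>r<rank \<rho> 0. v r * gens r)"
proof -
  interpret abelian_group M by (rule abelian_group_Gamma_module)
  have vS: "v r * gens r \<in> S" if "r < rank \<rho> 0" for r
    by (intro poly_ring_mult free_moduleD[OF assms] homog_subset[OF gens(1)[OF that]])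
  have "aug_map M \<rho> v
      = finsum M (\<lambda>r. coset I (v r * gens r)) {..<rank \<rho> 0}"
    unfolding aug_map_def using vS
    by (intro finsum_cong') (auto simp: gens(2) smult_Gamma_module free_moduleD[OF assms] carrier_Gamma_module)
  also have "\<dots> = coset I (\<Sum>r<rank \<rho> 0. v r * gens r)"
    by (rule finsum_Gamma_module) (auto simp: vS)
  finally show ?thesis .
qed

text \<open>Through \<open>aug_map_eq\<close> the kernel and image conditions on the augmentation
  become statements about polynomials modulo \<open>I\<close>; the remaining conditions are the
  monomial lemmas on \<open>xy_ideal\<close>.\<close>

sublocale annihilating_regular_sequence V I \<rho> gens "xy_ideal n"
  "\<lambda>k. single (xy_mono n (Suc k)) 1" n
proof (intro annihilating_regular_sequence.intro cyclic_resolution.intro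
    annihilating_regular_sequence_axioms.intro)
  note res = resolution[unfolded graded_free_resolution_def]
  show "ideal I (poly_ring V)" by (rule ideal_Gamma)
  show "r < rank \<rho> 0 \<Longrightarrow> gens r \<in> homog V (bdeg \<rho> 0 r)" for r by (rule gens(1))
  show "r < rank \<rho> k \<Longrightarrow> c < rank \<rho> (Suc k) \<Longrightarrow> diff \<rho> k r c \<in> homog V (bdeg \<rho> (Suc k) c - bdeg \<rho> k r)"
    for k r c
    using res by blast
  show "{v \<in> carrier (free_module V (rank \<rho> (Suc k))). diff_map \<rho> k v = (\<lambda>_. 0)} =
      diff_map \<rho> (Suc k) ` carrier (free_module V (rank \<rho> (Suc (Suc k))))" for k
    using res by blast
  have "coset I 1 \<in> carrier M"
    by (auto simp: carrier_Gamma_module one_in_poly_ring)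
  moreover have "aug_map M \<rho> ` carrier (free_module V (rank \<rho> 0)) = carrier M"
    using res by blast
  ultimately obtain v where v: "v \<in> carrier (free_module V (rank \<rho> 0))"
    "aug_map M \<rho> v = coset I 1"
    by (metis (no_types, lifting) image_iff)
  then show "\<exists>v\<in>carrier (free_module V (rank \<rho> 0)). (\<Sum>r<rank \<rho> 0. v r * gens r) - 1 \<in> I"
    by (auto simp: aug_map_eq coset_eq_iff[OF subgroup_Gamma])
  have *: "(\<Sum>r<rank \<rho> 0. v r * gens r) \<in> I \<longleftrightarrow> aug_map M \<rho> v = \<zero>\<^bsub>M\<^esub>"
    if "v \<in> carrier (free_module V (rank \<rho> 0))" for v
    using that by (simp add: aug_map_eq zero_Gamma_module coset_eq_iff[OF subgroup_Gamma])
  have "{v \<in> carrier (free_module V (rank \<rho> 0)). (\<Sum>r<rank \<rho> 0. v r * gens r) \<in> I} =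
      {v \<in> carrier (free_module V (rank \<rho> 0)). aug_map M \<rho> v = \<zero>\<^bsub>M\<^esub>}"
    using * by blast
  also have "\<dots> = diff_map \<rho> 0 ` carrier (free_module V (rank \<rho> 1))"
    using res by blast
  finally show "{v \<in> carrier (free_module V (rank \<rho> 0)). (\<Sum>r<rank \<rho> 0. v r * gens r) \<in> I} =
      diff_map \<rho> 0 ` carrier (free_module V (rank \<rho> 1))" .
  show "ideal (xy_ideal n k :: 'f mpoly set) (poly_ring V)" for k
    unfolding xy_ideal_def by (intro mono_ideal_ideal) (auto simp: up_closed_def keys_add_nat)
  show "(xy_ideal n 0 :: 'f mpoly set) = {0}"
    by (auto simp: xy_ideal_def mono_ideal_def supported_False)
  fix k assume k: "k < n"
  have "Suc k \<in> xsupp n (xy_mono n (Suc k)) \<inter> ysupp n (xy_mono n (Suc k))"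
    using k by (simp add: keys_xy_mono xsupp_def ysupp_def)
  then have "gamma_nonface n \<Delta> (xy_mono n (Suc k))"
    unfolding gamma_nonface_def by blast
  then show "single (xy_mono n (Suc k)) 1 \<in> I"
    unfolding Gamma_ideal_eq[OF complex] using k
    by (intro single_in_mono_ideal) (auto simp: keys_xy_mono)
  show "single (xy_mono n (Suc k)) 1 \<in> homog V 2"
    unfolding homog_eq_supported using k
    by (intro supported_single conjI) (auto simp: keys_xy_mono, simp add: xy_mono_def)
qed (auto simp: xy_ideal_Suc intro: xy_ideal_regular, auto simp: xy_ideal_def intro: mono_ideal_restr)

end

lemma finite_monos_le: "finite {m. mono_in A m \<and> mono_deg m \<le> k}" if "finite A" for A k
proof (rule finite_imageD)
  have "lookup ` {m. mono_in A m \<and> mono_deg m \<le> k}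
      \<subseteq> {f. \<forall>v. (v \<in> A \<longrightarrow> f v \<in> {..k}) \<and> (v \<notin> A \<longrightarrow> f v = 0)}"
    by (auto simp: in_keys_iff subset_iff intro: order.trans[OF lookup_le_mono_deg])
  then show "finite (lookup ` {m. mono_in A m \<and> mono_deg m \<le> k})"
    using finite_set_of_finite_funs[OF that, of "{..k}" 0] finite_subset by blast
  show "inj_on lookup {m. mono_in A m \<and> mono_deg m \<le> k}"
    by (rule inj_onI, rule poly_mapping_eqI) simp
qed

section \<open>Monomial bases of \<open>S/I\<close> and of Hom(S/I, S/J)\<close>

context gamma_resolution
begin

definition gamma_faces :: "int \<Rightarrow> (nat \<Rightarrow>\<^sub>0 nat) set" where
  "gamma_faces j = {m. mono_in V m \<and> \<not> gamma_nonface n \<Delta> m \<and> int (mono_deg m) = j}"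

definition omega_monos :: "int \<Rightarrow> (nat \<Rightarrow>\<^sub>0 nat) set" where
  "omega_monos j = {m. mono_in V m \<and> xsupp n m \<inter> ysupp n m = {} \<and> {1..n} - ysupp n m \<in> \<Delta> \<and>
     int (mono_deg m) = j}"

lemma finite_gamma_faces: "finite (gamma_faces j)"
  by (rule finite_subset[OF _ finite_monos_le[of V "nat j"]]) (auto simp: gamma_faces_def)

lemma finite_omega_monos: "finite (omega_monos j)"
  by (rule finite_subset[OF _ finite_monos_le[of V "nat j"]]) (auto simp: omega_monos_def)

lemma xy_ideal_top: "xy_ideal n n = mono_ideal V (\<lambda>m. xsupp n m \<inter> ysupp n m \<noteq> {})"
  unfolding xy_ideal_def by (intro arg_cong[where f = "mono_ideal V"] ext) (auto simp: xsupp_def ysupp_def)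

lemma xsupp_ysupp_mono_of:
  assumes "G \<subseteq> {1..n}"
  shows "xsupp n (mono_of G) = G" "ysupp n (mono_of G) = {}"
  using assms keys_mono_of[OF finite_subset[OF assms]] by (auto simp: xsupp_def ysupp_def)

text \<open>Let G be the complement of the y-support of \<open>m\<close>. If G were no face, the
  monomial x^G would lie in \<open>I\<close>, so x^G u would lie in the ideal of all x_i y_i and the
  monomial x^G m would contain some x_i and y_i. But G avoids the y-support and the supports of
  \<open>m\<close> are disjoint.\<close>

lemma colon_ideal_monos:
  assumes u: "u \<in> S" "\<And>f. f \<in> I \<Longrightarrow> u * f \<in> xy_ideal n n"
    and m: "lookup u m \<noteq> 0" "xsupp n m \<inter> ysupp n m = {}"
  shows "{1..n} - ysupp n m \<in> \<Delta>"
proof (rule ccontr)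
  let ?G = "{1..n} - ysupp n m"
  assume G: "?G \<notin> \<Delta>"
  have "?G \<subseteq> {1..n}" by blast
  note sG = xsupp_ysupp_mono_of[OF this]
  have "single (mono_of ?G) 1 \<in> I"
    unfolding Gamma_ideal_eq[OF complex] using G
    by (intro single_in_mono_ideal) (auto simp: gamma_nonface_def sG keys_mono_of)
  then have "single (mono_of ?G) 1 * u \<in> xy_ideal n n"
    using u(2) by (subst mult.commute) blast
  then have "u \<in> supported (\<lambda>m. mono_in V (mono_of ?G + m) \<and>
      xsupp n (mono_of ?G + m) \<inter> ysupp n (mono_of ?G + m) \<noteq> {})"
    unfolding xy_ideal_top mono_ideal_def supported_single_mult_iff .
  then have "xsupp n (mono_of ?G + m) \<inter> ysupp n (mono_of ?G + m) \<noteq> {}"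
    using m(1) by (auto dest: supportedD)
  then show False
    using m(2) by (auto simp: xsupp_add ysupp_add sG)
qed

text \<open>A monomial of \<open>I\<close> whose product with \<open>m\<close> had disjoint supports
  would have its x-support inside the face {1..n} minus the y-support of \<open>m\<close>, and would
  not be a nonface after all.\<close>

lemma omega_mono_mult:
  assumes "m \<in> omega_monos j" "f \<in> I"
  shows "single m 1 * f \<in> xy_ideal n n"
  unfolding xy_ideal_top mono_ideal_def supported_single_mult_iff
proof (rule supported_mono)
  show "f \<in> supported (\<lambda>m. mono_in V m \<and> gamma_nonface n \<Delta> m)"
    using assms(2) unfolding Gamma_ideal_eq[OF complex] mono_ideal_def .
  fix m' assume m': "mono_in V m' \<and> gamma_nonface n \<Delta> m'"
  have "xsupp n (m + m') \<inter> ysupp n (m + m') \<noteq> {}"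
  proof
    assume disj: "xsupp n (m + m') \<inter> ysupp n (m + m') = {}"
    then have "xsupp n m' \<subseteq> {1..n} - ysupp n m"
      by (auto simp: xsupp_add ysupp_add xsupp_def[of n m'])
    then have "xsupp n m' \<in> \<Delta>"
      using complex assms(1) unfolding simplicial_complex_on_def omega_monos_def by blast
    then show False
      using m' disj by (auto simp: gamma_nonface_def xsupp_add ysupp_add)
  qed
  then show "mono_in V (m + m') \<and> xsupp n (m + m') \<inter> ysupp n (m + m') \<noteq> {}"
    using m' assms(1) by (auto simp: keys_add_nat omega_monos_def)
qed

text \<open>The homomorphism that sends 1 to the monomial \<open>m\<close>, recorded by its values
  on the basis of F_0, whose r-th element maps to the class of \<open>gens r\<close>.\<close>

definition hom_basis :: "(nat \<Rightarrow>\<^sub>0 nat) \<Rightarrow> nat \<Rightarrow> 'f mpoly" where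
  "hom_basis m r = (if r < rk 0 then single m 1 * gens r else 0)"

lemma gens_in: "r < rk 0 \<Longrightarrow> gens r \<in> S"
  by (rule p_in)

text \<open>Evaluation of a homomorphism \<open>S/I \<rightarrow> S/J\<close> at \<open>1\<close> identifies \<open>Hom(S/I, S/J)\<close> with \<open>(J : I)/J\<close>.\<close>

lemma basis_mod_Hom: "basis_mod (omega_monos j) hom_basis (Zgr 0 n j) (B 0 n)"
proof -
  let ?J = "xy_ideal n n :: 'f mpoly set"
  let ?X = "omega_monos j"
  obtain v where v: "v \<in> FM 0" "(\<Sum>r<rk 0. v r * gens r) - 1 \<in> I"
    using p_generate by blast
  let ?g = "\<Sum>r<rk 0. v r * gens r"
  let ?U = "\<lambda>c. \<Sum>m\<in>?X. Const (c m) * single m 1"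
  have single_S: "single m 1 \<in> S" if "m \<in> ?X" for m
    using that by (intro supported_single) (simp add: omega_monos_def)
  have US: "?U c \<in> S" for c
    by (intro supported_sum poly_ring_mult Const_in_poly_ring single_S)
  have lc: "lin_comb ?X c hom_basis r = (if r < rk 0 then ?U c * gens r else 0)" for c r
    by (auto simp: lin_comb_def hom_basis_def sum_distrib_right mult.assoc)
  have bF: "hom_basis m \<in> FM 0" if "m \<in> ?X" for m
    using single_S[OF that] gens_in by (auto simp: free_module_iff hom_basis_def poly_ring_mult)
  have "hom_basis m \<in> Zgr 0 n j" if m: "m \<in> ?X" for m
  proof -
    have "codiff 0 (hom_basis m) c \<in> ?J" for c
    proof (cases "c < rk 1")
      case True
      have "dmap 0 (unit_vec c) \<in> dmap 0 ` FM 1"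
        using unit_vec_in[OF True] by blast
      then have "(\<Sum>r<rk 0. dmap 0 (unit_vec c) r * gens r) \<in> I"
        unfolding exact_0[symmetric] by blast
      also have "(\<Sum>r<rk 0. dmap 0 (unit_vec c) r * gens r)
          = (\<Sum>r<rk 0. diff \<rho> 0 r c * gens r)"
        using True by (intro sum.cong refl) (simp add: diff_map_unit_vec One_nat_def)
      finally have "single m 1 * (\<Sum>r<rk 0. diff \<rho> 0 r c * gens r) \<in> ?J"
        by (rule omega_mono_mult[OF m])
      moreover have "codiff 0 (hom_basis m) c
          = single m 1 * (\<Sum>r<rk 0. diff \<rho> 0 r c * gens r)"
        using True by (simp add: codiff_map_simps One_nat_def hom_basis_def sum_distrib_left algebra_simps)
      ultimately show ?thesis by simp
    qed (simp add: codiff_map_simps One_nat_def J_zero)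
    moreover have "hom_basis m r \<in> homog V (j + bdeg \<rho> 0 r)" if "r < rk 0" for r
    proof -
      have "single m 1 \<in> homog V j"
        using m unfolding homog_eq_supported by (intro supported_single) (simp add: omega_monos_def)
      then show ?thesis
        using that homog_mult[OF _ gens(1)[OF that]] by (simp add: hom_basis_def)
    qed
    ultimately show ?thesis
      using bF[OF m] by (simp add: Zgr_def Z_def)
  qed
  moreover have "\<exists>c. (\<lambda>r. w r - lin_comb ?X c hom_basis r) \<in> B 0 n" if w: "w \<in> Zgr 0 n j" for w
  proof -
    have wF: "w \<in> FM 0" and wJ: "\<And>c. codiff 0 w c \<in> ?J"
      and wh: "\<And>r. r < rk 0 \<Longrightarrow> w r \<in> homog V (j + bdeg \<rho> 0 r)"
      using w by (auto simp: Zgr_def Z_def)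
    have ker: "(\<Sum>r<rk 0. w r * x r) \<in> ?J" if "x \<in> FM 0" "(\<Sum>r<rk 0. x r * gens r) \<in> I" for x
    proof -
      have "x \<in> dmap 0 ` FM 1"
        unfolding exact_0[symmetric] using that by simp
      then obtain y where y: "y \<in> FM 1" "x = dmap 0 y"
        by blast
      have "(\<Sum>c<rk 1. codiff 0 w c * y c) \<in> ?J"
        using J_mult[OF wJ free_moduleD[OF y(1)]] by (intro ideal_sum[OF ideal_J]) (simp add: mult.commute)
      then show ?thesis
        by (simp add: y(2) codiff_map_adjoint One_nat_def)
    qed
    \<comment> \<open>The value of \<open>w\<close> at 1, since \<open>v\<close> is a preimage of 1
      under the augmentation.\<close>
    define u where "u = (\<Sum>r<rk 0. v r * w r)"
    have uS: "u \<in> S"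
      unfolding u_def by (intro poly_ring_sum free_moduleD[OF v(1)] free_moduleD[OF wF])
    have uI: "u * f \<in> ?J" if f: "f \<in> I" for f
    proof -
      have "(\<Sum>r<rk 0. (f * v r) * gens r) = ?g * f"
        by (simp add: sum_distrib_left sum_distrib_right algebra_simps)
      also have "\<dots> \<in> I"
        by (intro ideal_poly_ringD(4)[OF ideal_I f] poly_ring_sum free_moduleD[OF v(1)] gens_in) simp
      finally have "(\<Sum>r<rk 0. w r * (f * v r)) \<in> ?J"
        by (intro ker FM_scale I_in[OF f] v(1))
      then show ?thesis
        by (simp add: u_def sum_distrib_left sum_distrib_right algebra_simps)
    qed
    have wu: "w r - u * gens r \<in> ?J" if r: "r < rk 0" for r
    proof -
      \<comment> \<open>Both terms have the image \<open>gens r\<close> in \<open>S/I\<close>, so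
        \<open>w\<close> maps their difference into \<open>?J\<close>.\<close>
      let ?x = "\<lambda>q. unit_vec r q - gens r * v q"
      have "(\<Sum>q<rk 0. ?x q * gens q) = (\<Sum>q<rk 0. gens q * unit_vec r q) - gens r * (\<Sum>q<rk 0. v q * gens q)"
        by (simp add: sum_subtractf sum_distrib_left algebra_simps)
      also have "\<dots> = - (gens r * ((\<Sum>q<rk 0. v q * gens q) - 1))"
        unfolding sum_mult_unit_vec[OF r] by (simp add: algebra_simps)
      also have "\<dots> \<in> I"
        by (intro ideal_poly_ringD(4,5)[OF ideal_I] v(2) gens_in r)
      finally have "(\<Sum>q<rk 0. w q * ?x q) \<in> ?J"
        by (intro ker FM_diff FM_scale unit_vec_in r v(1) gens_in)
      also have "(\<Sum>q<rk 0. w q * ?x q) = (\<Sum>q<rk 0. w q * unit_vec r q) - u * gens r"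
        by (simp add: u_def sum_subtractf sum_distrib_left sum_distrib_right algebra_simps)
      finally show ?thesis
        by (simp add: sum_mult_unit_vec[OF r])
    qed
    \<comment> \<open>\<open>v\<close> need not be homogeneous, hence neither need \<open>u\<close>.
      As \<open>w\<close> and \<open>gens\<close> are, passing to the component of degree
      \<open>j\<close> keeps the congruence \<open>w r = u * gens r\<close>.\<close>
    let ?u = "hcomp j u"
    let ?c = "\<lambda>m. lookup u m"
    let ?P = "\<lambda>m. mono_in V m \<and> int (mono_deg m) = j"
    have uh: "?u \<in> supported ?P"
      using hcomp_in_homog[OF uS] unfolding homog_eq_supported .
    have "?u - ?U ?c \<in> ?J"
    proof -
      have "lookup (?u - ?U ?c) m = 0" if "\<not> (?P m \<and> xsupp n m \<inter> ysupp n m \<noteq> {})" for m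
      proof (cases "m \<in> ?X")
        case True
        then have "int (mono_deg m) = j"
          by (simp add: omega_monos_def)
        with True show ?thesis
          by (simp add: lookup_minus lookup_restr lookup_sum_Const_single[OF finite_omega_monos])
      next
        case False
        have "?U ?c \<in> supported (\<lambda>m. m \<in> ?X)"
          unfolding Const_mult_single by (intro supported_sum supported_single)
        then have "lookup (?U ?c) m = 0"
          using False by (auto dest: supportedD)
        moreover have "lookup ?u m = 0"
        proof (rule ccontr)
          assume nz: "lookup ?u m \<noteq> 0"
          then have "?P m" "lookup u m \<noteq> 0"
            using supportedD[OF uh nz] by (auto simp: lookup_restr split: if_splits)
          then show False
            using colon_ideal_monos[OF uS uI, of m] that False by (auto simp: omega_monos_def)
        qed
        ultimately show ?thesis
          by (simp add: lookup_minus)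
      qed
      then show ?thesis
        unfolding xy_ideal_top mono_ideal_def supported_iff by blast
    qed
    have "w r - lin_comb ?X ?c hom_basis r \<in> ?J" for r
    proof (cases "r < rk 0")
      case True
      have "hcomp (j + bdeg \<rho> 0 r) (w r - gens r * u) \<in> ?J"
        using wu[OF True] by (intro hcomp_J) (simp add: mult.commute)
      then have "w r - gens r * ?u \<in> ?J"
        unfolding restr_diff hcomp_mult[OF gens(1)[OF True]] hcomp_homog[OF wh[OF True]] by simp
      moreover have "gens r * (?u - ?U ?c) \<in> ?J"
        by (intro J_mult \<open>?u - ?U ?c \<in> ?J\<close> gens_in True)
      ultimately have "(w r - gens r * ?u) + gens r * (?u - ?U ?c) \<in> ?J"
        by (rule J_add)
      then show ?thesis
        using True by (simp add: lc algebra_simps)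
    next
      case False
      then show ?thesis
        using free_module_zero[OF wF, of r] by (simp add: lc J_zero)
    qed
    moreover have "(\<lambda>r. w r - lin_comb ?X ?c hom_basis r) \<in> FM 0"
      by (intro FM_diff wF lin_comb_FM bF)
    ultimately have "(\<lambda>r. w r - lin_comb ?X ?c hom_basis r) \<in> B 0 n"
      by (simp add: B_def coboundaries_def)
    then show ?thesis by blast
  qed
  moreover have "\<forall>x\<in>?X. c x = 0" if "lin_comb ?X c hom_basis \<in> B 0 n" for c
  proof -
    have "lin_comb ?X c hom_basis r \<in> ?J" for r
      using that by (simp add: B_def coboundaries_def)
    then have UJ: "?U c * gens r \<in> ?J" if "r < rk 0" for r
      using that lc[of c r] by metis
    have "(\<Sum>r<rk 0. v r * (?U c * gens r)) \<in> ?J"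
      by (intro ideal_sum[OF ideal_J] J_mult UJ free_moduleD[OF v(1)]) simp
    \<comment> \<open>Evaluation at 1 is exact only up to \<open>?g - 1\<close>, which lies in
      \<open>I\<close> and is multiplied into \<open>?J\<close> by each monomial of
      \<open>?X\<close>.\<close>
    moreover have "(\<Sum>m\<in>?X. Const (c m) * (single m 1 * (?g - 1))) \<in> ?J"
      by (intro ideal_sum[OF ideal_J] J_mult omega_mono_mult v(2) Const_in_poly_ring)
    then have "?U c * (?g - 1) \<in> ?J"
      by (simp add: sum_distrib_right mult.assoc)
    ultimately have "(\<Sum>r<rk 0. v r * (?U c * gens r)) - ?U c * (?g - 1) \<in> ?J"
      by (rule J_diff)
    also have "(\<Sum>r<rk 0. v r * (?U c * gens r)) - ?U c * (?g - 1) = ?U c"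
    proof -
      have "(\<Sum>r<rk 0. v r * (U * gens r)) = U * ?g" for U
        by (simp add: sum_distrib_left algebra_simps)
      then show ?thesis
        by (simp only: right_diff_distrib mult_1_right diff_diff_eq2 add_diff_cancel_left')
    qed
    finally have "?U c \<in> supported (\<lambda>m. mono_in V m \<and> xsupp n m \<inter> ysupp n m \<noteq> {})"
      unfolding xy_ideal_top mono_ideal_def .
    moreover have "?U c \<in> supported (\<lambda>m. m \<in> ?X)"
      unfolding Const_mult_single by (intro supported_sum supported_single)
    ultimately have "?U c = 0"
      by (rule supported_disjoint) (simp add: omega_monos_def)
    then show ?thesis
      using lookup_sum_Const_single[OF finite_omega_monos, of _ j c] by (metis lookup_zero)
  qed
  ultimately show ?thesis
    unfolding basis_mod_def by blast
qed

lemma basis_mod_omega: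
  "\<exists>b. basis_mod (omega_monos j) b (Zgr n 0 (j - 2 * int n)) (coboundaries V \<rho> n)"
  using basis_mod_Ext[OF basis_mod_Hom] by (simp add: B_top)

end

section \<open>Graded dimensions of the idealization\<close>

text \<open>\<open>dimension\<close> is generated by line extensions with vectors outside the
  previous space. So the basis is added one vector at a time, and independence shows that the new
  vector is not in the old span.\<close>

lemma (in ring) dimension_finsum:
  fixes \<kappa> :: "'k::field \<Rightarrow> 'a" and e :: "'i \<Rightarrow> 'a"
  assumes K: "subfield K R" "range \<kappa> = K"
    and \<kappa>: "\<And>a b. \<kappa> (a + b) = \<kappa> a \<oplus> \<kappa> b" "\<kappa> 1 = \<one>"
    and "finite X" "e ` X \<subseteq> carrier R"
    and "\<And>c. (\<Oplus>x\<in>X. \<kappa> (c x) \<otimes> e x) = \<zero> \<Longrightarrow> \<forall>x\<in>X. c x = 0"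
  shows "dimension (card X) K {\<Oplus>x\<in>X. \<kappa> (c x) \<otimes> e x | c. True}"
  using assms(5-)
proof (induction X rule: finite_induct)
  case empty
  then show ?case by simp
next
  case (insert x X)
  let ?F = "\<lambda>X c. \<Oplus>x\<in>X. \<kappa> (c x) \<otimes> e x"
  let ?E = "{?F X c | c. True}"
  have \<kappa>c: "\<kappa> a \<in> carrier R" for a
    using subfieldE(3)[OF K(1)] K(2) by auto
  have \<kappa>0: "\<kappa> 0 = \<zero>"
    using \<kappa>(1)[of 0 0] \<kappa>c[of 0] by (simp add: add.r_cancel_one)
  have ec: "e y \<in> carrier R" if "y \<in> insert x X" for y
    using insert.prems(1) that by auto
  have ins: "?F (insert x X) c = \<kappa> (c x) \<otimes> e x \<oplus> ?F X c" for c
    using insert.hyps ec \<kappa>c by (intro finsum_insert) auto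
  have cong: "?F X c = ?F X c'" if "\<And>y. y \<in> X \<Longrightarrow> c y = c' y" for c c'
    using that ec \<kappa>c by (intro finsum_cong') auto
  have Fc: "?F X c \<in> carrier R" for c
    using ec \<kappa>c by (intro finsum_closed) auto
  have Fadd: "?F X c \<oplus> ?F X c' = ?F X (\<lambda>y. c y + c' y)" for c c'
  proof -
    have "?F X (\<lambda>y. c y + c' y) = (\<Oplus>y\<in>X. \<kappa> (c y) \<otimes> e y \<oplus> \<kappa> (c' y) \<otimes> e y)"
      using ec \<kappa>c by (intro finsum_cong') (auto simp: \<kappa>(1) l_distr)
    also have "\<dots> = ?F X c \<oplus> ?F X c'"
      using ec \<kappa>c by (intro finsum_addf) auto
    finally show ?thesis ..
  qed
  have F0: "?F X (\<lambda>_. 0) = \<zero>"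
    using ec by (subst finsum_cong'[of X X "\<lambda>_. \<zero>"]) (auto simp: \<kappa>0)
  have "?F X c = \<zero> \<Longrightarrow> \<forall>y\<in>X. c y = 0" for c
  proof -
    assume F: "?F X c = \<zero>"
    have "?F X (c(x := 0)) = ?F X c"
      using insert.hyps(2) by (intro cong) auto
    then have "?F (insert x X) (c(x := 0)) = \<zero>"
      unfolding ins using ec F by (simp add: \<kappa>0 del: fun_upd_apply) (simp add: \<kappa>0)
    from insert.prems(2)[OF this] show "\<forall>y\<in>X. c y = 0"
      using insert.hyps(2) by (metis fun_upd_other insertCI)
  qed
  then have dim: "dimension (card X) K ?E"
    using insert.IH insert.prems(1) by auto
  have "e x \<notin> ?E"
  proof
    assume "e x \<in> ?E"
    then obtain c where c: "e x = ?F X c" by blast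
    define c' where "c' y = (if y = x then 1 else - c y)" for y
    have "?F X c' = ?F X (\<lambda>y. - c y)"
      using insert.hyps(2) by (intro cong) (auto simp: c'_def)
    then have "?F (insert x X) c' = ?F X c \<oplus> ?F X (\<lambda>y. - c y)"
      unfolding ins using ec by (simp add: c'_def \<kappa>(2) flip: c)
    also have "\<dots> = \<zero>"
      unfolding Fadd by (simp add: F0)
    finally have "c' x = 0"
      using insert.prems(2) by blast
    then show False
      by (simp add: c'_def)
  qed
  then have "dimension (Suc (card X)) K (line_extension K (e x) ?E)"
    using dim ec by (intro Suc_dim) auto
  moreover have "line_extension K (e x) ?E = {?F (insert x X) c | c. True}"
  proof (intro equalityI subsetI)
    fix u assume "u \<in> line_extension K (e x) ?E"
    then obtain a c where u: "u = \<kappa> a \<otimes> e x \<oplus> ?F X c"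
      unfolding line_extension_mem_iff using K(2) by blast
    have "?F X (c(x := a)) = ?F X c"
      using insert.hyps(2) by (intro cong) auto
    then have "?F (insert x X) (c(x := a)) = u"
      unfolding ins u by (simp del: fun_upd_apply) simp
    then show "u \<in> {?F (insert x X) c | c. True}" by blast
  next
    fix u assume "u \<in> {?F (insert x X) c | c. True}"
    then show "u \<in> line_extension K (e x) ?E"
      unfolding line_extension_mem_iff using K(2) ins by blast
  qed
  ultimately show ?case
    using insert.hyps by simp
qed

context gamma_resolution
begin

abbreviation R :: "('f mpoly set \<times> (nat \<Rightarrow> 'f mpoly) set) graded_algebra" where "R \<equiv> R_Delta n \<Delta> \<rho>"
abbreviation Zn :: "(nat \<Rightarrow> 'f mpoly) set" where "Zn \<equiv> cocycles V \<rho> n"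
abbreviation Bn :: "(nat \<Rightarrow> 'f mpoly) set" where "Bn \<equiv> coboundaries V \<rho> n"

text \<open>All elements are written through representatives, so that ring identities in
  \<open>R\<close> become identities of polynomials and vectors, compared by
  \<open>elt_eq_iff\<close>.\<close>

definition elt :: "'f mpoly \<Rightarrow> (nat \<Rightarrow> 'f mpoly) \<Rightarrow> 'f mpoly set \<times> (nat \<Rightarrow> 'f mpoly) set" where
  "elt p w = (coset I p, coset Bn w)"

definition act :: "'f mpoly \<Rightarrow> (nat \<Rightarrow> 'f mpoly) \<Rightarrow> nat \<Rightarrow> 'f mpoly" where
  "act p w = (\<lambda>i. p * w i)"

lemma Zn_iff: "w \<in> Zn \<longleftrightarrow> w \<in> FM n \<and> (\<forall>c. codiff n w c = 0)"
  by (auto simp: cocycles_def fun_eq_iff)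

lemma Zn_add: "v \<in> Zn \<Longrightarrow> w \<in> Zn \<Longrightarrow> v + w \<in> Zn"
  unfolding plus_fun_def Zn_iff by (simp add: FM_add codiff_map_add)

lemma Zn_uminus: "w \<in> Zn \<Longrightarrow> - w \<in> Zn"
  using FM_diff[OF FM_zero, of w n] codiff_map_diff[of \<rho> n "\<lambda>_. 0" w]
  unfolding Zn_iff fun_Compl_def by simp

lemma Zn_act: "p \<in> S \<Longrightarrow> w \<in> Zn \<Longrightarrow> act p w \<in> Zn"
  unfolding act_def Zn_iff by (simp add: FM_scale codiff_map_scale)

lemma Zn_zero: "0 \<in> Zn"
  unfolding zero_fun_def Zn_iff by (simp add: FM_zero)

lemma subgroup_Bn: "add_subgroup Bn"
proof -
  have "codiff i (\<lambda>_. 0) = (\<lambda>_. 0)" for i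
    by (rule ext) simp
  then have "(\<lambda>_. 0) \<in> coboundaries V \<rho> i" for i
    unfolding coboundaries_def using FM_zero by (cases i) (auto simp: image_iff, metis)
  then show ?thesis
    using coboundary_diff[of _ n] by (auto simp: add_subgroup_def zero_fun_def fun_diff_def)
qed

lemma act_add: "act p (v + w) = act p v + act p w" "act (p + q) w = act p w + act q w"
  "act p (act q w) = act (p * q) w" "act 1 w = w" "act 0 w = 0" "act p 0 = 0"
  by (auto simp: act_def fun_eq_iff algebra_simps)

lemma act_Bn: "p \<in> S \<Longrightarrow> w \<in> Bn \<Longrightarrow> act p w \<in> Bn"
  unfolding act_def by (rule coboundary_scale)

text \<open>\<open>I\<close> kills Ext^n, by the transposed homotopy with \<open>J\<close> the zero
  ideal. The case \<open>n = 0\<close> is separate because the only coboundary is then 0.\<close>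

lemma act_I:
  assumes "f \<in> I" "w \<in> Zn"
  shows "act f w \<in> Bn"
proof (cases n)
  case 0
  have eqs: "rk n = rk 0" "codiff n = codiff 0" "Bn = {\<lambda>_. 0}"
    by (simp_all add: 0 coboundaries_def)
  have "f * w r \<in> xy_ideal n 0" for r
    using assms J_zero[of 0] unfolding Zn_iff eqs by (intro annihilates_cocycles_0[OF ideal_J]) auto
  then show ?thesis
    unfolding eqs J_0 act_def by auto
next
  case (Suc i)
  have "\<exists>u\<in>FM i. \<forall>r. f * w r - codiff i u r \<in> xy_ideal n 0"
    using assms by (intro annihilates_cocycles_Suc[OF ideal_J]) (auto simp: Zn_iff Suc[symmetric] J_zero)
  then obtain u where u: "u \<in> FM i" "\<And>r. f * w r = codiff i u r"
    unfolding J_0 by auto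
  then have "act f w = codiff i u"
    by (auto simp: act_def)
  then show ?thesis
    using u(1) by (simp add: Suc coboundaries_def)
qed

lemma add_free_module: "add (free_module W b :: ('f mpoly, _) module) = (+)"
  by (auto simp: free_module_def fun_eq_iff)

lemma smult_omega:
  assumes "p \<in> S" "w \<in> Zn"
  shows "coset I p \<odot>\<^bsub>omega n \<rho>\<^esub> coset Bn w = coset Bn (act p w)"
proof -
  have ext: "p' \<odot>\<^bsub>Ext V \<rho> n\<^esub> coset Bn w = coset Bn (act p' w)" if "p' \<in> S" for p'
  proof -
    have "(\<Union>v\<in>coset Bn w. coset Bn (act p' v)) = coset Bn (act p' w)"
      by (rule UN_coset[OF subgroup_Bn]) (simp add: act_add act_Bn[OF that])
    then show ?thesis
      by (simp add: Ext_def quot_module_def a_r_coset_eq_coset add_free_module)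
        (simp add: free_module_def flip: act_def)
  qed
  \<comment> \<open>A residue class acts through \<open>the_elem\<close> of this set of results, so
    the set must be a singleton; two representatives differ by an element of \<open>I\<close>,
    covered by \<open>act_I\<close>.\<close>
  have "(\<lambda>p'. p' \<odot>\<^bsub>Ext V \<rho> n\<^esub> coset Bn w) ` coset I p = {coset Bn (act p w)}"
  proof -
    have "p' \<odot>\<^bsub>Ext V \<rho> n\<^esub> coset Bn w = coset Bn (act p w)" if "p' \<in> coset I p" for p'
    proof -
      have p': "p' - p \<in> I"
        using that by (simp add: coset_iff)
      have "p' \<in> S"
        using supported_add[OF I_in[OF p'] assms(1)] by simp
      moreover have "act p' w - act p w = act (p' - p) w"
        by (auto simp: act_def fun_eq_iff algebra_simps)
      ultimately show ?thesis
        using act_I[OF p' assms(2)] by (simp add: ext coset_eq_iff[OF subgroup_Bn])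
    qed
    moreover have "p \<in> coset I p"
      using add_subgroupD(1)[OF subgroup_Gamma] by (simp add: coset_iff)
    ultimately show ?thesis by blast
  qed
  then show ?thesis
    by (simp add: omega_def residue_scalars_def)
qed

lemma carrier_omega: "carrier (omega n \<rho>) = coset Bn ` Zn"
  by (auto simp: omega_def residue_scalars_def Ext_def quot_module_def A_RCOSETS_def RCOSETS_def
      a_r_coset_def[symmetric] a_r_coset_eq_coset add_free_module r_coset_def coset_def)

lemma add_omega: "coset Bn v \<oplus>\<^bsub>omega n \<rho>\<^esub> coset Bn w = coset Bn (v + w)"
  by (simp add: omega_def residue_scalars_def Ext_def quot_module_def set_add_eq add_free_module
      coset_add[OF subgroup_Bn])

lemma zero_omega: "\<zero>\<^bsub>omega n \<rho>\<^esub> = coset Bn 0"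
  by (simp add: omega_def residue_scalars_def Ext_def quot_module_def coset_zero)

lemma carrier_Gamma_ring: "carrier (Gamma_ring n \<Delta> :: 'f mpoly set ring) = coset I ` S"
  by (auto simp: Gamma_ring_def FactRing_def A_RCOSETS_def RCOSETS_def
      r_coset_def coset_def carrier_poly_ring)

lemma mult_Gamma_ring:
  assumes "p \<in> S" "q \<in> S"
  shows "coset I p \<otimes>\<^bsub>Gamma_ring n \<Delta>\<^esub> coset I q = coset I (p * q)"
  using ideal.rcoset_mult_add[OF ideal_Gamma, of p q] assms
  by (simp add: Gamma_ring_def FactRing_def carrier_poly_ring a_r_coset_eq_coset)

lemma add_Gamma_ring: "coset I p \<oplus>\<^bsub>Gamma_ring n \<Delta>\<^esub> coset I q = coset I (p + q)"
  by (simp add: Gamma_ring_def FactRing_def set_add_eq coset_add[OF subgroup_Gamma])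

lemma R_simps:
  "carrier R = carrier (Gamma_ring n \<Delta>) \<times> carrier (omega n \<rho>)"
  "one R = (one (Gamma_ring n \<Delta>), zero (omega n \<rho>))"
  "zero R = (zero (Gamma_ring n \<Delta>), zero (omega n \<rho>))"
  "monoid.mult R = monoid.mult (idealization (Gamma_ring n \<Delta>) (omega n \<rho>))"
  "add R = add (idealization (Gamma_ring n \<Delta>) (omega n \<rho>))"
  "ground R = range (\<lambda>c. (I +>\<^bsub>S_ring n\<^esub> Const c, \<zero>\<^bsub>omega n \<rho>\<^esub>))"
  "grade R j = Gamma_grade n \<Delta> j \<times> omega_grade n \<rho> ((int n - (Defs.complex_dim \<Delta> + 1) - 1) + j)"
  by (simp_all add: R_Delta_def ring.defs idealization_def)

lemma carrier_R: "carrier R = {elt p w | p w. p \<in> S \<and> w \<in> Zn}"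
  unfolding R_simps carrier_Gamma_ring carrier_omega elt_def by auto

lemma elt_in: "p \<in> S \<Longrightarrow> w \<in> Zn \<Longrightarrow> elt p w \<in> carrier R"
  unfolding carrier_R by blast

lemma add_R: "elt p v \<oplus>\<^bsub>R\<^esub> elt q w = elt (p + q) (v + w)"
  unfolding R_simps by (simp add: idealization_def elt_def add_Gamma_ring add_omega)

lemma mult_R: "p \<in> S \<Longrightarrow> q \<in> S \<Longrightarrow> v \<in> Zn \<Longrightarrow> w \<in> Zn \<Longrightarrow>
    elt p v \<otimes>\<^bsub>R\<^esub> elt q w = elt (p * q) (act p w + act q v)"
  unfolding R_simps by (simp add: idealization_def elt_def mult_Gamma_ring smult_omega add_omega)

lemma one_R: "\<one>\<^bsub>R\<^esub> = elt 1 0"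
  unfolding R_simps by (simp add: elt_def zero_omega Gamma_ring_def FactRing_def a_r_coset_eq_coset)

lemma zero_R: "\<zero>\<^bsub>R\<^esub> = elt 0 0"
  unfolding R_simps by (simp add: elt_def zero_omega Gamma_ring_def FactRing_def coset_zero)

lemma elt_eq_iff: "elt p v = elt q w \<longleftrightarrow> p - q \<in> I \<and> v - w \<in> Bn"
  by (simp add: elt_def coset_eq_iff[OF subgroup_Gamma] coset_eq_iff[OF subgroup_Bn])

lemma cring_R: "cring R"
proof (rule cringI)
  show "abelian_group R"
  proof (rule abelian_groupI)
    show "\<zero>\<^bsub>R\<^esub> \<in> carrier R"
      by (simp add: zero_R elt_in Zn_zero)
    fix x y assume "x \<in> carrier R" "y \<in> carrier R"
    then obtain p u q v where "x = elt p u" "p \<in> S" "u \<in> Zn" "y = elt q v" "q \<in> S" "v \<in> Zn"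
      unfolding carrier_R by blast
    then show "x \<oplus>\<^bsub>R\<^esub> y \<in> carrier R"
      by (simp add: add_R elt_in supported_add Zn_add)
  next
    fix x assume "x \<in> carrier R"
    then obtain p w where x: "x = elt p w" "p \<in> S" "w \<in> Zn"
      by (auto simp: carrier_R)
    then show "\<exists>y\<in>carrier R. y \<oplus>\<^bsub>R\<^esub> x = \<zero>\<^bsub>R\<^esub>"
      by (intro bexI[of _ "elt (- p) (- w)"]) (auto simp: add_R zero_R elt_in supported_uminus Zn_uminus)
  qed (auto simp: carrier_R add_R zero_R add_ac)
  show "Group.comm_monoid R"
  proof (rule comm_monoidI)
    fix x y z assume "x \<in> carrier R" "y \<in> carrier R" "z \<in> carrier R"
    then obtain p u q v r w where x: "x = elt p u" "p \<in> S" "u \<in> Zn"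
      and y: "y = elt q v" "q \<in> S" "v \<in> Zn" and z: "z = elt r w" "r \<in> S" "w \<in> Zn"
      unfolding carrier_R by blast
    show "x \<otimes>\<^bsub>R\<^esub> y \<otimes>\<^bsub>R\<^esub> z = x \<otimes>\<^bsub>R\<^esub> (y \<otimes>\<^bsub>R\<^esub> z)"
      using x y z by (simp add: mult_R poly_ring_mult Zn_add Zn_act act_add add.assoc mult.assoc
          mult.commute[of r p] mult.commute[of r q])
  next
    fix x y assume "x \<in> carrier R" "y \<in> carrier R"
    then obtain p u q v where x: "x = elt p u" "p \<in> S" "u \<in> Zn"
      and y: "y = elt q v" "q \<in> S" "v \<in> Zn"
      unfolding carrier_R by blast
    show "x \<otimes>\<^bsub>R\<^esub> y \<in> carrier R"
      using x y by (simp add: mult_R poly_ring_mult Zn_add Zn_act elt_in)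
    show "x \<otimes>\<^bsub>R\<^esub> y = y \<otimes>\<^bsub>R\<^esub> x"
      using x y by (simp add: mult_R mult.commute[of q p] add.commute)
  qed (auto simp: carrier_R one_R mult_R one_in_poly_ring Zn_zero act_add intro: one_in_poly_ring Zn_zero)
  fix x y z assume "x \<in> carrier R" "y \<in> carrier R" "z \<in> carrier R"
  then obtain p u q v r w where x: "x = elt p u" "p \<in> S" "u \<in> Zn"
    and y: "y = elt q v" "q \<in> S" "v \<in> Zn" and z: "z = elt r w" "r \<in> S" "w \<in> Zn"
    unfolding carrier_R by blast
  show "(x \<oplus>\<^bsub>R\<^esub> y) \<otimes>\<^bsub>R\<^esub> z = x \<otimes>\<^bsub>R\<^esub> z \<oplus>\<^bsub>R\<^esub> y \<otimes>\<^bsub>R\<^esub> z"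
    using x y z by (simp add: mult_R add_R supported_add Zn_add act_add distrib_right add_ac)
qed

lemma one_notin_I: "1 \<notin> I"
proof
  assume "1 \<in> I"
  then have "gamma_nonface n \<Delta> 0"
    unfolding Gamma_ideal_eq[OF complex] mono_ideal_def supported_def by simp
  moreover have "{} \<in> \<Delta>"
    using complex by (auto simp: simplicial_complex_on_def)
  ultimately show False
    by (simp add: gamma_nonface_def xsupp_def ysupp_def)
qed

definition scal :: "'f \<Rightarrow> 'f mpoly set \<times> (nat \<Rightarrow> 'f mpoly) set" where
  "scal c = elt (Const c) 0"

lemma ground_R: "ground R = range scal"
  unfolding R_simps scal_def elt_def by (simp add: zero_omega a_r_coset_eq_coset)

lemma scal_in: "scal c \<in> carrier R"
  by (simp add: scal_def elt_in Const_in_poly_ring Zn_zero)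

lemma scal_hom: "scal (a + b) = scal a \<oplus>\<^bsub>R\<^esub> scal b" "scal (a * b) = scal a \<otimes>\<^bsub>R\<^esub> scal b"
  "scal 1 = \<one>\<^bsub>R\<^esub>" "scal 0 = \<zero>\<^bsub>R\<^esub>"
  by (simp_all add: scal_def add_R mult_R Const_add Const_mult Const_in_poly_ring Zn_zero act_add
      one_R zero_R)

lemma subfield_ground: "subfield (ground R) R"
proof -
  interpret cring R by (rule cring_R)
  have "cring (R\<lparr>carrier := range scal\<rparr>)"
  proof (rule cringI)
    show "abelian_group (R\<lparr>carrier := range scal\<rparr>)"
    proof (rule abelian_groupI)
      fix x assume "x \<in> carrier (R\<lparr>carrier := range scal\<rparr>)"
      then obtain a where "x = scal a" by auto
      then show "\<exists>y\<in>carrier (R\<lparr>carrier := range scal\<rparr>).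
          y \<oplus>\<^bsub>R\<lparr>carrier := range scal\<rparr>\<^esub> x = \<zero>\<^bsub>R\<lparr>carrier := range scal\<rparr>\<^esub>"
        by (intro bexI[of _ "scal (- a)"]) (auto simp flip: scal_hom)
    qed (auto simp: add_ac simp flip: scal_hom)
    show "Group.comm_monoid (R\<lparr>carrier := range scal\<rparr>)"
      by (rule comm_monoidI) (auto simp: mult_ac simp flip: scal_hom)
  qed (auto simp: distrib_right simp flip: scal_hom)
  then have "field (R\<lparr>carrier := range scal\<rparr>)"
  proof (rule cring.cring_fieldI2)
    have "elt 0 0 \<noteq> elt 1 0"
      using one_notin_I add_subgroupD(3)[OF subgroup_Gamma, of "-1"] by (auto simp: elt_eq_iff)
    then show "\<zero>\<^bsub>R\<lparr>carrier := range scal\<rparr>\<^esub> \<noteq> \<one>\<^bsub>R\<lparr>carrier := range scal\<rparr>\<^esub>"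
      by (simp add: one_R zero_R)
    fix x assume "x \<in> carrier (R\<lparr>carrier := range scal\<rparr>)" "x \<noteq> \<zero>\<^bsub>R\<lparr>carrier := range scal\<rparr>\<^esub>"
    then obtain a where a: "x = scal a" "a \<noteq> 0"
      using scal_hom(4) by auto
    then show "\<exists>b\<in>carrier (R\<lparr>carrier := range scal\<rparr>).
        x \<otimes>\<^bsub>R\<lparr>carrier := range scal\<rparr>\<^esub> b = \<one>\<^bsub>R\<lparr>carrier := range scal\<rparr>\<^esub>"
      by (intro bexI[of _ "scal (1 / a)"]) (auto simp flip: scal_hom)
  qed
  then have "subfield (range scal) R"
    using scal_in by (intro subfield_iff(1)) auto
  then show ?thesis
    by (simp add: ground_R)
qed

lemma finsum_elt:
  assumes "finite X" "\<And>x. x \<in> X \<Longrightarrow> f x \<in> S" "\<And>x. x \<in> X \<Longrightarrow> g x \<in> Zn"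
  shows "finsum R (\<lambda>x. elt (f x) (g x)) X = elt (sum f X) (sum g X)"
proof -
  interpret cring R by (rule cring_R)
  show ?thesis
    using assms
  proof (induction X)
    case (insert x X)
    have "finsum R (\<lambda>x. elt (f x) (g x)) (insert x X)
        = elt (f x) (g x) \<oplus>\<^bsub>R\<^esub> finsum R (\<lambda>x. elt (f x) (g x)) X"
      using insert by (intro finsum_insert) (auto simp: elt_in)
    then show ?case
      using insert by (simp add: add_R plus_fun_def)
  qed (simp add: zero_R)
qed

text \<open>The term \<open>n - d - 1\<close> is the shift of the canonical module, and
  \<open>- 2 * n\<close> comes from the twist S(-2n). The latter cancels the total degree drop of
  the dimension shift in \<open>basis_mod_omega\<close>.\<close>

lemma grade_R:
  "grade R j = {elt p w | p w. p \<in> homog V j \<and> w \<in> Zgr n 0 (int n - int d - 1 + j - 2 * int n)}"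
proof -
  have "omega_grade n \<rho> k = coset Bn ` Zgr n 0 (k - 2 * int n)" for k
    unfolding omega_grade_def Ext_grade_def Zgr_def Z_top
    by (auto simp: a_r_coset_eq_coset add_free_module algebra_simps)
  then show ?thesis
    unfolding R_simps(7) Gamma_grade_eq complex_dim by (auto simp: elt_def algebra_simps)
qed

lemma sum_fun_apply: "(\<Sum>x\<in>X. f x) r = (\<Sum>x\<in>X. f x r)" for f :: "'i \<Rightarrow> nat \<Rightarrow> 'f mpoly"
  by (induction X rule: infinite_finite_induct) auto

text \<open>The basis is indexed by a disjoint sum: monomials outside \<open>I\<close> for the first
  component, and the transported basis of Ext^n for the second.\<close>

lemma dim_grade_R:
  "ring.dim R (ground R) (grade R j)
    = card (gamma_faces j) + card (omega_monos (int n - int d - 1 + j))"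
proof -
  interpret cring R by (rule cring_R)
  let ?k = "int n - int d - 1 + j"
  obtain b where b: "basis_mod (omega_monos ?k) b (Zgr n 0 (?k - 2 * int n)) Bn"
    using basis_mod_omega by blast
  let ?X = "gamma_faces j <+> omega_monos ?k"
  define e1 :: "(nat \<Rightarrow>\<^sub>0 nat) + (nat \<Rightarrow>\<^sub>0 nat) \<Rightarrow> 'f mpoly"
    where "e1 = case_sum (\<lambda>m. single m 1) (\<lambda>_. 0)"
  define e2 :: "(nat \<Rightarrow>\<^sub>0 nat) + (nat \<Rightarrow>\<^sub>0 nat) \<Rightarrow> nat \<Rightarrow> 'f mpoly"
    where "e2 = case_sum (\<lambda>_. 0) b"
  have fin: "finite ?X"
    by (simp add: finite_gamma_faces finite_omega_monos)
  have e1h: "e1 x \<in> homog V j" if "x \<in> ?X" for x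
    using that unfolding e1_def homog_eq_supported
    by (auto simp: gamma_faces_def intro: supported_single)
  have e1S: "e1 x \<in> S" if "x \<in> ?X" for x
    using e1h[OF that] by (rule homog_subset)
  have bZ: "b m \<in> Zgr n 0 (?k - 2 * int n)" if "m \<in> omega_monos ?k" for m
    using b that unfolding basis_mod_def by blast
  have ZgrZ: "Zgr n 0 i \<subseteq> Zn" for i
    unfolding Zgr_def Z_top by blast
  have bZn: "b m \<in> Zn" if "m \<in> omega_monos ?k" for m
    using bZ[OF that] ZgrZ by blast
  have e2Z: "e2 x \<in> Zn" if "x \<in> ?X" for x
    using that by (auto simp: e2_def Zn_zero intro: bZn)
  define F1 where "F1 c = (\<Sum>m\<in>gamma_faces j. Const (c (Inl m)) * single m 1 :: 'f mpoly)"
    for c :: "(nat \<Rightarrow>\<^sub>0 nat) + (nat \<Rightarrow>\<^sub>0 nat) \<Rightarrow> 'f"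
  define F2 where "F2 c = lin_comb (omega_monos ?k) (\<lambda>m. c (Inr m)) b"
    for c :: "(nat \<Rightarrow>\<^sub>0 nat) + (nat \<Rightarrow>\<^sub>0 nat) \<Rightarrow> 'f"
  let ?F = "\<lambda>c. \<Oplus>\<^bsub>R\<^esub>x\<in>?X. scal (c x) \<otimes>\<^bsub>R\<^esub> elt (e1 x) (e2 x)"
  have F: "?F c = elt (F1 c) (F2 c)" for c
  proof -
    have "scal (c x) \<otimes>\<^bsub>R\<^esub> elt (e1 x) (e2 x) = elt (Const (c x) * e1 x) (act (Const (c x)) (e2 x))"
      "elt (Const (c x) * e1 x) (act (Const (c x)) (e2 x)) \<in> carrier R" if "x \<in> ?X" for x
      using e1S[OF that] e2Z[OF that]
      by (simp_all add: scal_def mult_R Const_in_poly_ring Zn_zero act_add poly_ring_mult Zn_act elt_in)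
    then have "?F c
        = (\<Oplus>\<^bsub>R\<^esub>x\<in>?X. elt (Const (c x) * e1 x) (act (Const (c x)) (e2 x)))"
      by (intro finsum_cong') blast+
    also have "\<dots> = elt (\<Sum>x\<in>?X. Const (c x) * e1 x) (\<Sum>x\<in>?X. act (Const (c x)) (e2 x))"
      using fin e1S e2Z by (intro finsum_elt poly_ring_mult Zn_act Const_in_poly_ring)
    also have "(\<Sum>x\<in>?X. Const (c x) * e1 x) = F1 c"
      using finite_gamma_faces finite_omega_monos by (simp add: sum.Plus e1_def F1_def)
    also have "(\<Sum>x\<in>?X. act (Const (c x)) (e2 x)) = F2 c"
      using finite_gamma_faces finite_omega_monos
      by (simp add: sum.Plus e2_def F2_def act_add fun_eq_iff sum_fun_apply lin_comb_def) (simp add: act_def)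
    finally show ?thesis .
  qed
  have F1_supp: "F1 c \<in> supported (\<lambda>m. m \<in> gamma_faces j)" for c
    unfolding F1_def Const_mult_single by (intro supported_sum supported_single)
  have F1_lookup: "lookup (F1 c) m = c (Inl m)" if "m \<in> gamma_faces j" for c m
    unfolding F1_def by (rule lookup_sum_Const_single[OF finite_gamma_faces that])
  have "dimension (card ?X) (ground R) {?F c | c. True}"
  proof (rule dimension_finsum[OF subfield_ground ground_R[symmetric] scal_hom(1,3) fin])
    show "(\<lambda>x. elt (e1 x) (e2 x)) ` ?X \<subseteq> carrier R"
      using e1S e2Z elt_in by blast
    fix c assume "?F c = \<zero>\<^bsub>R\<^esub>"
    then have "F1 c \<in> I" "F2 c \<in> Bn"
      unfolding F zero_R elt_eq_iff by simp_all
    have "F1 c = 0"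
      using F1_supp \<open>F1 c \<in> I\<close> unfolding Gamma_ideal_eq[OF complex] mono_ideal_def
      by (rule supported_disjoint) (simp add: gamma_faces_def)
    then have "c (Inl m) = 0" if "m \<in> gamma_faces j" for m
      using F1_lookup[OF that, of c] by simp
    moreover have "c (Inr m) = 0" if "m \<in> omega_monos ?k" for m
      using \<open>F2 c \<in> Bn\<close> b that unfolding F2_def basis_mod_def by blast
    ultimately show "\<forall>x\<in>?X. c x = 0"
      by auto
  qed
  also have "{?F c | c. True} = grade R j"
  proof (intro equalityI subsetI)
    fix x assume "x \<in> {?F c | c. True}"
    then obtain c where x: "x = elt (F1 c) (F2 c)"
      unfolding F by blast
    have "F1 c \<in> homog V j"
      using F1_supp unfolding homog_eq_supported by (rule supported_mono) (simp add: gamma_faces_def)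
    moreover have "F2 c \<in> Zgr n 0 (?k - 2 * int n)"
    proof -
      have "F2 c \<in> FM n"
        unfolding F2_def using bZ by (intro lin_comb_FM) (auto simp: Zgr_def Z_def)
      moreover have "codiff n (F2 c) r = 0" for r
        using bZn by (auto simp: F2_def lin_comb_def codiff_map_sum codiff_map_scale Zn_iff)
      moreover have "F2 c r \<in> homog V (?k - 2 * int n + bdeg \<rho> n r)" if "r < rk n" for r
      proof -
        have "Const a * b m r \<in> homog V (?k - 2 * int n + bdeg \<rho> n r)" if "m \<in> omega_monos ?k" for m a
          using homog_mult[OF Const_homog, of "b m r"] bZ[OF that] \<open>r < _\<close> by (simp add: Zgr_def)
        then show ?thesis
          unfolding F2_def lin_comb_def by (intro homog_sum)
      qed
      ultimately show ?thesis
        by (simp add: Zgr_def Z_top Zn_iff)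
    qed
    ultimately show "x \<in> grade R j"
      unfolding grade_R x by blast
  next
    fix x assume "x \<in> grade R j"
    then obtain p w where x: "x = elt p w" "p \<in> homog V j" "w \<in> Zgr n 0 (?k - 2 * int n)"
      unfolding grade_R by blast
    obtain c2 where c2: "(\<lambda>r. w r - lin_comb (omega_monos ?k) c2 b r) \<in> Bn"
      using b x(3) unfolding basis_mod_def by blast
    define c where "c = case_sum (lookup p) c2"
    have "p - F1 c \<in> I"
      unfolding Gamma_ideal_eq[OF complex] mono_ideal_def supported_iff
    proof (intro allI impI)
      fix m assume nz: "lookup (p - F1 c) m \<noteq> 0"
      then have m: "m \<notin> gamma_faces j"
        by (auto simp: lookup_minus F1_lookup c_def)
      then have "lookup (F1 c) m = 0"
        using F1_supp[of c] by (auto dest: supportedD)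
      then have "lookup p m \<noteq> 0"
        using nz by (simp add: lookup_minus)
      then show "mono_in V m \<and> gamma_nonface n \<Delta> m"
        using x(2) m unfolding homog_eq_supported by (auto dest: supportedD simp: gamma_faces_def)
    qed
    moreover have "w - F2 c \<in> Bn"
      using c2 by (simp add: F2_def c_def fun_diff_def)
    ultimately have "x = elt (F1 c) (F2 c)"
      unfolding x(1) elt_eq_iff by blast
    then show "x \<in> {?F c | c. True}"
      unfolding F by blast
  qed
  finally have "dimension (card ?X) (ground R) (grade R j)" .
  then have "dim (ground R) (grade R j) = card ?X"
    using dimI[OF subfield_ground] by (simp add: over_def)
  then show ?thesis
    by (simp add: card_Plus finite_gamma_faces finite_omega_monos)
qed

end

section \<open>Counting monomials\<close>

definition monos_between :: "nat set \<Rightarrow> nat set \<Rightarrow> nat \<Rightarrow> (nat \<Rightarrow>\<^sub>0 nat) set" where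
  "monos_between A U k = {m. A \<subseteq> keys m \<and> mono_in U m \<and> mono_deg m = k}"

definition mono_count :: "nat set \<Rightarrow> nat \<Rightarrow> nat" where
  "mono_count U k = card (monos_between {} U k)"

lemma finite_monos_between: "finite U \<Longrightarrow> finite (monos_between A U k)"
  by (rule finite_subset[OF _ finite_monos_le[of U k]]) (auto simp: monos_between_def)

text \<open>Division by the squarefree monomial on \<open>A\<close> is a bijection onto all
  monomials in the variables \<open>U\<close> of degree lowered by \<open>card A\<close>.\<close>

lemma card_monos_containing:
  assumes U: "finite U" and A: "A \<subseteq> U"
  shows "card (monos_between A U k)
    = (if k < card A then 0 else mono_count U (k - card A))"
proof -
  have fA: "finite A" using A U by (rule finite_subset)
  have deg: "mono_deg (mono_of A) = card A"
    using fA by (subst mono_deg_superset[of A]) (auto simp: keys_mono_of lookup_mono_of)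
  have eq: "monos_between A U k
      = (+) (mono_of A) ` {m. mono_in U m \<and> card A + mono_deg m = k}"
  proof (intro equalityI subsetI)
    fix m assume m: "m \<in> monos_between A U k"
    then obtain m' where "m = mono_of A + m'"
      using mono_of_adds[OF fA, of m] by (auto simp: monos_between_def)
    with m show "m \<in> (+) (mono_of A) ` {m. mono_in U m \<and> card A + mono_deg m = k}"
      by (auto simp: keys_add_nat deg monos_between_def)
  next
    fix m assume "m \<in> (+) (mono_of A) ` {m. mono_in U m \<and> card A + mono_deg m = k}"
    then show "m \<in> monos_between A U k"
      using A by (auto simp: keys_add_nat deg keys_mono_of[OF fA] monos_between_def)
  qed
  have "card (monos_between A U k)
      = card {m. mono_in U m \<and> card A + mono_deg m = k}"
    unfolding eq by (rule card_image) (auto simp: inj_on_def)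
  also have "\<dots> = (if k < card A then 0 else mono_count U (k - card A))"
  proof (cases "k < card A")
    case False
    then have "card A + mono_deg m = k \<longleftrightarrow> mono_deg m = k - card A" for m
      by auto
    then show ?thesis
      using False by (simp add: mono_count_def monos_between_def)
  qed auto
  finally show ?thesis .
qed

lemma mono_count_insert:
  assumes "finite U" "v \<notin> U"
  shows "mono_count (insert v U) k = mono_count U k + (if k < 1 then 0 else mono_count (insert v U) (k - 1))"
proof -
  let ?A = "monos_between {} U k" and ?B = "monos_between {v} (insert v U) k"
  have "monos_between {} (insert v U) k = ?A \<union> ?B"
    by (auto simp: monos_between_def)
  moreover have "?A \<inter> ?B = {}"
    using assms(2) by (auto simp: monos_between_def)
  moreover have "finite ?A" "finite ?B"
    using assms(1) by (simp_all add: finite_monos_between)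
  ultimately have "card (monos_between {} (insert v U) k) = card ?A + card ?B"
    by (simp only: card_Un_disjoint)
  then show ?thesis
    using card_monos_containing[of "insert v U" "{v}" k] assms(1) by (simp add: mono_count_def One_nat_def)
qed

text \<open>Sorting monomials by whether the new variable divides them gives G' = G + X G', so each
  variable contributes a factor 1/(1 - X).\<close>

lemma mono_count_fps:
  "finite U \<Longrightarrow> Abs_fps (\<lambda>k. int (mono_count U k)) * (1 - fps_X) ^ card U = 1"
proof (induction U rule: finite_induct)
  case empty
  have "monos_between {} {} k = (if k = 0 then {0} else {})" for k
    by (auto simp: monos_between_def)
  then show ?case
    by (auto simp: mono_count_def fps_eq_iff fps_nth_Abs_fps[of "\<lambda>k. int (if k = 0 then 1 else 0)"])
next
  case (insert v U)
  let ?G = "\<lambda>U. Abs_fps (\<lambda>k. int (mono_count U k))"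
  have "?G (insert v U) = ?G U + fps_X * ?G (insert v U)"
    using mono_count_insert[OF insert.hyps] by (auto simp: fps_eq_iff)
  then have "?G (insert v U) * (1 - fps_X) = ?G U"
    by (simp add: algebra_simps)
  then have "?G (insert v U) * (1 - fps_X) * (1 - fps_X) ^ card U = 1"
    using insert.IH by simp
  then show ?case
    using insert.hyps by (simp add: mult.assoc)
qed

section \<open>The Hilbert series as a sum over faces\<close>

context gamma_resolution
begin

text \<open>The facet of \<Gamma> belonging to the face \<open>F\<close>: for every index i exactly
  one of x_i and y_i, so it has n elements.\<close>

definition facet_vars :: "nat set \<Rightarrow> nat set" where
  "facet_vars F = F \<union> (+) n ` ({1..n} - F)"

lemma face_subset: "F \<in> \<Delta> \<Longrightarrow> F \<subseteq> {1..n}"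
  using complex by (auto simp: simplicial_complex_on_def)

lemma finite_face: "F \<in> \<Delta> \<Longrightarrow> finite F"
  using face_subset finite_subset by blast

lemma finite_Delta: "finite \<Delta>"
  using complex finite_subset[of \<Delta> "Pow {1..n}"] by (auto simp: simplicial_complex_on_def)

lemma empty_face: "{} \<in> \<Delta>"
  using complex by (auto simp: simplicial_complex_on_def)

lemma card_face_le:
  assumes "F \<in> \<Delta>"
  shows "card F \<le> d"
proof -
  have "face_dim F \<le> Max (face_dim ` \<Delta>)"
    using finite_Delta assms by simp
  then show ?thesis
    using complex_dim unfolding complex_dim_def face_dim_def[of F] by simp
qed

lemma card_face_le_n: "F \<in> \<Delta> \<Longrightarrow> card F \<le> n"
  using card_mono[OF _ face_subset, of F] by simp

lemma facet_vars:
  assumes "F \<in> \<Delta>"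
  shows "finite (facet_vars F)" "card (facet_vars F) = n" "facet_vars F \<subseteq> V"
proof -
  have F: "F \<subseteq> {1..n}" "finite F"
    using assms by (rule face_subset, rule finite_face)
  show "finite (facet_vars F)"
    using F by (simp add: facet_vars_def)
  show "facet_vars F \<subseteq> V"
    using F by (auto simp: facet_vars_def)
  have "card (facet_vars F) = card F + card ((+) n ` ({1..n} - F))"
    unfolding facet_vars_def using F by (intro card_Un_disjoint) auto
  also have "card ((+) n ` ({1..n} - F)) = n - card F"
    using F by (subst card_image) (auto simp: card_Diff_subset)
  finally show "card (facet_vars F) = n"
    using card_face_le_n[OF assms] by simp
qed

lemma mono_in_facet_vars_iff:
  assumes "F \<in> \<Delta>"
  shows "mono_in (facet_vars F) m \<longleftrightarrow> mono_in V m \<and> xsupp n m \<subseteq> F \<and> ysupp n m \<inter> F = {}"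
proof
  note F = face_subset[OF assms]
  assume m: "mono_in (facet_vars F) m"
  have "i \<in> F" if "i \<in> xsupp n m" for i
    using m that by (auto simp: xsupp_def facet_vars_def)
  moreover have "i \<notin> F" if "i \<in> ysupp n m" for i
  proof -
    have "n + i \<in> facet_vars F" "i \<in> {1..n}"
      using m that by (auto simp: ysupp_def)
    then show ?thesis
      using F by (auto simp: facet_vars_def)
  qed
  ultimately show "mono_in V m \<and> xsupp n m \<subseteq> F \<and> ysupp n m \<inter> F = {}"
    using m facet_vars(3)[OF assms] by auto
next
  assume m: "mono_in V m \<and> xsupp n m \<subseteq> F \<and> ysupp n m \<inter> F = {}"
  show "mono_in (facet_vars F) m"
  proof
    fix v assume v: "v \<in> keys m"
    then have vV: "v \<in> V"
      using m by blast
    show "v \<in> facet_vars F"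
    proof (cases "v \<le> n")
      case True
      then have "v \<in> xsupp n m"
        using v vV by (simp add: xsupp_def)
      then show ?thesis
        using m unfolding facet_vars_def by blast
    next
      case False
      then have "v - n \<in> ysupp n m" "v = n + (v - n)"
        using v vV by (auto simp: ysupp_def)
      then show ?thesis
        using m unfolding facet_vars_def ysupp_def by blast
    qed
  qed
qed

text \<open>Within the facet of \<open>F\<close>, using all its x-variables forces the x-support to
  be \<open>F\<close>, and using all its y-variables forces the y-support to be the complement.
  Either way \<open>F\<close> can be read off from \<open>m\<close>, which makes the unions over
  faces below disjoint.\<close>

lemma monos_between_facet_vars:
  assumes "F \<in> \<Delta>"
  shows "m \<in> monos_between F (facet_vars F) k \<longleftrightarrow>
      mono_in V m \<and> xsupp n m = F \<and> ysupp n m \<inter> F = {} \<and> mono_deg m = k"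
    and "m \<in> monos_between ((+) n ` ({1..n} - F)) (facet_vars F) k \<longleftrightarrow>
      mono_in V m \<and> xsupp n m \<subseteq> F \<and> ysupp n m = {1..n} - F \<and> mono_deg m = k"
  using face_subset[OF assms] unfolding monos_between_def mem_Collect_eq mono_in_facet_vars_iff[OF assms]
  by (auto simp: xsupp_def ysupp_def)

lemma gamma_faces_eq: "gamma_faces (int k) = (\<Union>F\<in>\<Delta>. monos_between F (facet_vars F) k)"
proof (rule Set.set_eqI)
  fix m
  show "m \<in> gamma_faces (int k) \<longleftrightarrow> m \<in> (\<Union>F\<in>\<Delta>. monos_between F (facet_vars F) k)"
    by (simp add: monos_between_facet_vars(1) gamma_faces_def gamma_nonface_def Int_commute)
qed

lemma omega_monos_eq:
  "omega_monos (int k) = (\<Union>F\<in>\<Delta>. monos_between ((+) n ` ({1..n} - F)) (facet_vars F) k)"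
proof (intro equalityI subsetI)
  fix m assume m: "m \<in> omega_monos (int k)"
  have "xsupp n m \<subseteq> {1..n}" "ysupp n m \<subseteq> {1..n}"
    by (auto simp: xsupp_def ysupp_def)
  with m have "m \<in> monos_between ((+) n ` ({1..n} - ({1..n} - ysupp n m))) (facet_vars ({1..n} - ysupp n m)) k"
    by (subst monos_between_facet_vars(2)) (auto simp: omega_monos_def)
  with m show "m \<in> (\<Union>F\<in>\<Delta>. monos_between ((+) n ` ({1..n} - F)) (facet_vars F) k)"
    unfolding omega_monos_def by blast
next
  fix m assume "m \<in> (\<Union>F\<in>\<Delta>. monos_between ((+) n ` ({1..n} - F)) (facet_vars F) k)"
  then obtain F where F: "F \<in> \<Delta>" "m \<in> monos_between ((+) n ` ({1..n} - F)) (facet_vars F) k"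
    by blast
  then show "m \<in> omega_monos (int k)"
    using face_subset[OF F(1)] by (auto simp: monos_between_facet_vars omega_monos_def double_diff)
qed

lemma card_UN_faces:
  assumes "\<And>F. F \<in> \<Delta> \<Longrightarrow> A F \<subseteq> facet_vars F"
    and "\<And>F G m. F \<in> \<Delta> \<Longrightarrow> G \<in> \<Delta> \<Longrightarrow> m \<in> monos_between (A F) (facet_vars F) k \<Longrightarrow>
      m \<in> monos_between (A G) (facet_vars G) k \<Longrightarrow> F = G"
  shows "card (\<Union>F\<in>\<Delta>. monos_between (A F) (facet_vars F) k)
    = (\<Sum>F\<in>\<Delta>. if k < card (A F) then 0 else mono_count (facet_vars F) (k - card (A F)))"
proof -
  have "card (\<Union>F\<in>\<Delta>. monos_between (A F) (facet_vars F) k)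
      = (\<Sum>F\<in>\<Delta>. card (monos_between (A F) (facet_vars F) k))"
    using assms(2) finite_Delta finite_monos_between[OF facet_vars(1)]
    by (intro card_UN_disjoint) blast+
  then show ?thesis
    using card_monos_containing[OF facet_vars(1) assms(1)] by simp
qed

lemma card_gamma_faces:
  "card (gamma_faces (int k)) = (\<Sum>F\<in>\<Delta>. if k < card F then 0 else mono_count (facet_vars F) (k - card F))"
  unfolding gamma_faces_eq
  by (rule card_UN_faces) (simp add: facet_vars_def, simp add: monos_between_facet_vars(1))

lemma card_omega_monos:
  "card (omega_monos (int k))
    = (\<Sum>F\<in>\<Delta>. if k < n - card F then 0 else mono_count (facet_vars F) (k - (n - card F)))"
proof -
  have "card (omega_monos (int k)) = (\<Sum>F\<in>\<Delta>. if k < card ((+) n ` ({1..n} - F)) then 0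
      else mono_count (facet_vars F) (k - card ((+) n ` ({1..n} - F))))"
    unfolding omega_monos_eq
  proof (rule card_UN_faces)
    fix F G m assume A: "F \<in> \<Delta>" "G \<in> \<Delta>" "m \<in> monos_between ((+) n ` ({1..n} - F)) (facet_vars F) k"
      "m \<in> monos_between ((+) n ` ({1..n} - G)) (facet_vars G) k"
    then have "{1..n} - F = {1..n} - G"
      by (simp add: monos_between_facet_vars(2))
    then show "F = G"
      using face_subset[OF A(1)] face_subset[OF A(2)] by blast
  qed (auto simp: facet_vars_def)
  moreover have "card ((+) n ` ({1..n} - F)) = n - card F" if "F \<in> \<Delta>" for F
    using face_subset[OF that] finite_face[OF that] by (subst card_image) (auto simp: card_Diff_subset)
  ultimately show ?thesis
    by (auto intro!: sum.cong)
qed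

lemma omega_monos_negative: "j < 0 \<Longrightarrow> omega_monos j = {}"
  by (auto simp: omega_monos_def)

lemma hilbert_series_R:
  "hilbert_series R * (1 - fps_X) ^ n = (\<Sum>F\<in>\<Delta>. fps_X ^ card F + fps_X ^ (d + 1 - card F))"
proof -
  let ?G = "\<lambda>F. Abs_fps (\<lambda>k. int (mono_count (facet_vars F) k))"
  have G: "?G F * (1 - fps_X) ^ n = 1" if "F \<in> \<Delta>" for F
    using mono_count_fps[OF facet_vars(1)[OF that]] facet_vars(2)[OF that] by simp
  have "hilbert_series R = (\<Sum>F\<in>\<Delta>. (fps_X ^ card F + fps_X ^ (d + 1 - card F)) * ?G F)"
  proof (rule fps_ext)
    fix k
    \<comment> \<open>In degree k of \<open>R\<close> the canonical module sits in degree k + n - d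
      - 1, so the bound n - |F| becomes d + 1 - |F|. If that degree is negative both sides are 0, as
      |F| <= n.\<close>
    have "int (card (omega_monos (int n - int d - 1 + int k)))
        = (\<Sum>F\<in>\<Delta>. if k < d + 1 - card F then 0 else int (mono_count (facet_vars F) (k - (d + 1 - card F))))"
    proof (cases "int n - int d - 1 + int k < 0")
      case True
      then have "k < d + 1 - card F" if "F \<in> \<Delta>" for F
        using card_face_le_n[OF that] card_face_le[OF that] by linarith
      then show ?thesis
        using omega_monos_negative[OF True] by simp
    next
      case False
      then obtain l where l: "int n - int d - 1 + int k = int l"
        by (metis nonneg_int_cases not_less)
      have "(l < n - card F) = (k < d + 1 - card F) \<and> (\<not> k < d + 1 - card F \<longrightarrow> l - (n - card F) = k - (d + 1 - card F))"
        if "F \<in> \<Delta>" for F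
        using card_face_le_n[OF that] card_face_le[OF that] l by linarith
      then show ?thesis
        unfolding l card_omega_monos by (simp cong: if_cong) (intro sum.cong; simp)
    qed
    then show "fps_nth (hilbert_series R) k
        = fps_nth (\<Sum>F\<in>\<Delta>. (fps_X ^ card F + fps_X ^ (d + 1 - card F)) * ?G F) k"
      by (simp add: hilbert_series_def dim_grade_R card_gamma_faces fps_sum_nth distrib_right
          fps_X_power_mult_nth sum.distrib if_distrib[of int] cong: if_cong)
  qed
  then show ?thesis
    using G by (simp add: sum_distrib_right mult.assoc)
qed

end

section \<open>The Krull dimension of \<open>R\<^sub>\<Delta>\<close>\<close>

definition poly_prime :: "nat set \<Rightarrow> 'f::field mpoly set \<Rightarrow> bool" where
  "poly_prime V Q \<longleftrightarrow> ideal Q (poly_ring V) \<and> 1 \<notin> Q \<and>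
     (\<forall>p\<in>polys V. \<forall>q\<in>polys V. p * q \<in> Q \<longrightarrow> p \<in> Q \<or> q \<in> Q)"

definition indep_mod :: "'f::field mpoly set \<Rightarrow> 'f mpoly set \<Rightarrow> bool" where
  "indep_mod Q Y \<longleftrightarrow> (\<forall>c. (\<Sum>y\<in>Y. Const (c y) * y) \<in> Q \<longrightarrow> (\<forall>y\<in>Y. c y = 0))"

abbreviation deg_le :: "nat set \<Rightarrow> nat \<Rightarrow> 'f::field mpoly set" where
  "deg_le V D \<equiv> supported (\<lambda>m. mono_in V m \<and> mono_deg m \<le> D)"

lemma deg_le_subset: "p \<in> deg_le V D \<Longrightarrow> p \<in> polys V"
  by (erule supported_mono) simp

lemma deg_le_mono: "p \<in> deg_le V D \<Longrightarrow> D \<le> D' \<Longrightarrow> p \<in> deg_le V D'"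
  by (erule supported_mono) simp

lemma deg_le_mult: "p \<in> deg_le V D \<Longrightarrow> q \<in> deg_le V E \<Longrightarrow> p * q \<in> deg_le V (D + E)"
  by (rule supported_mult, assumption, assumption) (auto simp: keys_add_nat)

lemma ex_deg_le: "p \<in> polys V \<Longrightarrow> \<exists>D. p \<in> deg_le V D"
  by (rule exI[of _ "\<Sum>m\<in>keys p. mono_deg m"])
    (auto simp: supported_def intro: member_le_sum)

text \<open>Modulo \<open>Q'\<close> the multiples of \<open>f\<close> disappear, so a relation has
  zero coefficients on \<open>Y\<close>. What remains is \<open>f\<close> times a combination of
  \<open>X\<close> in \<open>Q\<close>, and primality removes \<open>f\<close>.\<close>

lemma indep_mod_Un:
  fixes Q Q' X Y :: "'f::field mpoly set"
  assumes Q: "poly_prime V Q" "poly_prime V Q'" "Q \<subseteq> Q'"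
    and f: "f \<in> Q'" "f \<notin> Q"
    and Y: "finite Y" "Y \<subseteq> polys V" "indep_mod Q' Y"
    and X: "finite X" "X \<subseteq> polys V" "indep_mod Q X"
  shows "indep_mod Q (Y \<union> (*) f ` X)" "card (Y \<union> (*) f ` X) = card Y + card X"
proof -
  have I: "ideal Q (poly_ring V)" "ideal Q' (poly_ring V)"
    using Q(1,2) by (auto simp: poly_prime_def)
  have fS: "f \<in> polys V"
    using f(1) ideal_poly_ringD(1)[OF I(2)] by blast
  have "f \<noteq> 0"
    using f(2) ideal_poly_ringD(2)[OF I(1)] by auto
  then have inj: "inj_on ((*) f) X"
    by (auto simp: inj_on_def)
  have fX: "q * x \<in> Q'" if "x \<in> (*) f ` X" "q \<in> polys V" for x q
  proof -
    obtain z where z: "z \<in> X" "x = f * z" using \<open>x \<in> _\<close> by blast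
    have "(q * z) * f \<in> Q'"
      using z(1) X(2) that(2) by (intro ideal_poly_ringD(4)[OF I(2) f(1)] poly_ring_mult) auto
    then show ?thesis by (simp add: z(2) algebra_simps)
  qed
  have "y \<notin> Q'" if "y \<in> Y" for y
  proof
    assume "y \<in> Q'"
    moreover have "(\<Sum>z\<in>Y. Const (if z = y then 1 else 0) * z) = (\<Sum>z\<in>Y. if z = y then y else 0)"
      by (intro sum.cong) auto
    then have "(\<Sum>z\<in>Y. Const (if z = y then 1 else 0) * z) = y"
      using Y(1) that by simp
    ultimately have "(\<Sum>z\<in>Y. Const (if z = y then 1 else 0) * z) \<in> Q'"
      by simp
    then have "\<forall>z\<in>Y. (if z = y then 1 else 0 :: 'f) = 0"
      using Y(3) unfolding indep_mod_def by (elim allE impE)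
    then show False
      using that by auto
  qed
  moreover have "x \<in> Q'" if "x \<in> (*) f ` X" for x
    using fX[OF that one_in_poly_ring] by simp
  ultimately have disj: "Y \<inter> (*) f ` X = {}"
    by blast
  then show "card (Y \<union> (*) f ` X) = card Y + card X"
    using Y(1) X(1) by (simp add: card_Un_disjoint card_image[OF inj])
  show "indep_mod Q (Y \<union> (*) f ` X)"
    unfolding indep_mod_def
  proof (intro allI impI)
    fix c :: "'f mpoly \<Rightarrow> 'f"
    let ?s = "\<lambda>A. \<Sum>y\<in>A. Const (c y) * y"
    assume "?s (Y \<union> (*) f ` X) \<in> Q"
    then have s: "?s Y + ?s ((*) f ` X) \<in> Q"
      using Y(1) X(1) disj by (simp add: sum.union_disjoint)
    have "?s A \<in> Q'" if "\<And>y. y \<in> A \<Longrightarrow> Const (c y) * y \<in> Q'" for A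
      using that by (induction A rule: infinite_finite_induct) (auto intro: ideal_poly_ringD(2,3)[OF I(2)])
    then have "?s ((*) f ` X) \<in> Q'"
      using fX Const_in_poly_ring by blast
    then have "(?s Y + ?s ((*) f ` X)) - ?s ((*) f ` X) \<in> Q'"
      using s Q(3) by (intro ideal_poly_ringD(6)[OF I(2)]) auto
    then have cY: "\<forall>y\<in>Y. c y = 0"
      using Y(3) unfolding indep_mod_def by simp
    then have "?s Y = 0"
      by simp
    moreover have "?s ((*) f ` X) = f * (\<Sum>x\<in>X. Const (c (f * x)) * x)"
      by (simp add: sum.reindex[OF inj] sum_distrib_left mult.left_commute)
    ultimately have "f * (\<Sum>x\<in>X. Const (c (f * x)) * x) \<in> Q"
      using s by simp
    moreover have "(\<Sum>x\<in>X. Const (c (f * x)) * x) \<in> polys V"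
      using X(2) by (intro supported_sum poly_ring_mult Const_in_poly_ring) auto
    ultimately have "(\<Sum>x\<in>X. Const (c (f * x)) * x) \<in> Q"
      using Q(1) f(2) fS unfolding poly_prime_def by blast
    then have "\<forall>x\<in>X. c (f * x) = 0"
      using X(3) unfolding indep_mod_def by (elim allE impE)
    with cY show "\<forall>y\<in>Y \<union> (*) f ` X. c y = 0"
      by auto
  qed
qed

text \<open>A step of the chain turns \<open>t choose r\<close> into \<open>t choose (r + 1)\<close> by Pascal's rule: the elements
  of degree at most \<open>E (t + 1)\<close> come from the larger prime and from multiples of some \<open>f\<close> that lies in
  the larger prime only.\<close>

lemma prime_chain_growth:
  fixes Q :: "nat \<Rightarrow> 'f::field mpoly set"
  assumes "\<And>i. i \<le> r \<Longrightarrow> poly_prime V (Q i)" "\<And>i. i < r \<Longrightarrow> Q i \<subset> Q (Suc i)"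
  shows "\<exists>E. \<forall>t. \<exists>Y. finite Y \<and> Y \<subseteq> deg_le V (E * t) \<and> card Y = t choose r \<and> indep_mod (Q 0) Y"
  using assms
proof (induction r arbitrary: Q)
  case 0
  have Q: "ideal (Q 0) (poly_ring V)" "1 \<notin> Q 0"
    using 0 by (auto simp: poly_prime_def)
  have "indep_mod (Q 0) {1}"
    unfolding indep_mod_def
  proof (intro allI impI ballI)
    fix c :: "'f mpoly \<Rightarrow> 'f" and y :: "'f mpoly"
    assume c: "(\<Sum>y\<in>{1}. Const (c y) * y) \<in> Q 0" and y: "y \<in> {1}"
    show "c y = 0"
    proof (rule ccontr)
      assume "c y \<noteq> 0"
      then have "Const (1 / c 1) * Const (c 1) = 1"
        using y by (simp flip: Const_mult)
      moreover have "Const (1 / c 1) * Const (c 1) \<in> Q 0"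
        using c by (intro ideal_poly_ringD(4)[OF Q(1)] Const_in_poly_ring) simp
      ultimately show False
        using Q(2) by simp
    qed
  qed
  then show ?case
    by (intro exI[of _ 0] allI exI[of _ "{1}"]) (auto simp: supported_def)
next
  case (Suc r)
  have "\<exists>E. \<forall>t. \<exists>Y. finite Y \<and> Y \<subseteq> deg_le V (E * t) \<and> card Y = t choose r \<and> indep_mod (Q (Suc 0)) Y"
    using Suc.IH[of "\<lambda>i. Q (Suc i)"] Suc.prems by auto
  then obtain E where E: "\<And>t. \<exists>Y. finite Y \<and> Y \<subseteq> deg_le V (E * t) \<and> card Y = t choose r \<and> indep_mod (Q (Suc 0)) Y"
    by blast
  have Q: "poly_prime V (Q 0)" "poly_prime V (Q (Suc 0))" "Q 0 \<subset> Q (Suc 0)"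
    using Suc.prems(1)[of 0] Suc.prems(1)[of "Suc 0"] Suc.prems(2)[of 0] by simp_all
  then obtain f where f: "f \<in> Q (Suc 0)" "f \<notin> Q 0"
    by blast
  have "f \<in> polys V"
    using f(1) Q(2) ideal_poly_ringD(1) unfolding poly_prime_def by blast
  then obtain e where e: "f \<in> deg_le V e"
    using ex_deg_le by blast
  \<comment> \<open>One step in \<open>t\<close> multiplies the old elements by \<open>f\<close>,
    costing degree \<open>e\<close>, and adds new ones of degree at most \<open>E * t\<close>; the
    maximum pays for both.\<close>
  define E' where "E' = max E e"
  have "\<exists>Y. finite Y \<and> Y \<subseteq> deg_le V (E' * t) \<and> card Y = t choose Suc r \<and> indep_mod (Q 0) Y" for t
  proof (induction t)
    case 0
    then show ?case
      by (intro exI[of _ "{}"]) (simp add: indep_mod_def)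
  next
    case (Suc t)
    then obtain X where X: "finite X" "X \<subseteq> deg_le V (E' * t)" "card X = t choose Suc r" "indep_mod (Q 0) X"
      by blast
    obtain Y where Y: "finite Y" "Y \<subseteq> deg_le V (E * t)" "card Y = t choose r" "indep_mod (Q (Suc 0)) Y"
      using E by blast
    have XS: "X \<subseteq> polys V" and YS: "Y \<subseteq> polys V"
      using X(2) Y(2) deg_le_subset by blast+
    note * = indep_mod_Un[OF Q(1,2) psubset_imp_subset[OF Q(3)] f Y(1) YS Y(4) X(1) XS X(4)]
    have "E * t \<le> E' * Suc t"
      unfolding E'_def by (rule mult_le_mono) auto
    moreover have "e + E' * t \<le> E' * Suc t"
      by (simp add: E'_def)
    ultimately
    have "Y \<union> (*) f ` X \<subseteq> deg_le V (E' * Suc t)"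
      using X(2) Y(2) deg_le_mult[OF e] deg_le_mono by blast
    then show ?case
      using * X Y by (intro exI[of _ "Y \<union> (*) f ` X"]) simp
  qed
  then show ?case by blast
qed

lemma vector_space_mpoly: "vector_space (\<lambda>c p. Const c * p :: 'f::field mpoly)"
  by unfold_locales (auto simp: algebra_simps Const_add Const_mult)

lemma growth_contradiction:
  fixes n E :: nat
  assumes "\<And>t. t choose (n + 1) \<le> (2 * (E * t + 1)) ^ n"
  shows False
proof -
  \<comment> \<open>With t = (n + 1) s the binomial coefficient is at least s^(n+1), while the right
    side is at most K s^n because s >= 1. The choice s = K + 1 contradicts this.\<close>
  define K where "K = (2 * (E * (n + 1) + 1)) ^ n"
  define s where "s = K + 1"
  define t where "t = (n + 1) * s"
  have "s \<ge> 1" by (simp add: s_def)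
  have "real s ^ (n + 1) = (real t / real (n + 1)) ^ (n + 1)"
    by (simp add: t_def)
  also have "\<dots> \<le> real (t choose (n + 1))"
    using \<open>s \<ge> 1\<close> by (intro binomial_ge_n_over_k_pow_k) (simp add: t_def)
  also have "\<dots> \<le> real ((2 * (E * t + 1)) ^ n)"
    using assms[of t] by (rule of_nat_mono)
  also have "(2 * (E * t + 1)) ^ n \<le> (2 * (E * (n + 1) + 1) * s) ^ n"
    using \<open>s \<ge> 1\<close> by (intro power_mono) (auto simp: t_def algebra_simps)
  finally have "s ^ (n + 1) \<le> K * s ^ n"
    unfolding K_def power_mult_distrib[symmetric] by (simp only: of_nat_power[symmetric] of_nat_le_iff)
  then have "s * s ^ n \<le> K * s ^ n"
    by (simp only: power_add power_one_right mult.commute)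
  moreover have "s ^ n > 0"
    using \<open>s \<ge> 1\<close> by simp
  ultimately have "s \<le> K"
    by (metis mult_le_cancel2)
  then show False
    by (simp add: s_def)
qed

section \<open>Upper bound for chains of primes\<close>

context gamma_resolution
begin

definition gamma_faces_le :: "nat \<Rightarrow> (nat \<Rightarrow>\<^sub>0 nat) set" where
  "gamma_faces_le D = {m. mono_in V m \<and> \<not> gamma_nonface n \<Delta> m \<and> mono_deg m \<le> D}"

lemma finite_gamma_faces_le: "finite (gamma_faces_le D)"
  by (rule finite_subset[OF _ finite_monos_le[of V D]]) (auto simp: gamma_faces_le_def)

text \<open>For each i one of the exponents of x_i and y_i is 0, so the pair lies on one of two axes
  with \<open>D + 1\<close> points each.\<close>

lemma card_gamma_faces_le: "card (gamma_faces_le D) \<le> (2 * (D + 1)) ^ n"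
proof -
  let ?P = "(\<lambda>a. (a, 0)) ` {..D} \<union> (\<lambda>a. (0, a)) ` {..D}"
  let ?g = "\<lambda>m. restrict (\<lambda>i. (lookup m i, lookup m (n + i))) {1..n}"
  have "card (gamma_faces_le D) \<le> card (PiE {1..n} (\<lambda>_. ?P))"
  proof (rule card_inj_on_le)
    show "inj_on ?g (gamma_faces_le D)"
    proof (rule inj_onI, rule poly_mapping_eqI)
      fix m m' v assume m: "m \<in> gamma_faces_le D" "m' \<in> gamma_faces_le D" and eq: "?g m = ?g m'"
      have e: "lookup m i = lookup m' i \<and>
          lookup m (n + i) = lookup m' (n + i)" if "i \<in> {1..n}" for i
        using fun_cong[OF eq, of i] that by simp
      show "lookup m v = lookup m' v"
      proof (cases "v \<in> V")
        case True
        then have "v \<in> {1..n} \<or> v - n \<in> {1..n} \<and> v = n + (v - n)"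
          by auto
        then show ?thesis
          using e by metis
      next
        case False
        then have "v \<notin> keys m" "v \<notin> keys m'"
          using m unfolding gamma_faces_le_def by blast+
        then show ?thesis
          by (simp add: in_keys_iff)
      qed
    qed
    show "?g ` gamma_faces_le D \<subseteq> PiE {1..n} (\<lambda>_. ?P)"
    proof
      fix h assume "h \<in> ?g ` gamma_faces_le D"
      then obtain m where m: "m \<in> gamma_faces_le D" "h = ?g m" by blast
      have "(lookup m i, lookup m (n + i)) \<in> ?P" if i: "i \<in> {1..n}" for i
      proof -
        have "lookup m v \<le> D" for v
          using lookup_le_mono_deg[of m v] m(1) by (simp add: gamma_faces_le_def)
        moreover have "i \<notin> xsupp n m \<or> i \<notin> ysupp n m"
          using m(1) by (auto simp: gamma_faces_le_def gamma_nonface_def)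
        then have "lookup m i = 0 \<or> lookup m (n + i) = 0"
          using i by (auto simp: xsupp_def ysupp_def in_keys_iff)
        ultimately show ?thesis by auto
      qed
      then show "h \<in> PiE {1..n} (\<lambda>_. ?P)"
        unfolding m(2) by simp
    qed
    show "finite (PiE {1..n} (\<lambda>_. ?P))"
      by (intro finite_PiE) auto
  qed
  also have "\<dots> = card ?P ^ n"
    by (simp add: card_PiE)
  also have "card ?P \<le> 2 * (D + 1)"
  proof -
    have "card ?P \<le> card ((\<lambda>a. (a, 0::nat)) ` {..D}) + card ((\<lambda>a. (0::nat, a)) ` {..D})"
      by (rule card_Un_le)
    also have "\<dots> \<le> card {..D} + card {..D}"
      by (intro add_mono card_image_le) auto
    finally show ?thesis by simp
  qed
  then have "card ?P ^ n \<le> (2 * (D + 1)) ^ n"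
    by (rule power_mono) simp
  finally show ?thesis .
qed

text \<open>Deleting the nonface monomials changes an element only by a member of \<open>I\<close>,
  hence of \<open>Q\<close>, so independence survives. The normal forms are spanned by the monomials
  in \<open>gamma_faces_le D\<close>.\<close>

lemma indep_mod_bound:
  assumes Q: "ideal Q (poly_ring V)" "I \<subseteq> Q"
    and Y: "finite Y" "Y \<subseteq> deg_le V D" "indep_mod Q Y"
  shows "card Y \<le> (2 * (D + 1)) ^ n"
proof -
  interpret vs: vector_space "\<lambda>c p. Const c * p :: 'f mpoly"
    by (rule vector_space_mpoly)
  let ?r = "restr (\<lambda>m. \<not> gamma_nonface n \<Delta> m) :: 'f mpoly \<Rightarrow> 'f mpoly"
  let ?T = "(\<lambda>m. single m (1::'f)) ` gamma_faces_le D"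
  have YS: "y \<in> S" if "y \<in> Y" for y
    using that Y(2) deg_le_subset by blast
  have rI: "y - ?r y \<in> Q" if "y \<in> S" for y
  proof -
    have "y - ?r y \<in> supported (\<lambda>m. mono_in V m \<and> \<not> \<not> gamma_nonface n \<Delta> m)"
      by (intro supported_conj[OF supported_diff diff_restr_supported] that restr_preserves_supported)
    then have "y - ?r y \<in> I"
      unfolding Gamma_ideal_eq[OF complex] mono_ideal_def by simp
    then show ?thesis
      using Q(2) by blast
  qed
  have indep: "\<forall>y\<in>Y. c y = 0" if c: "(\<Sum>y\<in>Y. Const (c y) * ?r y) = 0" for c
  proof -
    have "(\<Sum>y\<in>A. Const (c y) * (y - ?r y)) \<in> Q" if "A \<subseteq> Y" for A
      using finite_subset[OF that Y(1)] that
      by (induction A rule: finite_induct)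
        (auto intro!: ideal_poly_ringD(2-4)[OF Q(1)] rI YS Const_in_poly_ring)
    then have "(\<Sum>y\<in>Y. Const (c y) * (y - ?r y)) \<in> Q" by blast
    then have "(\<Sum>y\<in>Y. Const (c y) * y) \<in> Q"
      using c by (simp add: right_diff_distrib sum_subtractf)
    then show ?thesis
      using Y(3) unfolding indep_mod_def by blast
  qed
  \<comment> \<open>Two elements with the same normal form would satisfy a relation with
    coefficients 1 and -1.\<close>
  have inj: "inj_on ?r Y"
  proof (rule inj_onI, rule ccontr)
    fix x y assume xy: "x \<in> Y" "y \<in> Y" "?r x = ?r y" "x \<noteq> y"
    let ?c = "\<lambda>z. if z = x then 1 else if z = y then - 1 else 0 :: 'f"
    have "(\<Sum>z\<in>Y. Const (?c z) * ?r z) = (\<Sum>z\<in>{x, y}. Const (?c z) * ?r z)"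
      using xy Y(1) by (intro sum.mono_neutral_right) auto
    also have "\<dots> = 0"
      using xy by (simp add: Const_def single_uminus)
    finally have "\<forall>y\<in>Y. ?c y = 0"
      by (rule indep)
    then show False
      using xy(1) by auto
  qed
  have "vs.independent (?r ` Y)"
  proof (rule vs.independent_if_scalars_zero)
    fix c x assume "(\<Sum>x\<in>?r ` Y. Const (c x) * x) = 0" and x: "x \<in> ?r ` Y"
    then have "(\<Sum>y\<in>Y. Const (c (?r y)) * ?r y) = 0"
      by (simp add: sum.reindex[OF inj])
    then show "c x = 0"
      using indep[of "\<lambda>y. c (?r y)"] x by auto
  qed (use Y(1) in simp)
  moreover have "?r ` Y \<subseteq> vs.span ?T"
  proof
    fix z assume "z \<in> ?r ` Y"
    then obtain y where y: "y \<in> Y" "z = ?r y" by blast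
    have "y \<in> deg_le V D"
      using Y(2) y(1) by blast
    then have zs: "z \<in> supported (\<lambda>m. (mono_in V m \<and> mono_deg m \<le> D) \<and> \<not> gamma_nonface n \<Delta> m)"
      unfolding y(2) by (intro supported_conj[OF restr_preserves_supported restr_in_supported])
    have "(\<Sum>m\<in>keys z. Const (lookup z m) * single m 1) \<in> vs.span ?T"
      using zs by (intro vs.span_sum vs.span_scale vs.span_base)
        (auto simp: supported_def gamma_faces_le_def)
    then show "z \<in> vs.span ?T"
      by (simp add: Const_mult_single flip: poly_mapping_as_sum)
  qed
  ultimately have "card (?r ` Y) \<le> card ?T"
    using vs.independent_span_bound[of ?T "?r ` Y"] finite_gamma_faces_le by blast
  also have "card ?T \<le> card (gamma_faces_le D)"
    by (rule card_image_le[OF finite_gamma_faces_le])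
  also have "\<dots> \<le> (2 * (D + 1)) ^ n"
    by (rule card_gamma_faces_le)
  finally show ?thesis
    by (simp add: card_image[OF inj])
qed

text \<open>A longer chain would contain n + 2 primes, forcing at least
  \<open>t choose (n + 1)\<close> independent elements against a bound of degree n in t.\<close>

lemma prime_chain_length:
  assumes "\<And>i. i \<le> k \<Longrightarrow> poly_prime V (Q i)" "\<And>i. i < k \<Longrightarrow> Q i \<subset> Q (Suc i)" "\<And>i. i \<le> k \<Longrightarrow> I \<subseteq> Q i"
  shows "k \<le> n"
proof (rule ccontr)
  assume k: "\<not> k \<le> n"
  obtain E where E: "\<And>t. \<exists>Y. finite Y \<and> Y \<subseteq> deg_le V (E * t) \<and> card Y = t choose (n + 1) \<and> indep_mod (Q 0) Y"
    using prime_chain_growth[of "n + 1" V Q] assms k by auto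
  have "t choose (n + 1) \<le> (2 * (E * t + 1)) ^ n" for t
  proof -
    obtain Y where Y: "finite Y" "Y \<subseteq> deg_le V (E * t)" "card Y = t choose (n + 1)" "indep_mod (Q 0) Y"
      using E by blast
    have "ideal (Q 0) (poly_ring V)"
      using assms(1)[of 0] by (simp add: poly_prime_def)
    from indep_mod_bound[OF this assms(3)[of 0] Y(1,2,4)] show ?thesis
      using Y(3) by simp
  qed
  then show False
    by (rule growth_contradiction)
qed

subsection \<open>Prime ideals of \<open>R\<^sub>\<Delta>\<close> and of the polynomial ring\<close>

text \<open>The summand \<open>\<omega>\<close> of the idealization squares to zero, so that all primes contain it.\<close>

lemma pullback_prime:
  assumes "primeideal P R"
  defines "Q \<equiv> {p \<in> S. elt p 0 \<in> P}"
  shows "poly_prime V Q" "I \<subseteq> Q" "\<And>p w. p \<in> S \<Longrightarrow> w \<in> Zn \<Longrightarrow> elt p w \<in> P \<longleftrightarrow> p \<in> Q"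
proof -
  interpret primeideal P R by fact
  have Padd: "x \<oplus>\<^bsub>R\<^esub> y \<in> P" if "x \<in> P" "y \<in> P" for x y
    using additive_subgroup.a_closed[OF additive_subgroup_axioms that] .
  have P0: "elt 0 0 \<in> P"
    using additive_subgroup.zero_closed[OF additive_subgroup_axioms] by (simp add: zero_R)
  have Pmult: "elt q v \<otimes>\<^bsub>R\<^esub> x \<in> P" if "x \<in> P" "q \<in> S" "v \<in> Zn" for x q v
    using I_l_closed[OF that(1) elt_in[OF that(2,3)]] .
  have w: "elt 0 w \<in> P" if "w \<in> Zn" for w
  proof -
    have "elt 0 w \<otimes>\<^bsub>R\<^esub> elt 0 w \<in> P"
      using that P0 by (simp add: mult_R act_add)
    then show ?thesis
      using I_prime[OF elt_in elt_in] that by blast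
  qed
  show *: "elt p w \<in> P \<longleftrightarrow> p \<in> Q" if "p \<in> S" "w \<in> Zn" for p w
  proof
    assume "elt p w \<in> P"
    then have "elt p w \<oplus>\<^bsub>R\<^esub> elt 0 (- w) \<in> P"
      using w[OF Zn_uminus[OF that(2)]] by (rule Padd)
    then show "p \<in> Q"
      using that by (simp add: add_R Q_def)
  next
    assume "p \<in> Q"
    then have "elt p 0 \<oplus>\<^bsub>R\<^esub> elt 0 w \<in> P"
      using w[OF that(2)] unfolding Q_def by (intro Padd) auto
    then show "elt p w \<in> P"
      by (simp add: add_R)
  qed
  show "I \<subseteq> Q"
  proof
    fix p assume p: "p \<in> I"
    then have "elt p 0 = elt 0 0"
      using add_subgroupD(1)[OF subgroup_Bn] by (simp add: elt_eq_iff)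
    then show "p \<in> Q"
      using P0 I_in[OF p] by (simp add: Q_def)
  qed
  have "ideal Q (poly_ring V)"
  proof (rule ideal_poly_ringI)
    fix p q assume p: "p \<in> Q"
    show "p + q \<in> Q" if "q \<in> Q"
      using Padd[of "elt p 0" "elt q 0"] p that by (auto simp: Q_def add_R supported_add)
    show "q * p \<in> Q" if "q \<in> S"
      using Pmult[of "elt p 0" q 0] p that
      by (auto simp: Q_def mult_R act_add Zn_zero poly_ring_mult)
  qed (use P0 in \<open>auto simp: Q_def\<close>)
  moreover have "1 \<notin> Q"
    using one_imp_carrier I_notcarr one_in_poly_ring unfolding Q_def one_R by blast
  moreover have "p \<in> Q \<or> q \<in> Q" if "p \<in> S" "q \<in> S" "p * q \<in> Q" for p q
  proof -
    have "elt p 0 \<otimes>\<^bsub>R\<^esub> elt q 0 \<in> P"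
      using that by (simp add: mult_R act_add Zn_zero Q_def)
    then show ?thesis
      using I_prime[OF elt_in elt_in] that Zn_zero by (auto simp: Q_def)
  qed
  ultimately show "poly_prime V Q"
    by (simp add: poly_prime_def)
qed

text \<open>Adding the whole summand \<omega> to a prime containing \<open>I\<close> inverts the
  pullback; only the polynomial component matters for membership.\<close>

lemma pushforward_prime:
  assumes Q: "poly_prime V Q" "I \<subseteq> Q"
  defines "P \<equiv> {elt p w | p w. p \<in> Q \<and> w \<in> Zn}"
  shows "primeideal P R" "\<And>p w. p \<in> S \<Longrightarrow> w \<in> Zn \<Longrightarrow> elt p w \<in> P \<longleftrightarrow> p \<in> Q"
proof -
  have IQ: "ideal Q (poly_ring V)"
    using Q by (simp add: poly_prime_def)
  have QS: "p \<in> S" if "p \<in> Q" for p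
    using that ideal_poly_ringD(1)[OF IQ] by blast
  show *: "elt p w \<in> P \<longleftrightarrow> p \<in> Q" if p: "p \<in> S" and w: "w \<in> Zn" for p w
  proof
    assume "elt p w \<in> P"
    then obtain p' w' where "elt p w = elt p' w'" "p' \<in> Q"
      unfolding P_def by blast
    then have "(p - p') + p' \<in> Q"
      using Q(2) by (intro ideal_poly_ringD(3)[OF IQ]) (auto simp: elt_eq_iff)
    then show "p \<in> Q" by simp
  qed (use w in \<open>auto simp: P_def\<close>)
  interpret cring R by (rule cring_R)
  have "ideal P R"
  proof (rule idealI)
    show "ring R" by (rule ring_axioms)
    show "subgroup P (add_monoid R)"
    proof (rule group.subgroupI)
      show "Group.group (add_monoid R)"
        by (rule a_group)
      show "P \<subseteq> carrier (add_monoid R)"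
        using QS elt_in by (auto simp: P_def)
      show "P \<noteq> {}"
        using ideal_poly_ringD(2)[OF IQ] Zn_zero unfolding P_def by blast
      fix a b assume "a \<in> P" "b \<in> P"
      then obtain p v q w where "a = elt p v" "p \<in> Q" "v \<in> Zn" "b = elt q w" "q \<in> Q" "w \<in> Zn"
        unfolding P_def by blast
      moreover from this have "p + q \<in> Q" "v + w \<in> Zn"
        using ideal_poly_ringD(3)[OF IQ] Zn_add by blast+
      ultimately show "a \<otimes>\<^bsub>add_monoid R\<^esub> b \<in> P"
        unfolding P_def by (simp add: add_R) blast
    next
      fix a assume "a \<in> P"
      then obtain p v where a: "a = elt p v" "p \<in> Q" "v \<in> Zn"
        unfolding P_def by blast
      then have "\<ominus>\<^bsub>R\<^esub> a = elt (- p) (- v)"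
        by (intro minus_equality) (auto simp: add_R zero_R elt_in QS supported_uminus Zn_uminus)
      moreover have "elt (- p) (- v) \<in> P"
        using a ideal_poly_ringD(5)[OF IQ] Zn_uminus unfolding P_def by blast
      ultimately show "inv\<^bsub>add_monoid R\<^esub> a \<in> P"
        by (simp add: a_inv_def)
    qed
    fix a x assume "a \<in> P" "x \<in> carrier R"
    then obtain p v q w where ax: "a = elt p v" "p \<in> Q" "v \<in> Zn" "x = elt q w" "q \<in> S" "w \<in> Zn"
      unfolding P_def carrier_R by blast
    have "q * p \<in> Q" "act q v + act p w \<in> Zn"
      using ideal_poly_ringD(4)[OF IQ ax(2,5)] ax QS[OF ax(2)] by (simp_all add: Zn_add Zn_act)
    then show "x \<otimes>\<^bsub>R\<^esub> a \<in> P"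
      using ax QS[OF ax(2)] unfolding P_def by (simp add: mult_R) blast
    then show "a \<otimes>\<^bsub>R\<^esub> x \<in> P"
      using ax QS[OF ax(2)] by (simp add: m_comm elt_in)
  qed
  then show "primeideal P R"
  proof (rule primeidealI[OF _ cring_R])
    have "elt 1 0 \<notin> P"
      using Q(1) *[OF one_in_poly_ring Zn_zero] by (simp add: poly_prime_def)
    then show "carrier R \<noteq> P"
      using elt_in[OF one_in_poly_ring Zn_zero] by blast
    fix a b assume "a \<in> carrier R" "b \<in> carrier R" and ab: "a \<otimes>\<^bsub>R\<^esub> b \<in> P"
    then obtain p v q w where x: "a = elt p v" "p \<in> S" "v \<in> Zn" "b = elt q w" "q \<in> S" "w \<in> Zn"
      unfolding carrier_R by blast
    then have "p * q \<in> Q"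
      using ab by (simp add: mult_R * poly_ring_mult Zn_add Zn_act)
    then have "p \<in> Q \<or> q \<in> Q"
      using Q(1) x(2,5) unfolding poly_prime_def by blast
    then show "a \<in> P \<or> b \<in> P"
      using x by (simp add: *)
  qed
qed

text \<open>The ideal is the kernel of setting the variables in \<open>W\<close> to 0, a ring
  homomorphism into a ring without zero divisors.\<close>

lemma variable_prime: "poly_prime V (mono_ideal V (\<lambda>m. keys m \<inter> W \<noteq> {}) :: 'f mpoly set)"
proof -
  let ?Q = "mono_ideal V (\<lambda>m. keys m \<inter> W \<noteq> {}) :: 'f mpoly set"
  let ?r = "restr (\<lambda>m. keys m \<inter> W = {}) :: 'f mpoly \<Rightarrow> 'f mpoly"
  have r: "?r p = 0 \<longleftrightarrow> p \<in> ?Q" if "p \<in> S" for p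
  proof
    assume "?r p = 0"
    then have "lookup (?r p) m = 0" for m
      by simp
    then show "p \<in> ?Q"
      using that unfolding mono_ideal_def supported_iff lookup_restr by metis
  next
    assume "p \<in> ?Q"
    then show "?r p = 0"
      unfolding mono_ideal_def by (rule restr_eq_zero) simp
  qed
  have "p \<in> ?Q \<or> q \<in> ?Q" if "p \<in> S" "q \<in> S" "p * q \<in> ?Q" for p q
  proof -
    have "?r p * ?r q = ?r (p * q)"
      by (rule restr_mult_hom[symmetric]) (auto simp: keys_add_nat)
    also have "\<dots> = 0"
      using that by (simp add: r poly_ring_mult)
    finally show ?thesis
      using that by (simp add: r)
  qed
  moreover have "ideal ?Q (poly_ring V)"
    by (rule mono_ideal_ideal) (auto simp: up_closed_def keys_add_nat)
  moreover have "1 \<notin> ?Q"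
    by (auto simp: mono_ideal_def supported_def)
  ultimately show ?thesis
    by (simp add: poly_prime_def)
qed

lemma prime_chain_exists:
  "\<exists>P. (\<forall>i\<le>n. primeideal (P i) R) \<and> (\<forall>i<n. P i \<subset> P (Suc i))"
proof -
  \<comment> \<open>All x-variables and the first i of the y-variables. Each of these primes
    contains \<open>I\<close> because the empty set is a face, so every nonface monomial involves
    some x_i.\<close>
  define W where "W i = {1..n + i}" for i
  define Q where "Q i = (mono_ideal V (\<lambda>m. keys m \<inter> W i \<noteq> {}) :: 'f mpoly set)" for i
  have prime: "poly_prime V (Q i)" for i
    unfolding Q_def by (rule variable_prime)
  have IQ: "I \<subseteq> Q i" for i
    unfolding Q_def Gamma_ideal_eq[OF complex]
  proof (rule mono_ideal_mono)
    fix m assume m: "gamma_nonface n \<Delta> m"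
    then have "xsupp n m \<noteq> {}"
      using empty_face by (auto simp: gamma_nonface_def)
    then show "keys m \<inter> W i \<noteq> {}"
      unfolding xsupp_def W_def by fastforce
  qed simp
  define P where "P i = {elt p w | p w. p \<in> Q i \<and> w \<in> Zn}" for i
  have "P i \<subset> P (Suc i)" if i: "i < n" for i
  proof
    have "Q i \<subseteq> Q (Suc i)"
      unfolding Q_def by (rule mono_ideal_mono) (auto simp: W_def)
    then show "P i \<subseteq> P (Suc i)"
      unfolding P_def by blast
    let ?y = "single (single (n + Suc i) 1) 1 :: 'f mpoly"
    have y: "?y \<in> S" "?y \<in> Q (Suc i)" "?y \<notin> Q i"
      using i by (auto simp: Q_def mono_ideal_def supported_def W_def)
    have "elt ?y 0 \<in> P (Suc i)"
      using y(2) Zn_zero unfolding P_def by blast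
    moreover have "elt ?y 0 \<notin> P i"
      using pushforward_prime(2)[OF prime IQ y(1) Zn_zero] y(3) unfolding P_def by simp
    ultimately show "P i \<noteq> P (Suc i)"
      by blast
  qed
  moreover have "primeideal (P i) R" for i
    unfolding P_def by (rule pushforward_prime(1)[OF prime IQ])
  ultimately show ?thesis by blast
qed

lemma krull_dim_R: "krull_dim R = enat n"
proof -
  have "k \<le> n" if P: "\<And>i. i \<le> k \<Longrightarrow> primeideal (P i) R" "\<And>i. i < k \<Longrightarrow> P i \<subset> P (Suc i)" for k P
  proof (rule prime_chain_length)
    let ?Q = "\<lambda>i. {p \<in> S. elt p 0 \<in> P i}"
    show "poly_prime V (?Q i)" "I \<subseteq> ?Q i" if "i \<le> k" for i
      using pullback_prime(1,2)[OF P(1)[OF that]] .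
    fix i assume i: "i < k"
    have "P i \<subset> P (Suc i)" by (rule P(2)[OF i])
    moreover have "P (Suc i) \<subseteq> carrier R"
      using P(1)[of "Suc i"] i ideal.Icarr primeideal.axioms(1) by (metis Suc_leI subsetI)
    ultimately obtain p w where pw: "p \<in> S" "w \<in> Zn" "elt p w \<in> P (Suc i)" "elt p w \<notin> P i"
      unfolding carrier_R by blast
    have "p \<in> ?Q (Suc i)" "p \<notin> ?Q i"
      using pullback_prime(3)[OF P(1) pw(1,2)] pw(3,4) i by auto
    moreover have "?Q i \<subseteq> ?Q (Suc i)"
      using P(2)[OF i] by blast
    ultimately show "?Q i \<subset> ?Q (Suc i)"
      by blast
  qed
  then have "krull_dim R \<le> enat n"
    unfolding krull_dim_def by (intro Sup_least) (clarsimp, blast)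
  moreover have "enat n \<le> krull_dim R"
    unfolding krull_dim_def using prime_chain_exists by (intro Sup_upper) blast
  ultimately show ?thesis
    by (rule antisym)
qed

end

section \<open>The \<open>\<gamma>\<close>-vector\<close>

text \<open>The homogenized relation between h- and f-vector: after exchanging the sums, the inner
  one is the binomial expansion of (y - x)^(d-j). Keeping x and y free allows using it for the
  h-polynomial and for its reversal.\<close>

lemma h_transform:
  fixes x y :: "'a::comm_ring_1" and f h :: "nat \<Rightarrow> int"
  assumes "\<And>k. k \<le> d \<Longrightarrow> h k = (\<Sum>j=0..k. (-1) ^ (k - j) * int ((d - j) choose (d - k)) * f j)"
  shows "(\<Sum>k\<le>d. of_int (h k) * (x ^ k * y ^ (d - k))) = (\<Sum>j\<le>d. of_int (f j) * (x ^ j * (y - x) ^ (d - j)))"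
proof -
  let ?t = "\<lambda>k j. of_nat ((d - j) choose (d - k)) * y ^ (d - k) * (- x) ^ (k - j)"
  have inner: "(\<Sum>k\<in>{j..d}. ?t k j) = (y - x) ^ (d - j)" if "j \<le> d" for j
  proof -
    have "(\<Sum>k\<in>{j..d}. ?t k j) = (\<Sum>i\<le>d - j. of_nat ((d - j) choose i) * y ^ i * (- x) ^ (d - j - i))"
      using that by (intro sum.reindex_bij_witness[of _ "\<lambda>i. d - i" "\<lambda>k. d - k"]) auto
    then show ?thesis
      using binomial_ring[of y "- x" "d - j"] by simp
  qed
  have "(\<Sum>k\<le>d. of_int (h k) * (x ^ k * y ^ (d - k)))
      = (\<Sum>k\<le>d. \<Sum>j\<le>d. if j \<le> k then of_int (f j) * x ^ j * ?t k j else 0)"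
  proof (rule sum.cong[OF refl])
    fix k assume k: "k \<in> {..d}"
    have "of_int (h k) * (x ^ k * y ^ (d - k))
        = (\<Sum>j=0..k. (- 1) ^ (k - j) * of_nat ((d - j) choose (d - k)) * of_int (f j) * (x ^ k * y ^ (d - k)))"
      using k assms[of k] by (simp add: sum_distrib_right)
    also have "\<dots> = (\<Sum>j=0..k. of_int (f j) * x ^ j * ?t k j)"
    proof (rule sum.cong[OF refl])
      fix j assume "j \<in> {0..k}"
      then have "x ^ k = x ^ j * x ^ (k - j)"
        by (simp flip: power_add)
      then show "(- 1) ^ (k - j) * of_nat ((d - j) choose (d - k)) * of_int (f j) * (x ^ k * y ^ (d - k))
          = of_int (f j) * x ^ j * ?t k j"
        by (simp add: power_minus[of x] algebra_simps)
    qed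
    also have "\<dots> = (\<Sum>j\<le>d. if j \<le> k then of_int (f j) * x ^ j * ?t k j else 0)"
      using k by (intro sum.mono_neutral_cong_left) auto
    finally show "of_int (h k) * (x ^ k * y ^ (d - k))
        = (\<Sum>j\<le>d. if j \<le> k then of_int (f j) * x ^ j * ?t k j else 0)" .
  qed
  also have "\<dots> = (\<Sum>j\<le>d. \<Sum>k\<le>d. if j \<le> k then of_int (f j) * x ^ j * ?t k j else 0)"
    by (rule sum.swap)
  also have "\<dots> = (\<Sum>j\<le>d. of_int (f j) * (x ^ j * (y - x) ^ (d - j)))"
  proof (rule sum.cong[OF refl])
    fix j assume j: "j \<in> {..d}"
    have "(\<Sum>k\<le>d. if j \<le> k then of_int (f j) * x ^ j * ?t k j else 0)
        = (\<Sum>k\<in>{j..d}. of_int (f j) * x ^ j * ?t k j)"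
      by (intro sum.mono_neutral_cong_right) auto
    also have "\<dots> = of_int (f j) * x ^ j * (\<Sum>k\<in>{j..d}. ?t k j)"
      by (rule sum_distrib_left[symmetric])
    also have "\<dots> = of_int (f j) * (x ^ j * (y - x) ^ (d - j))"
      using j inner[of j] by (simp add: mult.assoc)
    finally show "(\<Sum>k\<le>d. if j \<le> k then of_int (f j) * x ^ j * ?t k j else 0)
        = of_int (f j) * (x ^ j * (y - x) ^ (d - j))" .
  qed
  finally show ?thesis .
qed

text \<open>The Girard-Waring number m/(m-i) times \<open>(m - i) choose i\<close>, written without
  division. The guard removes false values of truncated subtraction, such as 1 at
  \<open>m = i = 1\<close>. At \<open>m = 0\<close> the value is 1 although the power sum 1 + t^0 is
  2.\<close>

definition lucas_coeff :: "nat \<Rightarrow> nat \<Rightarrow> int" where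
  "lucas_coeff m i = (if 2 * i \<le> m then
     int (((m - i) choose i) + (if i = 0 then 0 else (m - i - 1) choose (i - 1))) else 0)"

lemma lucas_coeff_0 [simp]: "lucas_coeff m 0 = 1"
  by (simp add: lucas_coeff_def)

text \<open>Pascal's rule in both binomial coefficients. It fails at \<open>m = 0\<close>, where the
  exceptional value \<open>lucas_coeff 0 0 = 1\<close> would enter.\<close>

lemma lucas_coeff_rec:
  assumes "m \<ge> 1"
  shows "lucas_coeff (m + 2) (Suc i) = lucas_coeff (m + 1) (Suc i) + lucas_coeff m i"
proof -
  consider "2 * i < m" | "2 * i = m" | "m < 2 * i"
    by linarith
  then show ?thesis
  proof cases
    case 1
    then obtain l where l: "m = i + Suc l"
      using less_imp_Suc_add[of i m] by auto
    have a: "m + 2 - Suc i = Suc (Suc l)" "m + 1 - Suc i = Suc l" "m - i = Suc l"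
      "Suc (Suc l) - 1 = Suc l" "Suc l - 1 = l" "Suc i - 1 = i" "Suc i \<noteq> 0"
      using l by simp_all
    have c: "2 * Suc i \<le> m + 2" "2 * Suc i \<le> m + 1" "2 * i \<le> m"
      using 1 by simp_all
    show ?thesis
      unfolding lucas_coeff_def a using c a(7) by (cases i) simp_all
  next
    case 2
    then obtain l where l: "i = Suc l"
      using assms by (cases i) auto
    show ?thesis
      unfolding lucas_coeff_def 2[symmetric] l by simp
  next
    case 3
    then show ?thesis
      by (simp add: lucas_coeff_def)
  qed
qed

text \<open>Newton's recurrence 1 + t^(l+2) = (1 + t)(1 + t^(l+1)) - t (1 + t^l) for the power sums
  of 1 and t matches \<open>lucas_coeff_rec\<close>.\<close>

lemma power_sum_expansion:
  fixes t :: "'a::comm_ring_1"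
  assumes "m \<ge> 1"
  shows "1 + t ^ m = (\<Sum>i\<le>m. of_int ((-1) ^ i * lucas_coeff m i) * (t ^ i * (1 + t) ^ (m - 2 * i)))"
  using assms
proof (induction m rule: less_induct)
  case (less m)
  let ?L = "\<lambda>m i. of_int ((-1) ^ i * lucas_coeff m i) * (t ^ i * (1 + t) ^ (m - 2 * i))"
  let ?M = "\<lambda>c i. of_int ((-1) ^ i * c) * (t ^ i * (1 + t) ^ (m - 2 * i))"
  consider "m = 1" | "m = 2" | "m \<ge> 3"
    using less.prems by linarith
  then show ?case
  proof cases
    case 1
    then show ?thesis
      by (simp add: lucas_coeff_def One_nat_def)
  next
    \<comment> \<open>The recurrence would refer back to exponent 0, which the expansion does not
      cover.\<close>
    case 2
    have "lucas_coeff 2 1 = 2" "lucas_coeff 2 2 = 0"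
      by (simp_all add: lucas_coeff_def One_nat_def)
    then show ?thesis
      unfolding 2 by (simp add: numeral_2_eq_2 One_nat_def algebra_simps)
  next
    case 3
    then obtain l where l: "m = l + 2" "l \<ge> 1"
      using le_Suc_ex[of 2 m] by auto
    have "1 + t ^ m = (1 + t) * (1 + t ^ (l + 1)) - t * (1 + t ^ l)"
      by (simp add: l One_nat_def algebra_simps)
    also have "\<dots> = (1 + t) * (\<Sum>i\<le>l + 1. ?L (l + 1) i) - t * (\<Sum>i\<le>l. ?L l i)"
      using less.IH[of "l + 1"] less.IH[of l] l by simp
    also have "(1 + t) * (\<Sum>i\<le>l + 1. ?L (l + 1) i)
        = (\<Sum>i\<le>l + 1. ?M (lucas_coeff (l + 1) i) i)"
      unfolding sum_distrib_left
    proof (rule sum.cong[OF refl])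
      fix i
      show "(1 + t) * ?L (l + 1) i
          = ?M (lucas_coeff (l + 1) i) i"
      proof (cases "2 * i \<le> l + 1")
        case True
        then have "m - 2 * i = Suc (l + 1 - 2 * i)"
          using l by simp
        then show ?thesis
          by (simp add: algebra_simps)
      qed (simp add: lucas_coeff_def)
    qed
    also have "\<dots> = (1 + t) ^ m
        + (\<Sum>i\<le>l. ?M (lucas_coeff (l + 1) (Suc i)) (Suc i))"
      unfolding Suc_eq_plus1[symmetric] sum.atMost_Suc_shift by simp
    also have "t * (\<Sum>i\<le>l. ?L l i)
        = - (\<Sum>i\<le>l. ?M (lucas_coeff l i) (Suc i))"
      unfolding sum_distrib_left sum_negf[symmetric] by (intro sum.cong refl) (simp add: l algebra_simps)
    also have "(1 + t) ^ m
        + (\<Sum>i\<le>l. ?M (lucas_coeff (l + 1) (Suc i)) (Suc i))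
        - - (\<Sum>i\<le>l. ?M (lucas_coeff l i) (Suc i))
        = (1 + t) ^ m + (\<Sum>i\<le>l. ?L m (Suc i))"
      unfolding diff_minus_eq_add add.assoc sum.distrib[symmetric]
      by (intro arg_cong2[of _ _ _ _ "(+)"] refl sum.cong)
        (simp add: l(1) lucas_coeff_rec[OF l(2), simplified] algebra_simps)
    also have "\<dots> = (\<Sum>i\<le>Suc l. ?L m i)"
      unfolding sum.atMost_Suc_shift by simp
    also have "\<dots> = (\<Sum>i\<le>m. ?L m i)"
      using l by (intro sum.mono_neutral_left) (auto simp: lucas_coeff_def)
    finally show ?thesis .
  qed
qed

text \<open>From t^k + t = t (1 + t^(k-1)): for \<open>k >= 2\<close> the power sum expansion is
  shifted by one in both indices. For \<open>k = 1\<close> the factor is 2t, and for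
  \<open>k = 0\<close> it is 1 + t.\<close>

definition gamma_coeff :: "nat \<Rightarrow> nat \<Rightarrow> int" where
  "gamma_coeff k i = (if k = 0 then (if i = 0 then 1 else 0)
     else if k = 1 then (if i = 1 then 2 else 0)
     else if i = 0 then 0 else (-1) ^ (i - 1) * lucas_coeff (k - 1) (i - 1))"

lemma gamma_expansion:
  fixes t :: "'a::comm_ring_1"
  assumes "k \<le> d"
  shows "(t ^ k + t) * (1 + t) ^ (d - k)
    = (\<Sum>i=0..(d + 1) div 2. of_int (gamma_coeff k i) * (t ^ i * (1 + t) ^ (d + 1 - 2 * i)))"
proof -
  let ?g = "\<lambda>i. of_int (gamma_coeff k i) * (t ^ i * (1 + t) ^ (d + 1 - 2 * i))"
  consider "k = 0" | "k = 1" | "k \<ge> 2"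
    by linarith
  then show ?thesis
  proof cases
    case 1
    have "(\<Sum>i=0..(d + 1) div 2. ?g i)
        = (\<Sum>i\<in>{0}. ?g i)"
      by (intro sum.mono_neutral_right) (auto simp: gamma_coeff_def 1)
    then show ?thesis
      by (simp add: gamma_coeff_def 1 One_nat_def)
  next
    case 2
    have "(\<Sum>i=0..(d + 1) div 2. ?g i)
        = (\<Sum>i\<in>{1}. ?g i)"
      using assms 2 by (intro sum.mono_neutral_right) (auto simp: gamma_coeff_def)
    then show ?thesis
      by (simp add: gamma_coeff_def 2 One_nat_def algebra_simps)
  next
    case 3
    have "t ^ k = t * t ^ (k - 1)"
      using 3 by (simp flip: power_Suc)
    then have "(t ^ k + t) * (1 + t) ^ (d - k) = t * (1 + t ^ (k - 1)) * (1 + t) ^ (d - k)"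
      by (simp add: algebra_simps)
    also have "\<dots> = (\<Sum>i\<le>k - 1. t * (of_int ((-1) ^ i * lucas_coeff (k - 1) i) * (t ^ i * (1 + t) ^ (k - 1 - 2 * i)))
        * (1 + t) ^ (d - k))"
      using 3 power_sum_expansion[of "k - 1" t] by (simp add: sum_distrib_left sum_distrib_right)
    also have "\<dots> = (\<Sum>i\<le>k - 1. ?g (Suc i))"
    proof (rule sum.cong[OF refl])
      fix i
      show "t * (of_int ((-1) ^ i * lucas_coeff (k - 1) i) * (t ^ i * (1 + t) ^ (k - 1 - 2 * i)))
          * (1 + t) ^ (d - k) = ?g (Suc i)"
      proof (cases "2 * i \<le> k - 1")
        case True
        then obtain r e where "k - 1 = 2 * i + r" "d = k + e"
          using assms by (auto simp: le_iff_add)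
        then have "d + 1 - 2 * Suc i = (k - 1 - 2 * i) + (d - k)"
          using 3 by simp
        then have "(1 + t) ^ (d + 1 - 2 * Suc i) = (1 + t) ^ (k - 1 - 2 * i) * (1 + t) ^ (d - k)"
          by (simp only: power_add)
        then show ?thesis
          using 3 by (simp add: gamma_coeff_def algebra_simps)
      qed (use 3 in \<open>simp add: gamma_coeff_def lucas_coeff_def\<close>)
    qed
    also have "\<dots> = (\<Sum>i\<le>k. ?g i)"
    proof -
      have "k = Suc (k - 1)" using 3 by simp
      then have "(\<Sum>i\<le>k. ?g i) = ?g 0 + (\<Sum>i\<le>k - 1. ?g (Suc i))"
        using sum.atMost_Suc_shift[of ?g "k - 1"] by simp
      then show ?thesis
        using 3 by (simp add: gamma_coeff_def)
    qed
    \<comment> \<open>Neither of the ranges up to \<open>k\<close> and up to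
      \<open>(d + 1) div 2\<close> contains the other in general; both contain this one, outside of
      which the coefficients vanish.\<close>
    also have "\<dots> = (\<Sum>i\<in>{i. 2 * i \<le> k + 1}. ?g i)"
    proof (rule sum.mono_neutral_right)
      show "\<forall>i\<in>{..k} - {i. 2 * i \<le> k + 1}. ?g i = 0"
        using 3 by (auto simp: gamma_coeff_def lucas_coeff_def)
    qed (use 3 in auto)
    also have "\<dots> = (\<Sum>i=0..(d + 1) div 2. ?g i)"
    proof (rule sum.mono_neutral_left)
      show "\<forall>i\<in>{0..(d + 1) div 2} - {i. 2 * i \<le> k + 1}. ?g i = 0"
        using 3 by (auto simp: gamma_coeff_def lucas_coeff_def)
    qed (use assms in auto)
    finally show ?thesis .
  qed
qed

definition gamma_sum :: "nat \<Rightarrow> nat \<Rightarrow> (nat \<Rightarrow> int) \<Rightarrow> int poly" where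
  "gamma_sum N s g = (\<Sum>i=0..N. Polynomial.smult (g i) ([:0, 1:] ^ i * [:1, 1:] ^ (s - 2 * i)))"

text \<open>The i-th basis polynomial has lowest term t^i with coefficient 1, so the system for the
  coefficients is unitriangular.\<close>

lemma gamma_basis_unique:
  fixes g g' :: "nat \<Rightarrow> int"
  assumes "gamma_sum N s g = gamma_sum N s g'"
    and "i \<le> N"
  shows "g i = g' i"
  using assms(2)
proof (induction i rule: less_induct)
  case (less i)
  have c: "poly.coeff ([:0, 1:] ^ j * [:1, 1:] ^ (s - 2 * j)) i
      = (if i < j then 0 else poly.coeff ([:1, 1:] ^ (s - 2 * j)) (i - j) :: int)" for j :: nat
    using coeff_monom_mult[of "1::int" j "[:1, 1:] ^ (s - 2 * j)" i] by (simp add: monom_altdef)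
  have c0: "poly.coeff ([:1, 1:] ^ k) 0 = (1::int)" for k
    by (induction k) auto
  let ?e = "\<lambda>g j. g j * poly.coeff ([:0, 1:] ^ j * [:1, 1:] ^ (s - 2 * j)) i :: int"
  have split: "(\<Sum>j=0..N. ?e g j) = (\<Sum>j<i. ?e g j) + g i" for g
  proof -
    have "(\<Sum>j=0..N. ?e g j) = (\<Sum>j\<le>i. ?e g j)"
      using less.prems by (intro sum.mono_neutral_right) (auto simp: c)
    also have "\<dots> = (\<Sum>j<i. ?e g j) + ?e g i"
      by (simp flip: lessThan_Suc_atMost)
    finally show ?thesis
      by (simp add: c c0)
  qed
  have "poly.coeff (gamma_sum N s g) i = poly.coeff (gamma_sum N s g') i"
    by (simp only: assms(1))
  then have "(\<Sum>j<i. ?e g j) + g i = (\<Sum>j<i. ?e g' j) + g' i"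
    unfolding gamma_sum_def coeff_sum coeff_smult split .
  moreover have "(\<Sum>j<i. ?e g j) = (\<Sum>j<i. ?e g' j)"
    using less by (intro sum.cong) auto
  ultimately show ?case
    by simp
qed

context gamma_resolution
begin

definition face_poly :: "int poly" where
  "face_poly = (\<Sum>F\<in>\<Delta>. [:0, 1:] ^ card F + [:0, 1:] ^ (d + 1 - card F))"

lemma h_polynomial_R: "h_polynomial R = face_poly"
proof -
  have X: "fps_of_poly [:0, 1:] = (fps_X :: int fps)"
    by (simp add: fps_of_poly_pCons)
  have "hilbert_series R * (1 - fps_X) ^ n = fps_of_poly face_poly"
    unfolding hilbert_series_R face_poly_def
    by (simp add: fps_of_poly_sum fps_of_poly_add fps_of_poly_power X)
  then show ?thesis
    unfolding h_polynomial_def krull_dim_R by (auto simp: fps_of_poly_eq_iff)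
qed

text \<open>Faces have at most d elements, so t^(d+1) arises only from the second summand of the
  empty face.\<close>

lemma degree_face_poly: "Polynomial.degree face_poly = d + 1"
proof (rule antisym)
  have coeff: "poly.coeff ([:0, 1:] ^ j :: int poly) k = (if j = k then 1 else 0)" for j k
    by (metis coeff_monom monom_altdef smult_1_left)
  show "Polynomial.degree face_poly \<le> d + 1"
  proof (rule degree_le, intro allI impI)
    fix k assume "d + 1 < k"
    then show "poly.coeff face_poly k = 0"
      unfolding face_poly_def coeff_sum coeff_add coeff
      by (intro sum.neutral ballI) (use card_face_le in force)
  qed
  have "poly.coeff face_poly (d + 1) = (\<Sum>F\<in>\<Delta>. if F = {} then 1 else 0)"
    unfolding face_poly_def coeff_sum coeff_add coeff
  proof (rule sum.cong[OF refl])
    fix F assume F: "F \<in> \<Delta>"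
    have "d + 1 - card F = d + 1 \<longleftrightarrow> F = {}"
      using finite_face[OF F] card_face_le[OF F] card_gt_0_iff[of F] by (cases "F = {}") auto
    then show "(if card F = d + 1 then 1 else 0) + (if d + 1 - card F = d + 1 then 1 else 0)
        = (if F = {} then 1 else (0::int))"
      using card_face_le[OF F] by auto
  qed
  also have "\<dots> = 1"
    using empty_face finite_Delta by simp
  finally show "d + 1 \<le> Polynomial.degree face_poly"
    by (intro le_degree) simp
qed

lemma sum_faces:
  fixes \<phi> :: "nat \<Rightarrow> int poly"
  shows "(\<Sum>F\<in>\<Delta>. \<phi> (card F)) = (\<Sum>j\<le>d. of_int (int (f_vector \<Delta> (int j - 1))) * \<phi> j)"
proof -
  have "(\<Sum>F\<in>\<Delta>. \<phi> (card F)) = (\<Sum>j\<le>d. \<Sum>F\<in>{F \<in> \<Delta>. card F = j}. \<phi> (card F))"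
    using card_face_le finite_Delta by (intro sum.group[symmetric]) auto
  also have "\<dots> = (\<Sum>j\<le>d. of_int (int (f_vector \<Delta> (int j - 1))) * \<phi> j)"
    by (intro sum.cong refl) (simp add: f_vector_def face_dim_def)
  finally show ?thesis .
qed

lemma h_vector_eq:
  "h_vector \<Delta> k
    = (\<Sum>j=0..k. (-1) ^ (k - j) * int ((d - j) choose (d - k)) * int (f_vector \<Delta> (int j - 1)))"
  by (simp add: h_vector_def complex_dim Let_def)

definition gamma_entry :: "nat \<Rightarrow> int" where
  "gamma_entry i = (\<Sum>k\<le>d. h_vector \<Delta> k * gamma_coeff k i)"

lemma face_poly_expansion:
  "gamma_sum ((d + 1) div 2) (d + 1) gamma_entry = face_poly"
proof -
  define T :: "int poly" where "T = [:0, 1:]"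
  let ?h = "h_vector \<Delta>" and ?f = "\<lambda>j. int (f_vector \<Delta> (int j - 1))"
  have U: "[:1, 1:] = 1 + T"
    by (simp add: T_def one_pCons)
  have "face_poly = (\<Sum>j\<le>d. of_int (?f j) * (T ^ j + T ^ (d + 1 - j)))"
    unfolding face_poly_def T_def by (rule sum_faces)
  \<comment> \<open>Prepares \<open>h_transform\<close> at (x, y) = (T, 1 + T) and at (1, 1 + T),
    where y - x is 1 and T; one factor T is split off T^(d+1-j).\<close>
  also have "\<dots> = (\<Sum>j\<le>d. of_int (?f j) * (T ^ j * (1 + T - T) ^ (d - j)))
      + T * (\<Sum>j\<le>d. of_int (?f j) * (1 ^ j * (1 + T - 1) ^ (d - j)))"
    unfolding sum_distrib_left sum.distrib[symmetric]
    by (intro sum.cong refl) (simp add: Suc_diff_le One_nat_def algebra_simps)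
  also have "\<dots> = (\<Sum>k\<le>d. of_int (?h k) * (T ^ k * (1 + T) ^ (d - k)))
      + T * (\<Sum>k\<le>d. of_int (?h k) * (1 ^ k * (1 + T) ^ (d - k)))"
    by (simp only: h_transform[of d ?h ?f, OF h_vector_eq])
  also have "\<dots> = (\<Sum>k\<le>d. of_int (?h k) * ((T ^ k + T) * (1 + T) ^ (d - k)))"
    unfolding sum_distrib_left sum.distrib[symmetric] by (intro sum.cong refl) (simp add: algebra_simps)
  also have "\<dots> = (\<Sum>k\<le>d. \<Sum>i=0..(d + 1) div 2.
      of_int (?h k * gamma_coeff k i) * (T ^ i * (1 + T) ^ (d + 1 - 2 * i)))"
    by (intro sum.cong refl) (simp add: gamma_expansion[of _ d] sum_distrib_left mult.assoc)
  also have "\<dots> = (\<Sum>i=0..(d + 1) div 2. \<Sum>k\<le>d.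
      of_int (?h k * gamma_coeff k i) * (T ^ i * (1 + T) ^ (d + 1 - 2 * i)))"
    by (rule sum.swap)
  also have "\<dots> = (\<Sum>i=0..(d + 1) div 2. of_int (gamma_entry i) * (T ^ i * (1 + T) ^ (d + 1 - 2 * i)))"
    unfolding gamma_entry_def of_int_sum sum_distrib_right ..
  finally show ?thesis
    unfolding gamma_sum_def U T_def[symmetric] by (simp add: of_int_poly)
qed

lemma gamma_vector_R: "gamma_vector R = map gamma_entry [0..<(d + 1) div 2 + 1]"
proof -
  let ?N = "(d + 1) div 2"
  let ?P = "\<lambda>g. length g = ?N + 1 \<and> gamma_sum ?N (d + 1) (\<lambda>i. g ! i) = face_poly"
  have "(THE g. ?P g) = map gamma_entry [0..<?N + 1]"
  proof (rule the_equality)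
    have "gamma_sum ?N (d + 1) (\<lambda>i. map gamma_entry [0..<?N + 1] ! i) = face_poly"
      unfolding face_poly_expansion[symmetric] gamma_sum_def
      by (intro sum.cong refl) (simp del: upt_Suc)
    then show "?P (map gamma_entry [0..<?N + 1])"
      by simp
    fix g assume g: "?P g"
    have "g ! i = gamma_entry i" if "i \<le> ?N" for i
    proof (rule gamma_basis_unique[OF _ that])
      show "gamma_sum ?N (d + 1) (\<lambda>i. g ! i) = gamma_sum ?N (d + 1) gamma_entry"
        using g face_poly_expansion by simp
    qed
    then show "g = map gamma_entry [0..<?N + 1]"
      using g by (intro nth_equalityI) (auto simp del: upt_Suc)
  qed
  then show ?thesis
    unfolding gamma_vector_def h_polynomial_R degree_face_poly Let_def gamma_sum_def .
qed

lemma gamma_entry_0: "gamma_entry 0 = 1"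
proof -
  have "gamma_entry 0 = (\<Sum>k\<le>d. if k = 0 then h_vector \<Delta> 0 else 0)"
    unfolding gamma_entry_def by (intro sum.cong refl) (auto simp: gamma_coeff_def)
  also have "\<dots> = int (card {F \<in> \<Delta>. face_dim F = - 1})"
    by (simp add: h_vector_eq f_vector_def)
  also have "{F \<in> \<Delta>. face_dim F = - 1} = {{}}"
    using empty_face finite_face by (auto simp: face_dim_def)
  finally show ?thesis
    by simp
qed

lemma gamma_entry_1:
  assumes "1 \<le> d"
  shows "gamma_entry 1 = 2 * h_vector \<Delta> 1 + (\<Sum>k=2..d. h_vector \<Delta> k)"
proof -
  have "{..d} = {0, 1} \<union> {2..d}"
    using assms by auto
  then have "gamma_entry 1 = (\<Sum>k\<in>{0, 1} \<union> {2..d}. h_vector \<Delta> k * gamma_coeff k 1)"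
    by (simp only: gamma_entry_def)
  also have "\<dots> = (\<Sum>k\<in>{0, 1}. h_vector \<Delta> k * gamma_coeff k 1) + (\<Sum>k\<in>{2..d}. h_vector \<Delta> k * gamma_coeff k 1)"
    by (rule sum.union_disjoint) auto
  also have "(\<Sum>k\<in>{2..d}. h_vector \<Delta> k * gamma_coeff k 1) = (\<Sum>k=2..d. h_vector \<Delta> k)"
    by (intro sum.cong refl) (simp add: gamma_coeff_def)
  finally show ?thesis
    by (simp add: gamma_coeff_def)
qed

text \<open>The summation starts at 2i - 1 because \<open>lucas_coeff (k - 1) (i - 1)\<close>
  vanishes unless 2 (i - 1) <= k - 1.\<close>

lemma gamma_entry_ge_2:
  assumes "2 \<le> i"
  shows "gamma_entry i = (-1) ^ (i - 1) *
    (\<Sum>k=2 * i - 1..d. int (((k - i) choose (i - 1)) + ((k - i - 1) choose (i - 2))) * h_vector \<Delta> k)"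
proof -
  have "gamma_entry i = (\<Sum>k=2 * i - 1..d. h_vector \<Delta> k * gamma_coeff k i)"
    unfolding gamma_entry_def
  proof (rule sum.mono_neutral_right)
    show "\<forall>k\<in>{..d} - {2 * i - 1..d}. h_vector \<Delta> k * gamma_coeff k i = 0"
      using assms by (auto simp: gamma_coeff_def lucas_coeff_def)
  qed auto
  also have "\<dots> = (\<Sum>k=2 * i - 1..d. (-1) ^ (i - 1) *
      (int (((k - i) choose (i - 1)) + ((k - i - 1) choose (i - 2))) * h_vector \<Delta> k))"
  proof (rule sum.cong[OF refl])
    fix k assume k: "k \<in> {2 * i - 1..d}"
    have "k - 1 - (i - 1) = k - i" "i - 1 - 1 = i - 2" "2 * (i - 1) \<le> k - 1" "i - 1 \<noteq> 0"
      using k assms by auto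
    then have "lucas_coeff (k - 1) (i - 1) = int (((k - i) choose (i - 1)) + ((k - i - 1) choose (i - 2)))"
      by (simp only: lucas_coeff_def if_True if_False)
    moreover have "k \<noteq> 0" "k \<noteq> 1" "i \<noteq> 0"
      using k assms by auto
    ultimately show "h_vector \<Delta> k * gamma_coeff k i = (-1) ^ (i - 1) *
        (int (((k - i) choose (i - 1)) + ((k - i - 1) choose (i - 2))) * h_vector \<Delta> k)"
      by (simp only: gamma_coeff_def if_False mult.assoc mult.commute mult.left_commute)
  qed
  finally show ?thesis
    by (simp only: sum_distrib_left)
qed

end

theorem theorem4:
  fixes n d :: nat and \<Delta> :: "nat set set"
    and \<rho> :: "('f::field mpoly, 'f mpoly set) resolution"
  assumes "simplicial_complex_on n \<Delta>"
    and "pure_complex \<Delta>"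
    and "complex_dim \<Delta> = int d - 1"
    and "graded_free_resolution {1..2 * n} (Gamma_module n \<Delta>) (Gamma_grade n \<Delta>) \<rho>"
  shows "let \<gamma> = gamma_vector (R_Delta n \<Delta> \<rho>); h = h_vector \<Delta> in
    length \<gamma> = (d + 1) div 2 + 1 \<and>
    \<gamma> ! 0 = 1 \<and>
    (1 \<le> (d + 1) div 2 \<longrightarrow> \<gamma> ! 1 = 2 * h 1 + (\<Sum>k=2..d. h k)) \<and>
    (\<forall>i. 2 \<le> i \<and> i \<le> (d + 1) div 2 \<longrightarrow>
       \<gamma> ! i = (-1) ^ (i - 1) *
         (\<Sum>k=2 * i - 1..d. int (((k - i) choose (i - 1)) + ((k - i - 1) choose (i - 2))) * h k)) \<and>
    ((\<forall>k\<le>d. 0 \<le> h k) \<longrightarrow>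
       (\<forall>i. 1 \<le> i \<and> i \<le> (d + 1) div 2 \<longrightarrow> 0 \<le> (-1) ^ (i - 1) * \<gamma> ! i))"
proof -
  interpret gamma_resolution n d \<Delta> \<rho>
    using assms(1,3,4) by (rule gamma_resolution.intro)
  let ?N = "(d + 1) div 2"
  have nth: "gamma_vector R ! i = gamma_entry i" if "i \<le> ?N" for i
    using that by (simp add: gamma_vector_R del: upt_Suc)
  have "0 \<le> (-1) ^ (i - 1) * gamma_entry i"
    if h: "\<forall>k\<le>d. 0 \<le> h_vector \<Delta> k" and i: "1 \<le> i" "i \<le> ?N" for i
  proof (cases "i = 1")
    case True
    have "1 \<le> d" using i by linarith
    then show ?thesis
      using h True by (auto simp: gamma_entry_1 intro!: add_nonneg_nonneg sum_nonneg)
  next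
    case False
    then have "gamma_entry i = (-1) ^ (i - 1) *
        (\<Sum>k=2 * i - 1..d. int (((k - i) choose (i - 1)) + ((k - i - 1) choose (i - 2))) * h_vector \<Delta> k)"
      using i by (intro gamma_entry_ge_2) simp
    moreover have "0 \<le> (\<Sum>k=2 * i - 1..d.
        int (((k - i) choose (i - 1)) + ((k - i - 1) choose (i - 2))) * h_vector \<Delta> k)"
      using h by (intro sum_nonneg mult_nonneg_nonneg) auto
    \<comment> \<open>The sign occurs twice and squares to 1.\<close>
    ultimately show ?thesis
      by (simp flip: mult.assoc power_add power_mult_distrib)
  qed
  moreover have "length (gamma_vector R) = ?N + 1"
    by (simp add: gamma_vector_R)
  moreover have "1 \<le> ?N \<longrightarrow> gamma_entry 1 = 2 * h_vector \<Delta> 1 + (\<Sum>k=2..d. h_vector \<Delta> k)"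
    by (intro impI gamma_entry_1) linarith
  ultimately show ?thesis
    unfolding Let_def using gamma_entry_0 gamma_entry_ge_2 by (simp add: nth del: upt_Suc)
qed

end
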